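(* Let $\{\xi',\xi''\}\in\mathcal P'\times\mathcal P''$ be a potential. Solve the two independent initial value problems $$\mathrm d'\Psi'=\Psi'\,\xi',\qquad \mathrm d''\Psi''=\Psi''\,\xi'',\qquad \Psi'(x=0)=\Psi''(y=0)=\mathbf 1 ,$$ where $\mathrm d'=\frac{\partial}{\partial x}\mathrm dx$ and $\mathrm d''=\frac{\partial}{\partial y}\mathrm dy$. Then the Iwasawa decomposition $$(\Psi',\Psi'')=(\Psi,\Psi)\,(L_-^{-1},L_+^{-1})\in\Delta(\tilde\Lambda G_\sigma\times\tilde\Lambda G_\sigma)\cdot\bigl(\tilde\Lambda^-_*G_\sigma\times\tilde\Lambda^+G_\sigma\bigr)$$ gives an extended framing $\Psi$. Hence $\psi:=\mathrm{Ad}(\Psi)\mathbf k'$ gives a loop of harmonic maps into $S^2_1$.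
   Context: $G=\mathrm{SL}(2;\mathbb R)$, $\mathfrak g=\mathfrak{sl}(2;\mathbb R)$ with $\langle X,Y\rangle=\frac12\mathrm{tr}(XY)$ (a Lorentzian scalar product identifying $\mathfrak g$ with Minkowski 3-space), $\mathbf k'=\mathrm{diag}(-1,1)$, $S^2_1=\{X\in\mathfrak g:\langle X,X\rangle=1\}$ with its induced Lorentz metric. $\mathrm{Ad}(g)X=gXg^{-1}$. $\mathfrak k$ and $\mathfrak m$ are the subspaces of diagonal and of off-diagonal matrices in $\mathfrak g$; $S^2_1=G/K$ with $K$ the diagonal subgroup of $G$. $\sigma$ denotes conjugation by $\mathbf k'$ (on $\mathfrak g$ and on $G$). Loop groups: $\Lambda\mathfrak g$ is the Banach Lie algebra of loops $\xi(\lambda)=\sum_{j\in\mathbb Z}\xi_j\lambda^j$, $\lambda\in S^1$, with real coefficients $\xi_j\in\mathfrak g$ and $\sum_j|\xi_j|<\infty$; $\Lambda\mathfrak g_\sigma=\{\xi\in\Lambda\mathfrak g:\sigma(\xi(\lambda))=\xi(-\lambda)\}$ (so even coefficients lie in $\mathfrak k$, odd ones in $\mathfrak m$). $\Lambda G$ is the corresponding Banach Lie group of loops $\gamma(\lambda)=\sum_j\gamma_j\lambda^j$ with real $2\times2$ coefficients, $\sum_j|\gamma_j|<\infty$, $\det\gamma=1$; $\Lambda G_\sigma=\{\gamma\in\Lambda G:\sigma(\gamma(\lambda))=\gamma(-\lambda)\}$. $\tilde\Lambda G_\sigma$ is the subgroup of those $\gamma\in\Lambda G_\sigma$ which extend analytically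 to $\lambda\in\mathbb C^*$, with the topology induced from $\Lambda G_\sigma$. $\tilde\Lambda^{+}G_\sigma$ (resp. $\tilde\Lambda^{-}G_\sigma$) consists of the elements of $\tilde\Lambda G_\sigma$ with only powers $\lambda^j$, $j\ge0$ (resp. $j\le0$); $\tilde\Lambda^{\pm}_*G_\sigma$ consists of those elements of $\tilde\Lambda^\pm G_\sigma$ whose $\lambda^0$-coefficient is $\mathbf 1$. $\Delta(\tilde\Lambda G_\sigma\times\tilde\Lambda G_\sigma)$ is the diagonal subgroup of $\tilde\Lambda G_\sigma\times\tilde\Lambda G_\sigma$. $\mathbb D$ is a simply connected region of the Minkowski plane $(\mathbb R^2(x,y),\mathrm dx\,\mathrm dy)$ containing the origin. $\mathcal P'$ is the space of Lorentz holomorphic 1-forms on $\mathbb D$ of the form $\xi'=\left(\sum_{k=-\infty}^{1}\xi'_k(x)\lambda^k\right)\mathrm dx$, and $\mathcal P''$ is the space of Lorentz anti-holomorphic 1-forms on $\mathbb D$ of the form $\xi''=\left(\sum_{k=-1}^{\infty}\xi''_k(y)\lambda^k\right)\mathrm dy$; the sums take values in $\Lambda\mathfrak g_\sigma$, and the coefficients $\xi'_k$ are smooth functions of $x$ only, the coefficients $\xi''_k$ smooth functions of $y$ only. An extended framing is a smooth map $\Psi=\Psi_\lambda:\mathbb D\to\tilde\Lambda G_\sigma$ with $\Psi_\lambda(0,0)=\mathbf 1$ for all $\lambda$, $\Psi^{-1}\Psi_x=A+\lambda B$ and $\Psi^{-1}\Psi_y=C+\lambda^{-1}D$, where $A,C$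 are $\mathfrak k$-valued and $B,D$ are $\mathfrak m$-valued functions on $\mathbb D$ independent of $\lambda$. A smooth map $\psi$ into $S^2_1$ is harmonic if its tension field with respect to $\mathrm dx\,\mathrm dy$ vanishes; equivalently $\psi_{xy}=\rho\,\psi$ for some function $\rho$. A loop of harmonic maps is a family $\psi_\lambda$ of harmonic maps depending on the parameter $\lambda\in\mathbb R^+$; here $\psi_\lambda=\mathrm{Ad}(\Psi_\lambda)\mathbf k'$.
   Formalization: The potentials are taken smooth as maps into the Banach space of loops, not only coefficientwise, and the Iwasawa decomposition, which can fail on parts of the region, is assumed on an open subset containing the origin, where the framing and harmonicity are proved. *)

theory Defs
  imports "HOL-Analysis.Analysis"
begin

section \<open>Absolutely summable loops of real two by two matrices\<close>

type_synonym mat2 = "real^2^2"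

lemma norm_mat2_sq: "(norm (A::mat2))\<^sup>2 = (A$1$1)\<^sup>2 + (A$1$2)\<^sup>2 + (A$2$1)\<^sup>2 + (A$2$2)\<^sup>2"
  by (simp add: norm_vec_def L2_set_def sum_2 sum_nonneg)

lemma norm_mat2_mult: "norm (A ** B) \<le> norm A * norm B" for A B :: mat2
proof -
  have cs: "(a*c + b*d)\<^sup>2 \<le> (a\<^sup>2 + b\<^sup>2) * (c\<^sup>2 + d\<^sup>2)" for a b c d :: real
    using zero_le_power2[of "a*d - b*c"] by (simp add: power2_eq_square algebra_simps)
  have "(norm (A ** B))\<^sup>2 \<le> (norm A * norm B)\<^sup>2"
    unfolding power_mult_distrib norm_mat2_sq
    using cs[of "A$1$1" "B$1$1" "A$1$2" "B$2$1"] cs[of "A$1$1" "B$1$2" "A$1$2" "B$2$2"]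
      cs[of "A$2$1" "B$1$1" "A$2$2" "B$2$1"] cs[of "A$2$1" "B$1$2" "A$2$2" "B$2$2"]
    by (simp add: matrix_matrix_mult_def sum_2 algebra_simps)
  then show ?thesis
    by (simp add: power2_le_iff_abs_le)
qed

lemma bounded_bilinear_mat2_mult: "bounded_bilinear ((**) :: mat2 \<Rightarrow> mat2 \<Rightarrow> mat2)"
proof
  show "\<exists>K. \<forall>a b. norm ((a::mat2) ** (b::mat2)) \<le> norm a * norm b * K"
    using norm_mat2_mult by (intro exI[of _ 1]) simp
qed (simp_all add: matrix_matrix_mult_def sum_2 vec_eq_iff algebra_simps)

interpretation mat2: bounded_bilinear "(**) :: mat2 \<Rightarrow> mat2 \<Rightarrow> mat2"
  by (rule bounded_bilinear_mat2_mult)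

text \<open>
  An element of type \<open>loop\<close> is a Laurent series with real two by two matrix coefficients
  that is absolutely summable; it is a continuous function on the unit circle.
\<close>

typedef loop = "{a :: int \<Rightarrow> mat2. (\<lambda>j. norm (a j)) summable_on UNIV}"
  morphisms lcoeff Abs_loop
  by (rule exI[of _ "\<lambda>_. 0"]) simp

setup_lifting type_definition_loop

lemma lcoeff_summable: "(\<lambda>j. norm (lcoeff a j)) summable_on UNIV"
  using lcoeff[of a] by simp

lemma loop_eqI: "(\<And>j. lcoeff a j = lcoeff b j) \<Longrightarrow> a = b"
  by (simp add: lcoeff_inject[symmetric] ext)

instantiation loop :: real_vector
begin

lift_definition zero_loop :: loop is "\<lambda>_. 0" by simp

lift_definition plus_loop :: "loop \<Rightarrow> loop \<Rightarrow> loop" is "\<lambda>a b j. a j + b j"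
  subgoal for a b
    by (rule Infinite_Sum.abs_summable_on_comparison_test'[where g = "\<lambda>j. norm (a j) + norm (b j)"])
      (auto intro: summable_on_add norm_triangle_ineq)
  done

lift_definition uminus_loop :: "loop \<Rightarrow> loop" is "\<lambda>a j. - a j" by simp

lift_definition minus_loop :: "loop \<Rightarrow> loop \<Rightarrow> loop" is "\<lambda>a b j. a j - b j"
  subgoal for a b
    by (rule Infinite_Sum.abs_summable_on_comparison_test'[where g = "\<lambda>j. norm (a j) + norm (b j)"])
      (auto intro: summable_on_add norm_triangle_ineq4)
  done

lift_definition scaleR_loop :: "real \<Rightarrow> loop \<Rightarrow> loop" is "\<lambda>r a j. r *\<^sub>R a j"
  by (simp add: summable_on_cmult_right)

instance
  by standard (transfer, simp add: algebra_simps fun_eq_iff)+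

end

instantiation loop :: real_normed_vector
begin

definition norm_loop :: "loop \<Rightarrow> real" where
  "norm_loop a = (\<Sum>\<^sub>\<infinity>j. norm (lcoeff a j))"

definition dist_loop :: "loop \<Rightarrow> loop \<Rightarrow> real" where
  "dist_loop a b = norm (a - b)"

definition sgn_loop :: "loop \<Rightarrow> loop" where
  "sgn_loop a = inverse (norm a) *\<^sub>R a"

definition uniformity_loop :: "(loop \<times> loop) filter" where
  "uniformity_loop = (INF e\<in>{0<..}. principal {(x, y). dist x y < e})"

definition open_loop :: "loop set \<Rightarrow> bool" where
  "open_loop U = (\<forall>x\<in>U. \<forall>\<^sub>F (x', y) in uniformity. x' = x \<longrightarrow> y \<in> U)"

instance
proof
  fix a b :: loop and r :: real
  show "(norm a = 0) = (a = 0)"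
  proof
    assume "norm a = 0"
    then have "norm (lcoeff a j) = 0" for j
      using nonneg_infsum_le_0D[of "\<lambda>j. norm (lcoeff a j)" UNIV j] lcoeff_summable[of a]
      by (simp add: norm_loop_def)
    then show "a = 0"
      by (intro loop_eqI) (simp add: zero_loop.rep_eq)
  qed (simp add: norm_loop_def zero_loop.rep_eq)
  have "norm (a + b) \<le> (\<Sum>\<^sub>\<infinity>j. norm (lcoeff a j) + norm (lcoeff b j))"
    unfolding norm_loop_def
    by (intro infsum_mono summable_on_add lcoeff_summable)
      (simp add: plus_loop.rep_eq norm_triangle_ineq)
  also have "\<dots> = norm a + norm b"
    unfolding norm_loop_def by (intro infsum_add lcoeff_summable)
  finally show "norm (a + b) \<le> norm a + norm b" .
  show "norm (r *\<^sub>R a) = \<bar>r\<bar> * norm a"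
    by (simp add: norm_loop_def scaleR_loop.rep_eq infsum_cmult_right')
qed (simp_all add: dist_loop_def sgn_loop_def uniformity_loop_def open_loop_def)

end

lemma norm_lcoeff_le: "norm (lcoeff a j) \<le> norm a"
  using finite_sum_le_infsum[OF lcoeff_summable[of a], of "{j}"]
  by (simp add: norm_loop_def)

lemma sum_norm_lcoeff_le: "finite F \<Longrightarrow> (\<Sum>j\<in>F. norm (lcoeff a j)) \<le> norm a"
  unfolding norm_loop_def by (rule finite_sum_le_infsum[OF lcoeff_summable]) auto

instance loop :: banach
proof
  fix X :: "nat \<Rightarrow> loop"
  assume C: "Cauchy X"
  have "Cauchy (\<lambda>n. lcoeff (X n) j)" for j
  proof (rule CauchyI)
    fix e :: real assume "e > 0"
    then obtain M where "\<forall>m\<ge>M. \<forall>n\<ge>M. norm (X m - X n) < e"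
      using CauchyD[OF C] by blast
    then show "\<exists>M. \<forall>m\<ge>M. \<forall>n\<ge>M. norm (lcoeff (X m) j - lcoeff (X n) j) < e"
      using norm_lcoeff_le[of "X m - X n" j for m n]
      by (metis minus_loop.rep_eq order_le_less_trans)
  qed
  then obtain L where L: "\<And>j. (\<lambda>n. lcoeff (X n) j) \<longlonglongrightarrow> L j"
    unfolding Cauchy_convergent_iff convergent_def by metis
  have key: "(\<Sum>j\<in>F. norm (L j - lcoeff (X n) j)) \<le> e"
    if "finite F" and "\<forall>m\<ge>N. norm (X m - X n) \<le> e" for F n e N
  proof (rule tendsto_upperbound[where F = sequentially])
    show "(\<lambda>m. \<Sum>j\<in>F. norm (lcoeff (X m) j - lcoeff (X n) j))
        \<longlonglongrightarrow> (\<Sum>j\<in>F. norm (L j - lcoeff (X n) j))"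
      by (intro tendsto_intros L)
    show "\<forall>\<^sub>F m in sequentially. (\<Sum>j\<in>F. norm (lcoeff (X m) j - lcoeff (X n) j)) \<le> e"
      unfolding eventually_sequentially
      using that sum_norm_lcoeff_le[OF \<open>finite F\<close>, of "X m - X n" for m]
      by (metis (no_types, lifting) minus_loop.rep_eq order_trans sum.cong)
  qed simp
  have summ: "(\<lambda>j. norm (L j - lcoeff (X n) j)) summable_on UNIV"
    and bound: "infsum (\<lambda>j. norm (L j - lcoeff (X n) j)) UNIV \<le> e"
    if "\<forall>m\<ge>N. norm (X m - X n) \<le> e" for n e N
  proof -
    show *: "(\<lambda>j. norm (L j - lcoeff (X n) j)) summable_on UNIV"
      unfolding abs_summable_iff_bdd_above
      by (rule bdd_aboveI2[where M = e]) (use key[OF _ that] in auto)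
    show "infsum (\<lambda>j. norm (L j - lcoeff (X n) j)) UNIV \<le> e"
      by (rule infsum_le_finite_sums[OF *]) (use key[OF _ that] in auto)
  qed
  have eps: "\<exists>N. \<forall>n\<ge>N. \<forall>m\<ge>N. norm (X m - X n) \<le> e" if "e > 0" for e
    using CauchyD[OF C that] by (meson less_imp_le)
  obtain N where N: "\<forall>m\<ge>N. norm (X m - X N) \<le> 1"
    using eps[of 1] by auto
  have "(\<lambda>j. norm (L j)) summable_on UNIV"
    by (rule Infinite_Sum.abs_summable_on_comparison_test'[where
        g = "\<lambda>j. norm (L j - lcoeff (X N) j) + norm (lcoeff (X N) j)"])
      (use summ[OF N] lcoeff_summable in \<open>auto intro!: summable_on_add
         simp: norm_triangle_sub add.commute\<close>)
  then obtain l where l: "lcoeff l = L"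
    using Abs_loop_inverse[of L] by auto
  have "X \<longlonglongrightarrow> l"
  proof (rule LIMSEQ_I)
    fix e :: real assume "e > 0"
    then obtain N where N: "\<forall>n\<ge>N. \<forall>m\<ge>N. norm (X m - X n) \<le> e/2"
      using eps[of "e/2"] by auto
    have "norm (X n - l) < e" if "n \<ge> N" for n
    proof -
      have "norm (l - X n) \<le> e/2"
        using bound[of N n "e/2"] N that by (simp add: norm_loop_def minus_loop.rep_eq l)
      then show ?thesis
        using \<open>e > 0\<close> by (simp add: norm_minus_commute)
    qed
    then show "\<exists>N. \<forall>n\<ge>N. norm (X n - l) < e" by blast
  qed
  then show "convergent X"
    by (rule convergentI)
qed

lemma infsum_bounded_linear_image:
  fixes f :: "'a \<Rightarrow> 'b::real_normed_vector" and h :: "'b \<Rightarrow> 'c::real_normed_vector"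
  assumes "bounded_linear h" "f summable_on A"
  shows "(\<Sum>\<^sub>\<infinity>x\<in>A. h (f x)) = h (infsum f A)"
  by (rule infsumI[OF has_sum_bounded_linear[OF assms(1) has_sum_infsum[OF assms(2)]]])

lemma conv_has_sum:
  "((\<lambda>(i, n). norm (lcoeff a i) * norm (lcoeff b (n - i))) has_sum (norm a * norm b)) (UNIV \<times> UNIV)"
proof -
  let ?f = "\<lambda>(i, n). norm (lcoeff a i) * norm (lcoeff b (n - i))"
  have inner: "((\<lambda>n. ?f (i, n)) has_sum (norm (lcoeff a i) * norm b)) UNIV" for i
  proof -
    have "bij (\<lambda>n. n - i)"
      by (rule bij_betw_byWitness[where f' = "\<lambda>n. n + i"]) auto
    then have "((\<lambda>n. norm (lcoeff b (n - i))) has_sum norm b) UNIV"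
      using has_sum_reindex_bij_betw[of "\<lambda>n. n - i" UNIV UNIV "\<lambda>n. norm (lcoeff b n)" "norm b"]
        has_sum_infsum[OF lcoeff_summable[of b]]
      by (simp add: norm_loop_def)
    then show ?thesis
      by (simp add: has_sum_cmult_right)
  qed
  have outer: "((\<lambda>i. norm (lcoeff a i) * norm b) has_sum (norm a * norm b)) UNIV"
    using has_sum_cmult_left[OF has_sum_infsum[OF lcoeff_summable[of a]]]
    by (simp add: norm_loop_def)
  show ?thesis
    by (rule has_sum_SigmaI[OF inner outer])
      (rule summable_on_SigmaI[OF inner has_sum_imp_summable[OF outer]], auto)
qed

lemma conv_swap_has_sum:
  "((\<lambda>(n, i). norm (lcoeff a i) * norm (lcoeff b (n - i))) has_sum (norm a * norm b)) (UNIV \<times> UNIV)"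
proof -
  have "bij_betw prod.swap UNIV (UNIV :: (int \<times> int) set)"
    by simp
  from has_sum_reindex_bij_betw[OF this, where
      f = "\<lambda>(n, i). norm (lcoeff a i) * norm (lcoeff b (n - i))" and S = "norm a * norm b"]
  show ?thesis
    using conv_has_sum[of a b] by (simp add: case_prod_unfold)
qed

lemma conv_summable:
  "(\<lambda>i. norm (lcoeff a i) * norm (lcoeff b (n - i))) summable_on UNIV"
  using summable_on_SigmaD1[OF has_sum_imp_summable[OF conv_swap_has_sum], of n a b] by simp

lemma conv_norm_summable:
  "(\<lambda>i. norm (lcoeff a i ** lcoeff b (n - i))) summable_on UNIV"
  by (rule Infinite_Sum.abs_summable_on_comparison_test'[OF conv_summable]) (rule norm_mat2_mult)

lemma conv_mat_summable:
  "(\<lambda>i. lcoeff a i ** lcoeff b (n - i)) summable_on UNIV"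
  by (rule abs_summable_summable[OF conv_norm_summable])

lemma conv_norm_has_sum:
  "((\<lambda>n. \<Sum>\<^sub>\<infinity>i. norm (lcoeff a i) * norm (lcoeff b (n - i))) has_sum (norm a * norm b)) UNIV"
  using has_sum_SigmaD[OF conv_swap_has_sum, where g = "\<lambda>n. \<Sum>\<^sub>\<infinity>i. norm (lcoeff a i) * norm (lcoeff b (n - i))" for a b]
    has_sum_infsum[OF conv_summable]
  by simp

lemma conv_norm_le:
  "norm (\<Sum>\<^sub>\<infinity>i. lcoeff a i ** lcoeff b (n - i)) \<le> (\<Sum>\<^sub>\<infinity>i. norm (lcoeff a i) * norm (lcoeff b (n - i)))"
  by (rule norm_infsum_le[OF has_sum_infsum[OF conv_mat_summable] has_sum_infsum[OF conv_summable]])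
    (rule norm_mat2_mult)

instantiation loop :: real_normed_algebra
begin

text \<open>The pointwise product of loops is the convolution of their coefficients.\<close>

definition times_loop :: "loop \<Rightarrow> loop \<Rightarrow> loop" where
  "times_loop a b = Abs_loop (\<lambda>n. \<Sum>\<^sub>\<infinity>i. lcoeff a i ** lcoeff b (n - i))"

lemma lcoeff_times: "lcoeff (a * b) n = (\<Sum>\<^sub>\<infinity>i. lcoeff a i ** lcoeff b (n - i))"
proof -
  have "(\<lambda>n. norm (\<Sum>\<^sub>\<infinity>i. lcoeff a i ** lcoeff b (n - i))) summable_on UNIV"
    by (rule Infinite_Sum.abs_summable_on_comparison_test'[OF
          has_sum_imp_summable[OF conv_norm_has_sum] conv_norm_le])
  then show ?thesis
    by (simp add: times_loop_def Abs_loop_inverse)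
qed

instance
proof
  fix a b c :: loop and r :: real
  have bij: "bij (\<lambda>m. m - i)" for i :: int
    by (rule bij_betw_byWitness[where f' = "\<lambda>n. n + i"]) auto
  show "a * b * c = a * (b * c)"
  proof (rule loop_eqI)
    fix n
    let ?g = "\<lambda>m i. lcoeff a i ** lcoeff b (m - i) ** lcoeff c (n - m)"
    have "(\<lambda>(m, i). norm (lcoeff a i) * norm (lcoeff b (m - i)) * norm c) summable_on (UNIV \<times> UNIV)"
      using summable_on_cmult_left[OF has_sum_imp_summable[OF conv_swap_has_sum[of a b]], of "norm c"]
      by (simp add: case_prod_unfold)
    then have "(\<lambda>p. norm (case p of (m, i) \<Rightarrow> ?g m i)) summable_on (UNIV \<times> UNIV)"
    proof (rule Infinite_Sum.abs_summable_on_comparison_test')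
      fix p :: "int \<times> int"
      obtain m i where p: "p = (m, i)" by fastforce
      have "norm (?g m i) \<le> norm (lcoeff a i) * norm (lcoeff b (m - i)) * norm c"
        by (rule order_trans[OF norm_mat2_mult])
          (intro mult_mono norm_mat2_mult norm_lcoeff_le; simp)
      then show "norm (case p of (m, i) \<Rightarrow> ?g m i) \<le>
          (case p of (m, i) \<Rightarrow> norm (lcoeff a i) * norm (lcoeff b (m - i)) * norm c)"
        by (simp add: p)
    qed
    then have swap: "(\<Sum>\<^sub>\<infinity>m. \<Sum>\<^sub>\<infinity>i. ?g m i) = (\<Sum>\<^sub>\<infinity>i. \<Sum>\<^sub>\<infinity>m. ?g m i)"
      by (intro infsum_swap_banach) (rule abs_summable_summable)
    have "lcoeff (a * b * c) n = (\<Sum>\<^sub>\<infinity>m. \<Sum>\<^sub>\<infinity>i. ?g m i)"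
      unfolding lcoeff_times
    proof (rule infsum_cong)
      fix m
      show "(\<Sum>\<^sub>\<infinity>i. lcoeff a i ** lcoeff b (m - i)) ** lcoeff c (n - m) = (\<Sum>\<^sub>\<infinity>i. ?g m i)"
        by (rule infsum_bounded_linear_image[OF mat2.bounded_linear_left conv_mat_summable, symmetric])
    qed
    also have "\<dots> = (\<Sum>\<^sub>\<infinity>i. lcoeff a i ** (\<Sum>\<^sub>\<infinity>l. lcoeff b l ** lcoeff c (n - i - l)))"
      unfolding swap
    proof (rule infsum_cong)
      fix i :: int
      have "(\<Sum>\<^sub>\<infinity>m. ?g m i) = (\<Sum>\<^sub>\<infinity>m. lcoeff a i ** (lcoeff b (m - i) ** lcoeff c (n - i - (m - i))))"
        by (simp add: matrix_mul_assoc)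
      also have "\<dots> = (\<Sum>\<^sub>\<infinity>l. lcoeff a i ** (lcoeff b l ** lcoeff c (n - i - l)))"
        using infsum_reindex_bij_betw[OF bij[of i], of
            "\<lambda>l. lcoeff a i ** (lcoeff b l ** lcoeff c (n - i - l))"] .
      also have "\<dots> = lcoeff a i ** (\<Sum>\<^sub>\<infinity>l. lcoeff b l ** lcoeff c (n - i - l))"
        by (rule infsum_bounded_linear_image[OF mat2.bounded_linear_right conv_mat_summable])
      finally show "(\<Sum>\<^sub>\<infinity>m. ?g m i) = lcoeff a i ** (\<Sum>\<^sub>\<infinity>l. lcoeff b l ** lcoeff c (n - i - l))" .
    qed
    finally show "lcoeff (a * b * c) n = lcoeff (a * (b * c)) n"
      by (simp add: lcoeff_times)
  qed
  show "(a + b) * c = a * c + b * c"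
    by (rule loop_eqI)
      (simp add: lcoeff_times plus_loop.rep_eq mat2.add_left infsum_add conv_mat_summable)
  show "a * (b + c) = a * b + a * c"
    by (rule loop_eqI)
      (simp add: lcoeff_times plus_loop.rep_eq mat2.add_right infsum_add conv_mat_summable)
  show "r *\<^sub>R a * b = r *\<^sub>R (a * b)"
    by (rule loop_eqI)
      (simp add: lcoeff_times scaleR_loop.rep_eq mat2.scaleR_left infsum_scaleR_right)
  show "a * r *\<^sub>R b = r *\<^sub>R (a * b)"
    by (rule loop_eqI)
      (simp add: lcoeff_times scaleR_loop.rep_eq mat2.scaleR_right infsum_scaleR_right)
  show "norm (a * b) \<le> norm a * norm b"
  proof -
    have "norm (a * b) \<le> (\<Sum>\<^sub>\<infinity>n. \<Sum>\<^sub>\<infinity>i. norm (lcoeff a i) * norm (lcoeff b (n - i)))"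
      unfolding norm_loop_def[of "a * b"]
      by (intro infsum_mono lcoeff_summable has_sum_imp_summable[OF conv_norm_has_sum])
        (simp add: lcoeff_times conv_norm_le)
    also have "\<dots> = norm a * norm b"
      using conv_norm_has_sum by (rule infsumI)
    finally show ?thesis .
  qed
qed

end

text \<open>The loop \<open>\<lambda> \<mapsto> M \<lambda>\<^sup>j\<close>.\<close>

lift_definition lterm :: "int \<Rightarrow> mat2 \<Rightarrow> loop" is "\<lambda>j M k. if k = j then M else 0"
  subgoal for j M
    using summable_on_cong_neutral[of UNIV "{j}" "\<lambda>k. norm (if k = j then M else 0)"
        "\<lambda>k. norm (if k = j then M else 0)"]
    by simp
  done

lemma lcoeff_lterm_times: "lcoeff (lterm j M * a) n = M ** lcoeff a (n - j)"
proof -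
  have "(\<Sum>\<^sub>\<infinity>i. lcoeff (lterm j M) i ** lcoeff a (n - i))
      = (\<Sum>\<^sub>\<infinity>i\<in>{j}. lcoeff (lterm j M) i ** lcoeff a (n - i))"
    by (rule infsum_cong_neutral) (auto simp: lterm.rep_eq mat2.zero_left)
  then show ?thesis
    by (simp add: lcoeff_times lterm.rep_eq)
qed

lemma lcoeff_times_lterm: "lcoeff (a * lterm j M) n = lcoeff a (n - j) ** M"
proof -
  have "(\<Sum>\<^sub>\<infinity>i. lcoeff a i ** lcoeff (lterm j M) (n - i))
      = (\<Sum>\<^sub>\<infinity>i\<in>{n - j}. lcoeff a i ** lcoeff (lterm j M) (n - i))"
    by (rule infsum_cong_neutral) (auto simp: lterm.rep_eq mat2.zero_right)
  then show ?thesis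
    by (simp add: lcoeff_times lterm.rep_eq)
qed

instantiation loop :: ring_1
begin

definition one_loop :: loop where "one_loop = lterm 0 (mat 1)"

instance
proof
  fix a :: loop
  show "1 * a = a"
    by (rule loop_eqI) (simp add: one_loop_def lcoeff_lterm_times)
  show "a * 1 = a"
    by (rule loop_eqI) (simp add: one_loop_def lcoeff_times_lterm)
  have "lcoeff 0 0 $ 1 $ 1 \<noteq> lcoeff 1 0 $ 1 $ 1"
    by (simp add: one_loop_def lterm.rep_eq zero_loop.rep_eq mat_def)
  then show "(0::loop) \<noteq> 1"
    by auto
qed

end


section \<open>The Lorentzian Lie algebra and the pseudosphere\<close>

definition sl2 :: "mat2 set" where
  "sl2 = {X. trace X = 0}"

definition scal :: "mat2 \<Rightarrow> mat2 \<Rightarrow> real" where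
  "scal X Y = trace (X ** Y) / 2"

definition pseudosphere :: "mat2 set" where
  "pseudosphere = {X \<in> sl2. scal X X = 1}"

definition kprime :: "'a::field^2^2" where
  "kprime = (\<chi> i j. if i \<noteq> j then 0 else if i = 1 then -1 else 1)"

definition Ad :: "'a::field^2^2 \<Rightarrow> 'a^2^2 \<Rightarrow> 'a^2^2" where
  "Ad g X = g ** X ** matrix_inv g"

definition sigma :: "'a::field^2^2 \<Rightarrow> 'a^2^2" where
  "sigma = Ad kprime"

definition diag_part :: "mat2 set" where
  "diag_part = {X \<in> sl2. X $ 1 $ 2 = 0 \<and> X $ 2 $ 1 = 0}"

definition offdiag_part :: "mat2 set" where
  "offdiag_part = {X \<in> sl2. X $ 1 $ 1 = 0 \<and> X $ 2 $ 2 = 0}"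


section \<open>Loop algebras and loop groups\<close>

definition loop_eval :: "loop \<Rightarrow> complex \<Rightarrow> complex^2^2" where
  "loop_eval a z = (\<chi> i k. \<Sum>\<^sub>\<infinity>j. complex_of_real (lcoeff a j $ i $ k) * z powi j)"

definition twisted :: "loop \<Rightarrow> bool" where
  "twisted a \<longleftrightarrow> (\<forall>z. norm z = 1 \<longrightarrow> sigma (loop_eval a z) = loop_eval a (- z))"

definition Lambda_g_sigma :: "loop set" where
  "Lambda_g_sigma = {\<xi>. (\<forall>j. lcoeff \<xi> j \<in> sl2) \<and> twisted \<xi>}"

definition Lambda_G_sigma :: "loop set" where
  "Lambda_G_sigma = {\<gamma>. (\<forall>z. norm z = 1 \<longrightarrow> det (loop_eval \<gamma> z) = 1) \<and> twisted \<gamma>}"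

definition extends_analytically :: "loop \<Rightarrow> bool" where
  "extends_analytically a \<longleftrightarrow>
    (\<exists>F :: complex \<Rightarrow> complex^2^2.
       (\<forall>i k. (\<lambda>z. F z $ i $ k) holomorphic_on (- {0})) \<and>
       (\<forall>z. norm z = 1 \<longrightarrow> F z = loop_eval a z))"

definition tLambda_G_sigma :: "loop set" where
  "tLambda_G_sigma = {\<gamma> \<in> Lambda_G_sigma. extends_analytically \<gamma>}"

definition tLambda_plus :: "loop set" where
  "tLambda_plus = {\<gamma> \<in> tLambda_G_sigma. \<forall>j<0. lcoeff \<gamma> j = 0}"

definition tLambda_minus_star :: "loop set" where
  "tLambda_minus_star =
     {\<gamma> \<in> tLambda_G_sigma. (\<forall>j>0. lcoeff \<gamma> j = 0) \<and> lcoeff \<gamma> 0 = mat 1}"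

definition loop_inv :: "loop \<Rightarrow> loop" where
  "loop_inv a = (THE b. a * b = 1 \<and> b * a = 1)"

text \<open>
  For a loop that extends analytically, the Laurent series converges absolutely on the punctured
  plane and the following is the value of the extension at a real number \<open>l \<noteq> 0\<close>.
\<close>

definition loop_val :: "real \<Rightarrow> loop \<Rightarrow> mat2" where
  "loop_val l a = (\<chi> i k. \<Sum>\<^sub>\<infinity>j. lcoeff a j $ i $ k * l powi j)"

text \<open>\<open>(g', g'') = (\<gamma>, \<gamma>) (Lm\<inverse>, Lp\<inverse>)\<close> in the product of two copies of the loop group.\<close>

definition iwasawa :: "loop \<Rightarrow> loop \<Rightarrow> loop \<Rightarrow> loop \<Rightarrow> loop \<Rightarrow> bool" where
  "iwasawa g' g'' \<gamma> Lm Lp \<longleftrightarrow>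
     \<gamma> \<in> tLambda_G_sigma \<and> Lm \<in> tLambda_minus_star \<and> Lp \<in> tLambda_plus \<and>
     g' = \<gamma> * loop_inv Lm \<and> g'' = \<gamma> * loop_inv Lp"


section \<open>Smooth maps\<close>

text \<open>On open subsets of Euclidean spaces this is the usual notion of a \<open>C\<^sup>\<infinity>\<close> map.\<close>

primrec higher_differentiable_on ::
  "'a::real_normed_vector set \<Rightarrow> ('a \<Rightarrow> 'b::real_normed_vector) \<Rightarrow> nat \<Rightarrow> bool" where
  "higher_differentiable_on S f 0 \<longleftrightarrow> continuous_on S f"
| "higher_differentiable_on S f (Suc n) \<longleftrightarrow>
     (\<forall>x\<in>S. f differentiable (at x)) \<and>
     (\<forall>v. higher_differentiable_on S (\<lambda>x. frechet_derivative f (at x) v) n)"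

definition smooth_on :: "'a::real_normed_vector set \<Rightarrow> ('a \<Rightarrow> 'b::real_normed_vector) \<Rightarrow> bool" where
  "smooth_on S f \<longleftrightarrow> (\<forall>n. higher_differentiable_on S f n)"

definition partial_x :: "(real \<times> real \<Rightarrow> 'b::real_normed_vector) \<Rightarrow> real \<times> real \<Rightarrow> 'b" where
  "partial_x f p = vector_derivative (\<lambda>t. f (t, snd p)) (at (fst p))"

definition partial_y :: "(real \<times> real \<Rightarrow> 'b::real_normed_vector) \<Rightarrow> real \<times> real \<Rightarrow> 'b" where
  "partial_y f p = vector_derivative (\<lambda>t. f (fst p, t)) (at (snd p))"

definition minkowski_region :: "(real \<times> real) set \<Rightarrow> bool" where
  "minkowski_region D \<longleftrightarrow> open D \<and> simply_connected D \<and> (0, 0) \<in> D"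


section \<open>Harmonic maps into the pseudosphere\<close>

text \<open>
  The metric \<open>dx dy\<close> has components \<open>g\<^bsub>xx\<^esub> = g\<^bsub>yy\<^esub> = 0\<close> and \<open>g\<^bsub>xy\<^esub> = 1/2\<close>, so that the inverse metric
  has \<open>g\<^bsup>xy\<^esup> = 2\<close>; it is flat with parallel coordinate fields.  The Levi-Civita connection of the
  pseudosphere is the tangential part of the derivative in \<open>sl2\<close>.  The tension field is the trace
  \<open>g\<^bsup>ij\<^esup> \<nabla>\<^sub>i \<partial>\<^sub>j \<psi>\<close> of the second fundamental form.
\<close>

definition tangential :: "mat2 \<Rightarrow> mat2 \<Rightarrow> mat2" where
  "tangential P V = V - scal V P *\<^sub>R P"

definition tension_field :: "(real \<times> real \<Rightarrow> mat2) \<Rightarrow> real \<times> real \<Rightarrow> mat2" where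
  "tension_field \<psi> p =
     2 *\<^sub>R tangential (\<psi> p) (partial_x (partial_y \<psi>) p) +
     2 *\<^sub>R tangential (\<psi> p) (partial_y (partial_x \<psi>) p)"

definition harmonic_map :: "(real \<times> real) set \<Rightarrow> (real \<times> real \<Rightarrow> mat2) \<Rightarrow> bool" where
  "harmonic_map U \<psi> \<longleftrightarrow>
     smooth_on U \<psi> \<and> (\<forall>p\<in>U. \<psi> p \<in> pseudosphere) \<and> (\<forall>p\<in>U. tension_field \<psi> p = 0)"

definition loop_of_harmonic_maps ::
  "(real \<times> real) set \<Rightarrow> (real \<Rightarrow> real \<times> real \<Rightarrow> mat2) \<Rightarrow> bool" where
  "loop_of_harmonic_maps U \<psi> \<longleftrightarrow> (\<forall>l>0. harmonic_map U (\<psi> l))"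


section \<open>Potentials and extended framings\<close>

text \<open>
  A Lorentz holomorphic 1-form \<open>\<xi>'(x) dx\<close> on \<open>D\<close> is represented by its coefficient, a smooth map from
  the projection of \<open>D\<close> to the \<open>x\<close>-axis into the Banach space of loops.
  (For smooth coefficients \<open>\<xi>'\<^sub>k\<close> without control of the sum, the initial value problem for \<open>\<Psi>'\<close>
  need not have a solution in the loop group.)
\<close>

definition potentials' :: "(real \<times> real) set \<Rightarrow> (real \<Rightarrow> loop) set" where
  "potentials' D = {\<xi>. smooth_on (fst ` D) \<xi> \<and>
     (\<forall>x \<in> fst ` D. \<xi> x \<in> Lambda_g_sigma \<and> (\<forall>k>1. lcoeff (\<xi> x) k = 0))}"

definition potentials'' :: "(real \<times> real) set \<Rightarrow> (real \<Rightarrow> loop) set" where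
  "potentials'' D = {\<xi>. smooth_on (snd ` D) \<xi> \<and>
     (\<forall>y \<in> snd ` D. \<xi> y \<in> Lambda_g_sigma \<and> (\<forall>k< - 1. lcoeff (\<xi> y) k = 0))}"

definition solves_ivp :: "real set \<Rightarrow> (real \<Rightarrow> loop) \<Rightarrow> (real \<Rightarrow> loop) \<Rightarrow> bool" where
  "solves_ivp I \<xi> \<Psi> \<longleftrightarrow>
     \<Psi> 0 = 1 \<and> (\<forall>t\<in>I. (\<Psi> has_vector_derivative \<Psi> t * \<xi> t) (at t))"

definition extended_framing :: "(real \<times> real) set \<Rightarrow> (real \<times> real \<Rightarrow> loop) \<Rightarrow> bool" where
  "extended_framing U \<Psi> \<longleftrightarrow>
     smooth_on U \<Psi> \<and> (\<forall>p\<in>U. \<Psi> p \<in> tLambda_G_sigma) \<and> \<Psi> (0, 0) = 1 \<and>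
     (\<exists>A B C E :: real \<times> real \<Rightarrow> mat2. \<forall>p\<in>U.
        A p \<in> diag_part \<and> C p \<in> diag_part \<and> B p \<in> offdiag_part \<and> E p \<in> offdiag_part \<and>
        loop_inv (\<Psi> p) * partial_x \<Psi> p = lterm 0 (A p) + lterm 1 (B p) \<and>
        loop_inv (\<Psi> p) * partial_y \<Psi> p = lterm 0 (C p) + lterm (- 1) (E p))"

text \<open>
  Not every element of the product group has an Iwasawa decomposition, so a pair \<open>(\<Psi>', \<Psi>'')\<close>
  need not be decomposable over all of \<open>D\<close>.
\<close>

definition iwasawa_domain ::
  "(real \<times> real) set \<Rightarrow> (real \<Rightarrow> loop) \<Rightarrow> (real \<Rightarrow> loop) \<Rightarrow> (real \<times> real) set" where
  "iwasawa_domain D \<Psi>' \<Psi>'' =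
     {(x, y) \<in> D. \<exists>\<gamma> Lm Lp. iwasawa (\<Psi>' x) (\<Psi>'' y) \<gamma> Lm Lp}"

end

theory Submission
  imports Defs "HOL-Complex_Analysis.Complex_Residues"
begin

text \<open>
  Writing \<open>\<Psi> = \<Psi>' L\<^sub>- = \<Psi>'' L\<^sub>+\<close>, the form \<open>\<Psi>\<inverse> \<Psi>\<^sub>x\<close> has only powers \<open>\<le> 1\<close> by the first factorization
  (as \<open>\<xi>'\<close> does and \<open>L\<^sub>-\<close> starts with \<open>1\<close>) and only powers \<open>\<ge> 0\<close> by the second (as \<open>\<Psi>''\<close> does not depend
  on \<open>x\<close>); likewise \<open>\<Psi>\<inverse> \<Psi>\<^sub>y\<close> has only the power \<open>-1\<close>.  The comparison moreover gives the coefficients: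
  \<open>\<xi>'\<^sub>1(x)\<close> at \<open>\<lambda>\<close>, and the conjugate of \<open>\<xi>''\<^sub>-\<^sub>1(y)\<close> by the constant term of \<open>L\<^sub>+\<close> at \<open>\<lambda>\<inverse>\<close>, so that the two
  integrability equations needed for harmonicity hold without exchanging partial derivatives.

  For a loop \<open>1 + k\<close> with \<open>k\<close> small the factorization is the fixed point of a contraction; this
  gives openness of the big cell.  Its linearization shows that the factors of a smooth family are
  differentiable and satisfy a first-order equation, hence are smooth.  Inverses are harmless
  throughout, since on loops of determinant one inversion is the bounded linear adjugate.
\<close>

section \<open>Two by two matrices\<close>

text \<open>Two obstacles shape the argument. The factors \<open>Lm\<close>, \<open>Lp\<close> are
  given only point by point, with no continuity in \<open>p\<close>. But every factorization of a
  loop \<open>1 + k\<close> solves the fixed point equation of \<open>birkhoff_fixed_point\<close>,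
  whose solutions are at most \<open>2 * norm k\<close> for small \<open>k\<close>; this a priori
  bound alone yields differentiability. Secondly, the topology is that of the coefficient norm even
  for loops that extend analytically, so smoothness of \<Psi> says nothing directly about its value
  at a real \<open>l \<noteq> 1\<close>. The remedy is to carry the relation "\<open>b\<close> is
  \<open>a\<close> with \<lambda> replaced by \<open>l\<close> \<lambda>" through the differential
  equation, as a closed linear condition on pairs of loops. To make such conditions pass to
  derivatives and fixed points, membership in the loop group is written with bounded linear
  operators: \<open>a * ladj a = 1\<close> for the determinant and \<open>lsig a = a\<close> for the
  twist.\<close>

definition adj2 :: "'a::comm_ring_1^2^2 \<Rightarrow> 'a^2^2" where
  "adj2 A = (\<chi> i j. if i = j then (if i = 1 then A$2$2 else A$1$1) else - A$i$j)"

lemma adj2_nth [simp]: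
  "adj2 A $ 1 $ 1 = A $ 2 $ 2" "adj2 A $ 1 $ 2 = - A $ 1 $ 2"
  "adj2 A $ 2 $ 1 = - A $ 2 $ 1" "adj2 A $ 2 $ 2 = A $ 1 $ 1"
  by (simp_all add: adj2_def)

lemma mat2_eq_iff:
  "A = B \<longleftrightarrow> A$1$1 = B$1$1 \<and> A$1$2 = B$1$2 \<and> A$2$1 = B$2$1 \<and> A$2$2 = B$2$2"
  for A B :: "'a^2^2"
  by (auto simp: vec_eq_iff forall_2)

lemma mat2_mult_nth [simp]:
  "(A ** B) $ i $ k = A$i$1 * B$1$k + A$i$2 * B$2$k" for A B :: "'a::semiring_1^2^2"
  by (simp add: matrix_matrix_mult_def sum_2)

lemma mat2_one_nth [simp]:
  "(mat c :: 'a::zero^2^2) $ 1 $ 1 = c" "(mat c :: 'a::zero^2^2) $ 1 $ 2 = 0"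
  "(mat c :: 'a::zero^2^2) $ 2 $ 1 = 0" "(mat c :: 'a::zero^2^2) $ 2 $ 2 = c"
  by (simp_all add: mat_def)

lemma kprime_nth [simp]:
  "kprime $ 1 $ 1 = (-1 :: 'a::field)" "kprime $ 1 $ 2 = (0 :: 'a)"
  "kprime $ 2 $ 1 = (0 :: 'a)" "kprime $ 2 $ 2 = (1 :: 'a)"
  by (simp_all add: kprime_def)

lemma trace_mat2: "trace (A :: 'a::comm_semiring_1^2^2) = A$1$1 + A$2$2"
  by (simp add: trace_def sum_2)

lemma adj2_mult: "adj2 (A ** B) = adj2 B ** adj2 A"
  by (simp add: mat2_eq_iff algebra_simps)

lemma mult_adj2: "A ** adj2 A = mat (det A)"
  by (simp add: mat2_eq_iff det_2 algebra_simps)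

lemma adj2_mult_self: "adj2 A ** A = mat (det A)"
  by (simp add: mat2_eq_iff det_2 algebra_simps)

lemma norm_adj2: "norm (adj2 A) = norm (A :: mat2)"
proof -
  have "(norm (adj2 A))\<^sup>2 = (norm A)\<^sup>2"
    unfolding norm_mat2_sq by simp
  then show ?thesis by simp
qed

lemma linear_adj2: "linear (adj2 :: mat2 \<Rightarrow> mat2)"
  by (rule linearI) (simp_all add: mat2_eq_iff)

lemma matrix_inv_unique:
  fixes A :: "'a::field^'n^'n"
  assumes "A ** B = mat 1" "B ** A = mat 1"
  shows "matrix_inv A = B"
proof -
  define M where "M = matrix_inv A"
  have "A ** M = mat 1 \<and> M ** A = mat 1"
    unfolding M_def matrix_inv_def by (rule someI[of _ B]) (use assms in auto)
  then have "M ** A ** B = B"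
    by (simp add: matrix_mul_lid)
  then show ?thesis
    using assms by (simp add: matrix_mul_assoc[symmetric] matrix_mul_rid M_def)
qed

lemma matrix_inv_kprime: "matrix_inv kprime = (kprime :: 'a::field^2^2)"
  by (rule matrix_inv_unique) (simp_all add: mat2_eq_iff)

lemma sigma_nth [simp]:
  "sigma A $ 1 $ 1 = A $ 1 $ 1" "sigma A $ 1 $ 2 = - A $ 1 $ 2"
  "sigma A $ 2 $ 1 = - A $ 2 $ 1" "sigma A $ 2 $ 2 = A $ 2 $ 2"
  for A :: "'a::field^2^2"
  by (simp_all add: sigma_def Ad_def matrix_inv_kprime)

lemma sigma_mult: "sigma (A ** B) = sigma A ** sigma B" for A :: "'a::field^2^2"
  by (simp add: mat2_eq_iff)

lemma norm_sigma: "norm (sigma A) = norm (A :: mat2)"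
proof -
  have "(norm (sigma A))\<^sup>2 = (norm A)\<^sup>2"
    unfolding norm_mat2_sq by simp
  then show ?thesis by simp
qed

lemma linear_sigma: "linear (sigma :: mat2 \<Rightarrow> mat2)"
  by (rule linearI) (simp_all add: mat2_eq_iff)

section \<open>Coefficientwise operators on loops\<close>

text \<open>The operation may depend on the exponent, because truncation, dilation and twist treat
  the powers of \<lambda> differently. The uniform bound in \<open>linear_family\<close> keeps the
  image coefficients summable, so that \<open>Abs_loop\<close> has its intended value.\<close>

definition lmap :: "(int \<Rightarrow> mat2 \<Rightarrow> mat2) \<Rightarrow> loop \<Rightarrow> loop" where
  "lmap T a = Abs_loop (\<lambda>j. T j (lcoeff a j))"

definition linear_family :: "real \<Rightarrow> (int \<Rightarrow> mat2 \<Rightarrow> mat2) \<Rightarrow> bool" where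
  "linear_family C T \<longleftrightarrow> (\<forall>j. linear (T j)) \<and> (\<forall>j X. norm (T j X) \<le> C * norm X)"

lemma lcoeff_lmap:
  assumes "linear_family C T"
  shows "lcoeff (lmap T a) j = T j (lcoeff a j)"
proof -
  have "(\<lambda>j. norm (T j (lcoeff a j))) summable_on UNIV"
    by (rule Infinite_Sum.abs_summable_on_comparison_test'[where g = "\<lambda>j. C * norm (lcoeff a j)"])
      (use assms lcoeff_summable in \<open>auto simp: linear_family_def intro: summable_on_cmult_right\<close>)
  then show ?thesis
    by (simp add: lmap_def Abs_loop_inverse)
qed

lemma norm_lmap_le:
  assumes "linear_family C T"
  shows "norm (lmap T a) \<le> C * norm a"
proof -
  have "norm (lmap T a) \<le> (\<Sum>\<^sub>\<infinity>j. C * norm (lcoeff a j))"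
    unfolding norm_loop_def
    by (intro infsum_mono summable_on_cmult_right lcoeff_summable)
      (use assms in \<open>simp add: lcoeff_lmap[OF assms] linear_family_def\<close>)
  then show ?thesis
    by (simp add: norm_loop_def infsum_cmult_right')
qed

lemma bounded_linear_lmap:
  assumes "linear_family C T"
  shows "bounded_linear (lmap T)"
proof (rule bounded_linear_intro[where K = C])
  fix a b :: loop and r :: real
  have lin: "linear (T j)" for j
    using assms by (simp add: linear_family_def)
  show "lmap T (a + b) = lmap T a + lmap T b"
    by (rule loop_eqI) (simp add: lcoeff_lmap[OF assms] plus_loop.rep_eq linear_add[OF lin])
  show "lmap T (r *\<^sub>R a) = r *\<^sub>R lmap T a"
    by (rule loop_eqI) (simp add: lcoeff_lmap[OF assms] scaleR_loop.rep_eq linear_cmul[OF lin])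
  show "norm (lmap T a) \<le> norm a * C"
    using norm_lmap_le[OF assms] by (simp add: mult.commute)
qed

lemma bounded_linear_lcoeff: "bounded_linear (\<lambda>a. lcoeff a j)"
  by (rule bounded_linear_intro[where K = 1])
    (simp_all add: plus_loop.rep_eq scaleR_loop.rep_eq norm_lcoeff_le)

lemma linear_lcoeff_times:
  fixes h :: "mat2 \<Rightarrow> mat2"
  assumes "linear h"
  shows "h (lcoeff (a * b) n) = (\<Sum>\<^sub>\<infinity>i. h (lcoeff a i ** lcoeff b (n - i)))"
  unfolding lcoeff_times
  by (rule infsum_bounded_linear_image[OF linear_conv_bounded_linear[THEN iffD1, OF assms]
        conv_mat_summable, symmetric])

lemma lcoeff_one: "lcoeff 1 j = (if j = 0 then mat 1 else 0)"
  by (simp add: one_loop_def lterm.rep_eq)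

text \<open>The projection onto strictly negative powers. It is bounded because the norm sums the
  coefficient norms; in the supremum norm on the circle it would not be.\<close>

definition lneg :: "loop \<Rightarrow> loop" where
  "lneg = lmap (\<lambda>j X. if j < 0 then X else 0)"

text \<open>The substitution of \<open>l\<close> \<lambda> for \<lambda>, cut off outside
  \<open>J\<close>. For positive \<open>l \<noteq> 1\<close> the factors \<open>l powi j\<close> are
  unbounded over all exponents; a half-line \<open>J\<close> on the proper side keeps them
  bounded.\<close>

definition lscale :: "real \<Rightarrow> int set \<Rightarrow> loop \<Rightarrow> loop" where
  "lscale l J = lmap (\<lambda>j X. if j \<in> J then (l powi j) *\<^sub>R X else 0)"

text \<open>The operator that takes \<xi>(\<lambda>) to \<sigma>(\<xi>(-\<lambda>)), whence the sign
  at odd powers. Twisted loops are its fixed points.\<close>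

definition lsig :: "loop \<Rightarrow> loop" where
  "lsig = lmap (\<lambda>j X. if even j then sigma X else - sigma X)"

definition ladj :: "loop \<Rightarrow> loop" where
  "ladj = lmap (\<lambda>_. adj2)"

lemma linear_family_lneg: "linear_family 1 (\<lambda>j X. if j < 0 then X else 0)"
  by (auto simp: linear_family_def intro!: linearI)

lemma linear_family_lscale:
  assumes "\<And>j. j \<in> J \<Longrightarrow> \<bar>l powi j\<bar> \<le> C" "0 \<le> C"
  shows "linear_family C (\<lambda>j X. if j \<in> J then (l powi j) *\<^sub>R X else 0)"
  unfolding linear_family_def
proof (intro conjI allI)
  show "linear (\<lambda>X :: mat2. if j \<in> J then (l powi j) *\<^sub>R X else 0)" for j
    by (rule linearI) (simp_all add: scaleR_add_right)
  show "norm (if j \<in> J then (l powi j) *\<^sub>R X else 0) \<le> C * norm X" for j and X :: mat2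
    using mult_right_mono[OF assms(1), of j "norm X"] assms(2) by simp
qed

lemma linear_family_lsig: "linear_family 1 (\<lambda>j X. if even j then sigma X else - sigma X)"
  by (auto simp: linear_family_def norm_sigma linear_add[OF linear_sigma]
      linear_cmul[OF linear_sigma] intro!: linearI)

lemma linear_family_ladj: "linear_family 1 (\<lambda>_. adj2)"
  by (simp add: linear_family_def linear_adj2 norm_adj2)

lemmas lcoeff_lneg = lcoeff_lmap[OF linear_family_lneg, folded lneg_def]
lemmas lcoeff_lscale = lcoeff_lmap[OF linear_family_lscale, folded lscale_def]
lemmas lcoeff_lsig = lcoeff_lmap[OF linear_family_lsig, folded lsig_def]
lemmas lcoeff_ladj = lcoeff_lmap[OF linear_family_ladj, folded ladj_def]
lemmas bounded_linear_lneg = bounded_linear_lmap[OF linear_family_lneg, folded lneg_def]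
lemmas bounded_linear_lscale = bounded_linear_lmap[OF linear_family_lscale, folded lscale_def]
lemmas bounded_linear_lsig = bounded_linear_lmap[OF linear_family_lsig, folded lsig_def]
lemmas bounded_linear_ladj = bounded_linear_lmap[OF linear_family_ladj, folded ladj_def]

lemma norm_lneg_le: "norm (lneg a) \<le> norm a"
  using norm_lmap_le[OF linear_family_lneg] by (simp add: lneg_def)

lemmas lneg_linear = bounded_linear.linear[OF bounded_linear_lneg]
lemmas lsig_linear = bounded_linear.linear[OF bounded_linear_lsig]
lemmas lneg_add = linear_add[OF lneg_linear] and lneg_diff = linear_diff[OF lneg_linear]
  and lneg_minus = linear_neg[OF lneg_linear]
lemmas lsig_add = linear_add[OF lsig_linear] and lsig_diff = linear_diff[OF lsig_linear]
  and lsig_minus = linear_neg[OF lsig_linear]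

lemma lsig_mult: "lsig (a * b) = lsig a * lsig b"
proof (rule loop_eqI)
  fix n
  have "lcoeff (lsig (a * b)) n =
      (\<Sum>\<^sub>\<infinity>i. (if even n then sigma else (\<lambda>X. - sigma X)) (lcoeff a i ** lcoeff b (n - i)))"
    using linear_lcoeff_times[of "if even n then sigma else (\<lambda>X. - sigma X)" a b n]
      linear_sigma linear_compose_neg[OF linear_sigma]
    by (auto simp: lcoeff_lsig)
  also have "\<dots> = lcoeff (lsig a * lsig b) n"
    unfolding lcoeff_times
    by (rule infsum_cong) (auto simp: lcoeff_lsig sigma_mult mat2.minus_left mat2.minus_right)
  finally show "lcoeff (lsig (a * b)) n = lcoeff (lsig a * lsig b) n" .
qed

lemma lsig_one [simp]: "lsig 1 = 1"
  by (rule loop_eqI) (simp add: lcoeff_lsig lcoeff_one mat2_eq_iff)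

lemma lsig_lneg: "lsig (lneg a) = lneg (lsig a)"
  by (rule loop_eqI) (simp add: lcoeff_lsig lcoeff_lneg mat2_eq_iff)

lemma lsig_ladj: "lsig (ladj a) = ladj (lsig a)"
  by (rule loop_eqI) (simp add: lcoeff_lsig lcoeff_ladj mat2_eq_iff)

lemma ladj_mult: "ladj (a * b) = ladj b * ladj a"
proof (rule loop_eqI)
  fix n :: int
  have bij: "bij (\<lambda>i. n - i)"
    by (rule bij_betw_byWitness[where f' = "\<lambda>i. n - i"]) auto
  have "lcoeff (ladj (a * b)) n = (\<Sum>\<^sub>\<infinity>i. adj2 (lcoeff b (n - i)) ** adj2 (lcoeff a i))"
    by (simp add: lcoeff_ladj linear_lcoeff_times[OF linear_adj2] adj2_mult)
  \<comment> \<open>The reflection of the index i to n - i restores the shape of a convolution with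
    the factors exchanged.\<close>
  also have "\<dots> = (\<Sum>\<^sub>\<infinity>i. adj2 (lcoeff b (n - i)) ** adj2 (lcoeff a (n - (n - i))))"
    by simp
  also have "\<dots> = (\<Sum>\<^sub>\<infinity>i. adj2 (lcoeff b i) ** adj2 (lcoeff a (n - i)))"
    by (rule infsum_reindex_bij_betw[OF bij])
  finally show "lcoeff (ladj (a * b)) n = lcoeff (ladj b * ladj a) n"
    by (simp add: lcoeff_times lcoeff_ladj)
qed

lemma ladj_ladj [simp]: "ladj (ladj a) = a"
  by (rule loop_eqI) (simp add: lcoeff_ladj mat2_eq_iff)

lemma ladj_one [simp]: "ladj 1 = 1"
  by (rule loop_eqI) (simp add: lcoeff_ladj lcoeff_one mat2_eq_iff)

section \<open>Supports of coefficient sequences\<close>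

definition supp_le :: "int \<Rightarrow> loop \<Rightarrow> bool" where
  "supp_le m a \<longleftrightarrow> (\<forall>j>m. lcoeff a j = 0)"

definition supp_ge :: "int \<Rightarrow> loop \<Rightarrow> bool" where
  "supp_ge m a \<longleftrightarrow> (\<forall>j<m. lcoeff a j = 0)"

text \<open>In the convolution an index above \<open>m\<close> kills the left factor, and an index
  below \<open>m\<close> pushes the right one above \<open>n\<close>; only the extreme term
  survives.\<close>

lemma lcoeff_times_top:
  assumes "supp_le m a" "supp_le n b"
  shows "lcoeff (a * b) (m + n) = lcoeff a m ** lcoeff b n"
proof -
  have "lcoeff (a * b) (m + n) = (\<Sum>\<^sub>\<infinity>i\<in>{m}. lcoeff a i ** lcoeff b (m + n - i))"
    unfolding lcoeff_times
  proof (rule infsum_cong_neutral)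
    fix i assume "i \<in> UNIV - {m}"
    then show "lcoeff a i ** lcoeff b (m + n - i) = 0"
      using assms unfolding supp_le_def
      by (cases "i > m") (auto simp: mat2.zero_left mat2.zero_right)
  qed auto
  then show ?thesis by simp
qed

lemma lcoeff_times_bot:
  assumes "supp_ge m a" "supp_ge n b"
  shows "lcoeff (a * b) (m + n) = lcoeff a m ** lcoeff b n"
proof -
  have "lcoeff (a * b) (m + n) = (\<Sum>\<^sub>\<infinity>i\<in>{m}. lcoeff a i ** lcoeff b (m + n - i))"
    unfolding lcoeff_times
  proof (rule infsum_cong_neutral)
    fix i assume "i \<in> UNIV - {m}"
    then show "lcoeff a i ** lcoeff b (m + n - i) = 0"
      using assms unfolding supp_ge_def
      by (cases "i < m") (auto simp: mat2.zero_left mat2.zero_right)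
  qed auto
  then show ?thesis by simp
qed

lemma supp_le_mult:
  assumes "supp_le m a" "supp_le n b" shows "supp_le (m + n) (a * b)"
  unfolding supp_le_def
proof (intro allI impI)
  fix j assume "j > m + n"
  \<comment> \<open>Here \<open>j - n > m\<close>: regarding \<open>j - n\<close> as an upper bound
    for the support of \<open>a\<close>, the extreme coefficient is itself zero.\<close>
  then have "supp_le (j - n) a" "lcoeff a (j - n) = 0"
    using assms(1) by (auto simp: supp_le_def)
  then show "lcoeff (a * b) j = 0"
    using lcoeff_times_top[of "j - n" a n b] assms(2) by (simp add: mat2.zero_left)
qed

lemma supp_ge_mult:
  assumes "supp_ge m a" "supp_ge n b" shows "supp_ge (m + n) (a * b)"
  unfolding supp_ge_def
proof (intro allI impI)
  fix j assume "j < m + n"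
  then have "supp_ge (j - n) a" "lcoeff a (j - n) = 0"
    using assms(1) by (auto simp: supp_ge_def)
  then show "lcoeff (a * b) j = 0"
    using lcoeff_times_bot[of "j - n" a n b] assms(2) by (simp add: mat2.zero_left)
qed

lemma supp_ladj [simp]:
  "supp_le m (ladj a) \<longleftrightarrow> supp_le m a" "supp_ge m (ladj a) \<longleftrightarrow> supp_ge m a"
proof -
  have "adj2 X = 0 \<longleftrightarrow> X = 0" for X :: mat2
    by (auto simp: mat2_eq_iff)
  then show "supp_le m (ladj a) \<longleftrightarrow> supp_le m a" "supp_ge m (ladj a) \<longleftrightarrow> supp_ge m a"
    by (simp_all add: supp_le_def supp_ge_def lcoeff_ladj)
qed

lemma supp_add:
  "supp_le m a \<Longrightarrow> supp_le m b \<Longrightarrow> supp_le m (a + b)"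
  "supp_ge m a \<Longrightarrow> supp_ge m b \<Longrightarrow> supp_ge m (a + b)"
  by (simp_all add: supp_le_def supp_ge_def plus_loop.rep_eq)

lemma supp_le_mono: "supp_le m a \<Longrightarrow> m \<le> n \<Longrightarrow> supp_le n a"
  by (auto simp: supp_le_def)

lemma supp_one [simp]: "supp_le 0 1" "supp_ge 0 1"
  by (simp_all add: supp_le_def supp_ge_def lcoeff_one)

lemma lneg_eq_self_iff: "lneg a = a \<longleftrightarrow> supp_le (-1) a"
proof -
  have "lneg a = a \<longleftrightarrow> (\<forall>j. lcoeff (lneg a) j = lcoeff a j)"
    by (auto intro: loop_eqI)
  also have "\<dots> \<longleftrightarrow> supp_le (-1) a"
    by (auto simp: lcoeff_lneg supp_le_def not_less split: if_splits)
  finally show ?thesis .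
qed

lemma lneg_eq_0_iff: "lneg a = 0 \<longleftrightarrow> supp_ge 0 a"
proof -
  have "lneg a = 0 \<longleftrightarrow> (\<forall>j. lcoeff (lneg a) j = 0)"
    by (auto intro: loop_eqI simp: zero_loop.rep_eq)
  then show ?thesis
    by (auto simp: lcoeff_lneg supp_ge_def split: if_splits)
qed

text \<open>The algebraic counterpart of Liouville's theorem: the two half-lines of exponents share
  only 0. All uniqueness of factors rests on it.\<close>

lemma supp_le_ge_eq_one:
  assumes "supp_le 0 a" "supp_ge 0 a" "lcoeff a 0 = mat 1"
  shows "a = 1"
  using assms by (intro loop_eqI) (auto simp: supp_le_def supp_ge_def lcoeff_one neq_iff)

lemma supp_lneg: "supp_le (-1) (lneg a)"
  by (simp add: supp_le_def lcoeff_lneg)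

section \<open>Loops as functions on the unit circle\<close>

text \<open>Every power other than -1 has a primitive on the punctured plane; the remaining one is
  Cauchy's formula for a constant.\<close>

lemma has_contour_integral_powi:
  "((\<lambda>z. z powi m) has_contour_integral (if m = -1 then 2 * pi * \<i> else 0)) (circlepath 0 1)"
proof (cases "m = -1")
  case True
  have "((\<lambda>w. 1 / (w - 0)) has_contour_integral (2 * pi * \<i>)) (circlepath 0 1)"
    using Cauchy_integral_circlepath_simple[of "\<lambda>_. 1" 0 1 0] by simp
  then show ?thesis
    using True by (simp add: power_int_minus inverse_eq_divide)
next
  case False
  have "((\<lambda>z. z powi (m + 1) / of_int (m + 1)) has_field_derivative z powi m) (at z within - {0})"
    if "z \<in> - {0}" for z :: complex
  proof -
    have nz: "complex_of_int (m + 1) \<noteq> 0"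
      using False by (metis add_eq_0_iff2 of_int_eq_0_iff)
    show ?thesis
      using that nz by (auto intro!: derivative_eq_intros simp del: of_int_add)
  qed
  from contour_integral_primitive[OF this, of "circlepath 0 1"]
  show ?thesis
    using False by (auto simp: path_image_circlepath)
qed

text \<open>Absolute summability gives uniform convergence on the circle along the filter of finite
  index sets, so the integral may be taken term by term.\<close>

lemma contour_integral_laurent:
  fixes c :: "int \<Rightarrow> complex"
  assumes c: "(\<lambda>j. norm (c j)) summable_on UNIV"
  shows "contour_integral (circlepath 0 1) (\<lambda>z. (\<Sum>\<^sub>\<infinity>j. c j * z powi j) * z powi (- k - 1))
    = 2 * pi * \<i> * c k"
proof -
  let ?f = "\<lambda>F z. \<Sum>j\<in>F. c j * z powi (j - k - 1)"
  let ?l = "\<lambda>z. \<Sum>\<^sub>\<infinity>j. c j * z powi (j - k - 1)"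
  have int: "(?f F has_contour_integral (\<Sum>j\<in>F. c j * (if j - k - 1 = -1 then 2 * pi * \<i> else 0)))
      (circlepath 0 1)" if "finite F" for F
    by (intro has_contour_integral_sum that has_contour_integral_lmul has_contour_integral_powi)
  have val: "contour_integral (circlepath 0 1) (?f F) = 2 * pi * \<i> * c k"
    if "finite F" "k \<in> F" for F
  proof -
    have "(\<Sum>j\<in>F. c j * (if j - k - 1 = -1 then 2 * pi * \<i> else 0)) =
        (\<Sum>j\<in>F. if j = k then 2 * pi * \<i> * c k else 0)"
      by (rule sum.cong) auto
    then show ?thesis
      using contour_integral_unique[OF int[OF that(1)]] that by simp
  qed
  have ul: "uniform_limit (sphere 0 1) ?f ?l (finite_subsets_at_top UNIV)"
    by (rule Weierstrass_m_test_general[OF _ c]) (auto simp: norm_mult norm_power_int)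
  have ev: "\<forall>\<^sub>F F in finite_subsets_at_top UNIV. ?f F contour_integrable_on circlepath 0 1"
    by (rule eventually_mono[OF eventually_finite_subsets_at_top_weakI])
      (use int has_contour_integral_integrable in blast)+
  have "((\<lambda>F. contour_integral (circlepath 0 1) (?f F)) \<longlongrightarrow> contour_integral (circlepath 0 1) ?l)
      (finite_subsets_at_top UNIV)"
    by (rule contour_integral_uniform_limit_circlepath[OF ev]) (use ul in auto)
  \<comment> \<open>The net of integrals is eventually constant: its value is final as soon as the
    finite set contains \<open>k\<close>.\<close>
  moreover have "((\<lambda>F. contour_integral (circlepath 0 1) (?f F)) \<longlongrightarrow> 2 * pi * \<i> * c k)
      (finite_subsets_at_top UNIV)"
    by (rule tendsto_eventually, unfold eventually_finite_subsets_at_top, rule exI[of _ "{k}"])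
      (use val in auto)
  ultimately have "contour_integral (circlepath 0 1) ?l = 2 * pi * \<i> * c k"
    by (rule tendsto_unique[OF finite_subsets_at_top_neq_bot])
  moreover have "contour_integral (circlepath 0 1) ?l =
      contour_integral (circlepath 0 1) (\<lambda>z. (\<Sum>\<^sub>\<infinity>j. c j * z powi j) * z powi (- k - 1))"
  proof (rule contour_integral_cong)
    fix z :: complex assume "z \<in> path_image (circlepath 0 1)"
    then have "z \<noteq> 0" by (auto simp: path_image_circlepath)
    have "?l z = (\<Sum>\<^sub>\<infinity>j. c j * z powi j * z powi (- k - 1))"
      by (rule infsum_cong) (use \<open>z \<noteq> 0\<close> in \<open>simp add: power_int_add[symmetric] mult.assoc algebra_simps\<close>)
    then show "?l z = (\<Sum>\<^sub>\<infinity>j. c j * z powi j) * z powi (- k - 1)"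
      by (simp add: infsum_cmult_left')
  qed auto
  ultimately show ?thesis by simp
qed

lemma infsum_cauchy_product:
  fixes f g :: "int \<Rightarrow> complex"
  assumes f: "(\<lambda>i. norm (f i)) summable_on UNIV" and g: "(\<lambda>i. norm (g i)) summable_on UNIV"
  shows "(\<Sum>\<^sub>\<infinity>n. \<Sum>\<^sub>\<infinity>i. f i * g (n - i)) = infsum f UNIV * infsum g UNIV"
    and "(\<lambda>n. \<Sum>\<^sub>\<infinity>i. f i * g (n - i)) summable_on UNIV"
    and "(\<lambda>i. f i * g (n - i)) summable_on UNIV"
proof -
  have s: "(\<lambda>(i, j). f i * g j) summable_on UNIV \<times> UNIV"
  proof (rule abs_summable_summable, rule summable_on_SigmaI)
    show "((\<lambda>j. norm (case (i, j) of (i, j) \<Rightarrow> f i * g j)) has_sum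
        norm (f i) * infsum (\<lambda>j. norm (g j)) UNIV) UNIV" for i
      using has_sum_cmult_right[OF has_sum_infsum[OF g]] by (simp add: norm_mult)
    show "(\<lambda>i. norm (f i) * infsum (\<lambda>j. norm (g j)) UNIV) summable_on UNIV"
      by (rule summable_on_cmult_left[OF f])
  qed auto
  \<comment> \<open>The substitution j = n - i turns the convolution array into the plain product
    array, whose absolute summability is immediate.\<close>
  have bij: "bij_betw (\<lambda>(n, i). (i, n - i)) (UNIV \<times> UNIV) (UNIV \<times> (UNIV :: int set))"
    by (rule bij_betw_byWitness[where f' = "\<lambda>(i, j). (i + j, i)"]) auto
  have s': "(\<lambda>(n, i). f i * g (n - i)) summable_on UNIV \<times> UNIV"
    using summable_on_reindex_bij_betw[OF bij, of "\<lambda>(i, j). f i * g j"] s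
    by (simp add: case_prod_unfold)
  have "(\<Sum>\<^sub>\<infinity>n. \<Sum>\<^sub>\<infinity>i. f i * g (n - i)) = (\<Sum>\<^sub>\<infinity>(n, i)\<in>UNIV \<times> UNIV. f i * g (n - i))"
    by (rule infsum_Sigma'_banach[OF s'])
  also have "\<dots> = (\<Sum>\<^sub>\<infinity>(i, j)\<in>UNIV \<times> UNIV. f i * g j)"
    using infsum_reindex_bij_betw[OF bij, of "\<lambda>(i, j). f i * g j"] by (simp add: case_prod_unfold)
  also have "\<dots> = (\<Sum>\<^sub>\<infinity>i. \<Sum>\<^sub>\<infinity>j. f i * g j)"
    by (rule infsum_Sigma'_banach[OF s, symmetric])
  also have "\<dots> = infsum f UNIV * infsum g UNIV"
    by (simp add: infsum_cmult_right' infsum_cmult_left')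
  finally show "(\<Sum>\<^sub>\<infinity>n. \<Sum>\<^sub>\<infinity>i. f i * g (n - i)) = infsum f UNIV * infsum g UNIV" .
  show "(\<lambda>n. \<Sum>\<^sub>\<infinity>i. f i * g (n - i)) summable_on UNIV"
    by (rule summable_on_Sigma_banach[OF s'])
  show "(\<lambda>i. f i * g (n - i)) summable_on UNIV"
    using summable_on_SigmaD1[OF s', of n] by simp
qed

lemma abs_entry_le_norm: "\<bar>X $ i $ k\<bar> \<le> norm (X :: mat2)"
  by (metis Finite_Cartesian_Product.norm_nth_le order_trans real_norm_def)

lemma loop_eval_abs_summable:
  assumes "norm z = 1"
  shows "(\<lambda>j. norm (complex_of_real (lcoeff a j $ i $ k) * z powi j)) summable_on UNIV"
  by (rule Infinite_Sum.abs_summable_on_comparison_test'[OF lcoeff_summable[of a]])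
    (use assms in \<open>simp add: norm_mult norm_power_int abs_entry_le_norm\<close>)

lemma entry_abs_summable:
  "(\<lambda>j. norm (complex_of_real (lcoeff a j $ i $ k))) summable_on UNIV"
  by (rule Infinite_Sum.abs_summable_on_comparison_test'[OF lcoeff_summable[of a]])
    (simp add: abs_entry_le_norm)

lemma loop_eval_nth: "loop_eval a z $ i $ k = (\<Sum>\<^sub>\<infinity>j. complex_of_real (lcoeff a j $ i $ k) * z powi j)"
  by (simp add: loop_eval_def)

lemma bounded_linear_entry: "bounded_linear (\<lambda>X :: mat2. complex_of_real (X $ i $ k))"
  by (intro bounded_linear_compose[OF bounded_linear_of_real] bounded_linear_compose[OF bounded_linear_vec_nth]
      bounded_linear_vec_nth)

lemma loop_eval_mult:
  assumes z: "norm z = 1"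
  shows "loop_eval (a * b) z = loop_eval a z ** loop_eval b z"
proof -
  have z0: "z \<noteq> 0" using z by auto
  have "loop_eval (a * b) z $ i $ k =
      loop_eval a z $ i $ 1 * loop_eval b z $ 1 $ k + loop_eval a z $ i $ 2 * loop_eval b z $ 2 $ k" for i k
  proof -
    let ?f = "\<lambda>s j. complex_of_real (lcoeff a j $ i $ s) * z powi j"
    let ?g = "\<lambda>s j. complex_of_real (lcoeff b j $ s $ k) * z powi j"
    note P = infsum_cauchy_product[OF loop_eval_abs_summable[OF z] loop_eval_abs_summable[OF z]]
    have "complex_of_real (lcoeff (a * b) n $ i $ k) * z powi n
        = (\<Sum>\<^sub>\<infinity>j. ?f 1 j * ?g 1 (n - j)) + (\<Sum>\<^sub>\<infinity>j. ?f 2 j * ?g 2 (n - j))" for n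
    proof -
      have "complex_of_real (lcoeff (a * b) n $ i $ k) * z powi n =
          (\<Sum>\<^sub>\<infinity>j. complex_of_real ((lcoeff a j ** lcoeff b (n - j)) $ i $ k)) * z powi n"
        unfolding lcoeff_times
        by (simp only: infsum_bounded_linear_image[OF bounded_linear_entry conv_mat_summable])
      also have "\<dots> = (\<Sum>\<^sub>\<infinity>j. complex_of_real ((lcoeff a j ** lcoeff b (n - j)) $ i $ k) * z powi n)"
        by (simp only: infsum_cmult_left')
      also have "\<dots> = (\<Sum>\<^sub>\<infinity>j. ?f 1 j * ?g 1 (n - j) + ?f 2 j * ?g 2 (n - j))"
        by (rule infsum_cong) (use z0 in \<open>simp add: power_int_diff field_simps\<close>)
      also have "\<dots> = (\<Sum>\<^sub>\<infinity>j. ?f 1 j * ?g 1 (n - j)) + (\<Sum>\<^sub>\<infinity>j. ?f 2 j * ?g 2 (n - j))"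
        by (rule infsum_add) (rule P(3))+
      finally show ?thesis .
    qed
    then have "loop_eval (a * b) z $ i $ k
        = (\<Sum>\<^sub>\<infinity>n. (\<Sum>\<^sub>\<infinity>j. ?f 1 j * ?g 1 (n - j)) + (\<Sum>\<^sub>\<infinity>j. ?f 2 j * ?g 2 (n - j)))"
      by (simp add: loop_eval_nth)
    also have "\<dots> = infsum (?f 1) UNIV * infsum (?g 1) UNIV + infsum (?f 2) UNIV * infsum (?g 2) UNIV"
      by (subst infsum_add[OF P(2) P(2)]) (simp only: P(1))
    finally show ?thesis
      by (simp add: loop_eval_nth)
  qed
  then show ?thesis
    by (simp add: mat2_eq_iff)
qed

text \<open>Integration over the circle recovers each coefficient. Identities of matrices that hold
  at every point of the circle thereby become identities in the loop algebra.\<close>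

lemma loop_eval_inject:
  assumes "\<And>z. norm z = 1 \<Longrightarrow> loop_eval a z = loop_eval b z"
  shows "a = b"
proof (rule loop_eqI)
  fix n
  have "lcoeff a n $ i $ k = lcoeff b n $ i $ k" for i k
  proof -
    have "contour_integral (circlepath 0 1) (\<lambda>z. loop_eval a z $ i $ k * z powi (- n - 1)) =
        contour_integral (circlepath 0 1) (\<lambda>z. loop_eval b z $ i $ k * z powi (- n - 1))"
      by (rule contour_integral_cong) (use assms in \<open>auto simp: path_image_circlepath\<close>)
    then show ?thesis
      unfolding loop_eval_nth contour_integral_laurent[OF entry_abs_summable]
      by simp
  qed
  then show "lcoeff a n = lcoeff b n"
    by (simp add: mat2_eq_iff)
qed

lemma loop_eval_one: "loop_eval 1 z = mat 1"
proof -
  have "loop_eval 1 z $ i $ k = complex_of_real ((mat 1 :: mat2) $ i $ k)" for i k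
  proof -
    have "loop_eval 1 z $ i $ k = (\<Sum>\<^sub>\<infinity>j\<in>{0}. complex_of_real (lcoeff 1 j $ i $ k) * z powi j)"
      unfolding loop_eval_nth by (rule infsum_cong_neutral) (auto simp: lcoeff_one)
    then show ?thesis by (simp add: lcoeff_one)
  qed
  then show ?thesis by (simp add: mat2_eq_iff)
qed

lemma loop_eval_ladj: "loop_eval (ladj a) z = adj2 (loop_eval a z)"
  by (simp add: mat2_eq_iff loop_eval_nth lcoeff_ladj infsum_uminus)

lemma loop_eval_lsig:
  assumes "z \<noteq> 0"
  shows "loop_eval (lsig a) (- z) = sigma (loop_eval a z)"
proof -
  have [simp]: "(- z) powi j = (if even j then z powi j else - (z powi j))" for j
    using power_int_minus_left[of z j] assms by auto
  have "loop_eval (lsig a) (- z) $ i $ k = 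
    (\<Sum>\<^sub>\<infinity>j. complex_of_real (sigma (lcoeff a j) $ i $ k) * z powi j)" for i k
    unfolding loop_eval_nth by (rule infsum_cong) (auto simp: lcoeff_lsig)
  then show ?thesis
    by (simp add: mat2_eq_iff loop_eval_nth infsum_uminus)
qed

text \<open>Turns a condition on values into the fixed point equation of a bounded linear algebra
  homomorphism, a form that survives products and differentiation.\<close>

lemma twisted_iff: "twisted a \<longleftrightarrow> lsig a = a"
proof
  assume tw: "twisted a"
  show "lsig a = a"
  proof (rule loop_eval_inject)
    fix z :: complex assume "norm z = 1"
    then have "norm (- z) = 1" "- z \<noteq> 0" by auto
    then show "loop_eval (lsig a) z = loop_eval a z"
      using loop_eval_lsig[of "- z" a] tw by (simp add: twisted_def)
  qed
next
  assume eq: "lsig a = a"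
  show "twisted a"
    unfolding twisted_def
  proof (intro allI impI)
    fix z :: complex assume "norm z = 1"
    then have "z \<noteq> 0" by auto
    then show "sigma (loop_eval a z) = loop_eval a (- z)"
      using loop_eval_lsig[of z a] eq by simp
  qed
qed

text \<open>At each point of the circle both products are the determinant times the identity. Hence
  a right inverse of the form \<open>ladj a\<close> is automatically two-sided.\<close>

lemma mult_ladj_commute: "a * ladj a = ladj a * a"
  by (rule loop_eval_inject) (simp add: loop_eval_mult loop_eval_ladj mult_adj2 adj2_mult_self)

lemma Lambda_G_sigma_iff: "a \<in> Lambda_G_sigma \<longleftrightarrow> a * ladj a = 1 \<and> lsig a = a"
proof -
  have "(\<forall>z. norm z = 1 \<longrightarrow> det (loop_eval a z) = 1) \<longleftrightarrow> a * ladj a = 1"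
  proof
    assume "\<forall>z. norm z = 1 \<longrightarrow> det (loop_eval a z) = 1"
    then show "a * ladj a = 1"
      by (intro loop_eval_inject) (simp add: loop_eval_mult loop_eval_ladj mult_adj2 loop_eval_one)
  next
    assume eq: "a * ladj a = 1"
    have "det (loop_eval a z) = 1" if "norm z = 1" for z
    proof -
      have "mat (det (loop_eval a z)) = (mat 1 :: complex^2^2)"
        using arg_cong[OF eq, of "\<lambda>b. loop_eval b z"] that
        by (simp add: loop_eval_mult loop_eval_ladj mult_adj2 loop_eval_one)
      then show ?thesis by (simp add: mat2_eq_iff)
    qed
    then show "\<forall>z. norm z = 1 \<longrightarrow> det (loop_eval a z) = 1" by blast
  qed
  then show ?thesis
    by (simp add: Lambda_G_sigma_def twisted_iff)
qed

lemma loop_inv_eq: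
  assumes "a * b = 1" "b * a = 1"
  shows "loop_inv a = b"
  unfolding loop_inv_def
proof (rule the_equality)
  fix c assume c: "a * c = 1 \<and> c * a = 1"
  then have "c = c * (a * b)" using assms by simp
  also have "\<dots> = b" using c by (simp add: mult.assoc[symmetric])
  finally show "c = b" .
qed (use assms in auto)

lemma loop_inv_Lambda_G_sigma: "a \<in> Lambda_G_sigma \<Longrightarrow> loop_inv a = ladj a"
  by (rule loop_inv_eq) (simp_all add: Lambda_G_sigma_iff mult_ladj_commute[symmetric])

lemma Lambda_G_sigma_mult: "a \<in> Lambda_G_sigma \<Longrightarrow> b \<in> Lambda_G_sigma \<Longrightarrow> a * b \<in> Lambda_G_sigma"
  unfolding Lambda_G_sigma_iff
  by (metis ladj_mult lsig_mult mult.assoc mult.right_neutral)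

lemma Lambda_G_sigma_ladj: "a \<in> Lambda_G_sigma \<Longrightarrow> ladj a \<in> Lambda_G_sigma"
  by (simp add: Lambda_G_sigma_iff mult_ladj_commute lsig_ladj)

lemma Lambda_G_sigma_one: "1 \<in> Lambda_G_sigma"
  by (simp add: Lambda_G_sigma_iff)

lemma Lambda_G_sigma_cancel:
  assumes "a \<in> Lambda_G_sigma"
  shows "a * ladj a = 1" "ladj a * a = 1" "a * (ladj a * b) = b" "ladj a * (a * b) = b"
  using assms by (simp_all add: Lambda_G_sigma_iff mult_ladj_commute mult.assoc[symmetric])

text \<open>For a two by two matrix, \<open>adj2 X = - X\<close> says exactly that the trace
  vanishes; this is the linearization of \<open>a * ladj a = 1\<close>.\<close>

lemma Lambda_g_sigma_iff: "\<xi> \<in> Lambda_g_sigma \<longleftrightarrow> ladj \<xi> = - \<xi> \<and> lsig \<xi> = \<xi>"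
proof -
  have "ladj \<xi> = - \<xi> \<longleftrightarrow> (\<forall>j. lcoeff (ladj \<xi>) j = lcoeff (- \<xi>) j)"
    by (auto intro: loop_eqI)
  also have "\<dots> \<longleftrightarrow> (\<forall>j. lcoeff \<xi> j \<in> sl2)"
    by (auto simp: lcoeff_ladj uminus_loop.rep_eq sl2_def trace_mat2 mat2_eq_iff eq_neg_iff_add_eq_0 add.commute)
  finally show ?thesis
    by (auto simp: Lambda_g_sigma_def twisted_iff)
qed

subsection \<open>Loops with a holomorphic extension to the punctured plane\<close>

lemma extends_mult:
  assumes "extends_analytically a" "extends_analytically b"
  shows "extends_analytically (a * b)"
proof -
  obtain F G where F: "\<And>i k. (\<lambda>z. F z $ i $ k) holomorphic_on - {0}" "\<And>z. norm z = 1 \<Longrightarrow> F z = loop_eval a z"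
    and G: "\<And>i k. (\<lambda>z. G z $ i $ k) holomorphic_on - {0}" "\<And>z. norm z = 1 \<Longrightarrow> G z = loop_eval b z"
    using assms unfolding extends_analytically_def by blast
  show ?thesis
    unfolding extends_analytically_def
    by (rule exI[of _ "\<lambda>z. F z ** G z"]) (auto intro!: holomorphic_intros F G simp: F(2) G(2) loop_eval_mult)
qed

lemma extends_ladj:
  assumes "extends_analytically a"
  shows "extends_analytically (ladj a)"
proof -
  obtain F where F: "\<And>i k. (\<lambda>z. F z $ i $ k) holomorphic_on - {0}" "\<And>z. norm z = 1 \<Longrightarrow> F z = loop_eval a z"
    using assms unfolding extends_analytically_def by blast
  have "(\<lambda>z. adj2 (F z) $ i $ k) holomorphic_on - {0}" for i k
  proof -
    have "\<forall>i k. (\<lambda>z. adj2 (F z) $ i $ k) holomorphic_on - {0}"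
      unfolding forall_2 by (auto intro!: holomorphic_intros F)
    then show ?thesis by blast
  qed
  then show ?thesis
    unfolding extends_analytically_def
    by (intro exI[of _ "\<lambda>z. adj2 (F z)"]) (auto simp: F(2) loop_eval_ladj)
qed

lemma extends_one: "extends_analytically 1"
  unfolding extends_analytically_def
  by (rule exI[of _ "\<lambda>_. mat 1"]) (auto simp: loop_eval_one)

lemma tLambda_G_sigma_mult: "a \<in> tLambda_G_sigma \<Longrightarrow> b \<in> tLambda_G_sigma \<Longrightarrow> a * b \<in> tLambda_G_sigma"
  by (simp add: tLambda_G_sigma_def Lambda_G_sigma_mult extends_mult)

lemma tLambda_G_sigma_ladj: "a \<in> tLambda_G_sigma \<Longrightarrow> ladj a \<in> tLambda_G_sigma"
  by (simp add: tLambda_G_sigma_def Lambda_G_sigma_ladj extends_ladj)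

lemma tLambda_G_sigma_one: "1 \<in> tLambda_G_sigma"
  by (simp add: tLambda_G_sigma_def Lambda_G_sigma_one extends_one)

lemma norm_mat2_le: "norm (X :: mat2) \<le> \<bar>X$1$1\<bar> + \<bar>X$1$2\<bar> + \<bar>X$2$1\<bar> + \<bar>X$2$2\<bar>"
proof -
  have "norm X \<le> norm (X $ 1) + norm (X $ 2)"
    unfolding norm_vec_def[of X] using L2_set_le_sum[of UNIV "\<lambda>i. norm (X $ i)"] by (simp add: sum_2)
  also have "\<dots> \<le> (\<bar>X$1$1\<bar> + \<bar>X$1$2\<bar>) + (\<bar>X$2$1\<bar> + \<bar>X$2$2\<bar>)"
    using norm_le_l1_cart[of "X $ 1"] norm_le_l1_cart[of "X $ 2"] by (simp add: sum_2)
  finally show ?thesis by simp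
qed

text \<open>Cauchy's estimates on the circle of radius \<open>r\<close>. Small \<open>r\<close>
  controls the negative coefficients, large \<open>r\<close> the positive ones.\<close>

lemma extends_decay:
  assumes "extends_analytically a" "r > 0"
  obtains M where "M \<ge> 0" "\<And>j. norm (lcoeff a j) \<le> M * r powi (- j)"
proof -
  obtain F where F: "\<And>i k. (\<lambda>z. F z $ i $ k) holomorphic_on - {0}" "\<And>z. norm z = 1 \<Longrightarrow> F z = loop_eval a z"
    using assms unfolding extends_analytically_def by blast
  have "\<exists>M\<ge>0. \<forall>n. \<bar>lcoeff a n $ i $ k\<bar> \<le> M * r powi (- n)" for i k
  proof -
    define f where "f = (\<lambda>z. F z $ i $ k)"
    have "compact (f ` sphere 0 r)"
      by (intro compact_continuous_image holomorphic_on_imp_continuous_on[OF holomorphic_on_subset])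
        (use F(1)[of i k] assms in \<open>auto simp: f_def\<close>)
    then obtain M where "\<forall>w \<in> f ` sphere 0 r. norm w \<le> M"
      by (meson bounded_iff compact_imp_bounded)
    then have M: "norm (f z) \<le> M" if "norm z = r" for z
      using that by simp
    have "M \<ge> 0"
      using order_trans[OF norm_ge_zero M[of "complex_of_real r"]] assms(2) by simp
    have "\<bar>lcoeff a n $ i $ k\<bar> \<le> M * r powi (- n)" for n
    proof -
      define g where "g = (\<lambda>z. f z * z powi (- n - 1))"
      have hol: "g holomorphic_on UNIV - {0}"
        unfolding g_def by (intro holomorphic_intros) (use F(1)[of i k] in \<open>auto simp: f_def Compl_eq_Diff_UNIV\<close>)
      \<comment> \<open>Every circle about 0 yields the same residue, so the contour that defines
        the coefficient can be moved from radius 1 to radius \<open>r\<close>.\<close>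
      have circ: "(g has_contour_integral 2 * pi * \<i> * residue g 0) (circlepath 0 s)" if "s > 0" for s
        by (rule base_residue[OF open_UNIV _ that hol]) auto
      have "contour_integral (circlepath 0 1) g =
          contour_integral (circlepath 0 1) (\<lambda>z. loop_eval a z $ i $ k * z powi (- n - 1))"
        by (rule contour_integral_cong) (auto simp: path_image_circlepath g_def f_def F(2))
      also have "\<dots> = 2 * pi * \<i> * complex_of_real (lcoeff a n $ i $ k)"
        unfolding loop_eval_nth by (rule contour_integral_laurent[OF entry_abs_summable])
      finally have "(g has_contour_integral 2 * pi * \<i> * complex_of_real (lcoeff a n $ i $ k)) (circlepath 0 r)"
        using circ[of 1] circ[of r] assms contour_integral_unique by fastforce
      \<comment> \<open>The supremum of the integrand times the length of the circle; one factor
        \<open>r\<close> of the length cancels the -1 in the exponent.\<close>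
      then have "norm (2 * pi * \<i> * complex_of_real (lcoeff a n $ i $ k)) \<le> (M * r powi (- n - 1)) * (2 * pi * r)"
        by (rule has_contour_integral_bound_circlepath)
          (use M \<open>M \<ge> 0\<close> assms in \<open>auto simp: g_def norm_mult norm_power_int intro!: mult_right_mono\<close>)
      then show ?thesis
        using assms by (simp add: norm_mult power_int_diff field_simps)
    qed
    then show ?thesis using \<open>M \<ge> 0\<close> by blast
  qed
  then obtain M where M: "\<And>i k. M i k \<ge> 0" "\<And>i k n. \<bar>lcoeff a n $ i $ k\<bar> \<le> M i k * r powi (- n)"
    by metis
  show ?thesis
  proof (rule that[of "M 1 1 + M 1 2 + M 2 1 + M 2 2"])
    show "norm (lcoeff a j) \<le> (M 1 1 + M 1 2 + M 2 1 + M 2 2) * r powi - j" for j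
      using norm_mat2_le[of "lcoeff a j"] M(2)[of j 1 1] M(2)[of j 1 2] M(2)[of j 2 1] M(2)[of j 2 2]
      by (simp add: distrib_right)
  qed (use M in auto)
qed

text \<open>Coefficients that decay faster than every geometric sequence define an entire power
  series; substituting \<lambda> or its inverse, according to \<open>s\<close>, gives the
  extension.\<close>

lemma extends_one_sided:
  assumes s: "s = 1 \<or> s = - 1"
    and supp: "\<And>j. (\<And>n. j \<noteq> s * int n) \<Longrightarrow> lcoeff a j = 0"
    and decay: "\<And>\<rho>. \<rho> > 0 \<Longrightarrow> \<exists>M. \<forall>n. norm (lcoeff a (s * int n)) \<le> M * \<rho> ^ n"
  shows "extends_analytically a"
proof -
  define c where "c = (\<lambda>i k n. complex_of_real (lcoeff a (s * int n) $ i $ k))"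
  define f where "f = (\<lambda>i k w. \<Sum>n. c i k n * w ^ n)"
  have abs_summ: "summable (\<lambda>n. norm (c i k n * w ^ n))" for i k w
  proof -
    \<comment> \<open>Chosen so that \<rho> is positive and \<open>\<rho> * norm w < 1\<close>,
      including the case \<open>w = 0\<close>.\<close>
    define \<rho> where "\<rho> = 1 / (2 * (norm w + 1))"
    have "\<rho> > 0"
      using norm_ge_zero[of w] by (simp add: \<rho>_def add_nonneg_pos)
    then obtain M where M: "\<And>n. norm (lcoeff a (s * int n)) \<le> M * \<rho> ^ n"
      using decay by blast
    have "\<rho> * norm w < 1"
      unfolding \<rho>_def using norm_ge_zero[of w] by (simp add: divide_less_eq add_nonneg_pos)
    then have "summable (\<lambda>n. M * (\<rho> * norm w) ^ n)"
      using \<open>\<rho> > 0\<close> by (intro summable_mult summable_geometric) (simp add: abs_mult)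
    then show ?thesis
    proof (rule summable_comparison_test'[where N = 0])
      fix n
      have "norm (c i k n) \<le> M * \<rho> ^ n"
        using abs_entry_le_norm[of "lcoeff a (s * int n)" i k] M[of n] by (simp add: c_def)
      then show "norm (norm (c i k n * w ^ n)) \<le> M * (\<rho> * norm w) ^ n"
        using mult_right_mono[of "norm (c i k n)" "M * \<rho> ^ n" "norm w ^ n"]
        by (simp add: norm_mult norm_power power_mult_distrib mult.assoc)
    qed
  qed
  have hol: "f i k holomorphic_on UNIV" for i k
  proof -
    have ball: "f i k holomorphic_on ball 0 R" for R
      by (rule power_series_holomorphic[where a = "c i k"])
        (use summable_sums[OF summable_norm_cancel[OF abs_summ]] in \<open>auto simp: f_def\<close>)
    have "f i k field_differentiable at z" for z
      using holomorphic_on_imp_differentiable_at[OF ball[of "norm z + 1"] open_ball] by simp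
    then show ?thesis
      by (simp add: holomorphic_on_def)
  qed
  have val: "f i k (z powi s) = loop_eval a z $ i $ k" if z: "norm z = 1" for i k z
  proof -
    have z0: "z \<noteq> 0" using z by auto
    have inj: "inj (\<lambda>n. s * int n)"
      using s by (auto simp: inj_def)
    have pw: "z powi (s * int n) = (z powi s) ^ n" for n
      using z0 by (simp add: power_int_mult)
    have "loop_eval a z $ i $ k = (\<Sum>\<^sub>\<infinity>j\<in>range (\<lambda>n. s * int n). complex_of_real (lcoeff a j $ i $ k) * z powi j)"
      unfolding loop_eval_nth by (rule infsum_cong_neutral) (use supp in \<open>auto simp: image_iff\<close>)
    also have "\<dots> = (\<Sum>\<^sub>\<infinity>n. c i k n * (z powi s) ^ n)"
      unfolding infsum_reindex[OF inj] o_def by (simp add: c_def pw)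
    also have "\<dots> = f i k (z powi s)"
      unfolding f_def using norm_summable_imp_has_sum[OF abs_summ summable_sums[OF summable_norm_cancel[OF abs_summ]]]
      by (rule infsumI)
    finally show ?thesis by simp
  qed
  have "(\<lambda>z. f i k (z powi s)) holomorphic_on - {0}" for i k
  proof -
    have "(\<lambda>z :: complex. z powi s) holomorphic_on - {0}"
      by (intro holomorphic_intros) auto
    from holomorphic_on_compose[OF this holomorphic_on_subset[OF hol]] show ?thesis
      by (auto simp: o_def)
  qed
  then show ?thesis
    unfolding extends_analytically_def
    by (intro exI[of _ "\<lambda>z. \<chi> i k. f i k (z powi s)"]) (auto simp: val vec_eq_iff)
qed

text \<open>The bound on \<open>b\<close> is asked only at the indices that meet the support of
  \<open>a\<close>; when \<open>a\<close> has no negative powers, only one end of \<open>b\<close>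
  enters.\<close>

lemma convolution_bound:
  assumes "\<And>i. lcoeff a i \<noteq> 0 \<Longrightarrow> norm (lcoeff b (m - i)) \<le> K" "K \<ge> 0"
  shows "norm (lcoeff (a * b) m) \<le> norm a * K"
proof -
  have 1: "((\<lambda>i. norm (lcoeff a i) * K) has_sum (norm a * K)) UNIV"
    using has_sum_cmult_left[OF has_sum_infsum[OF lcoeff_summable[of a]]] by (simp add: norm_loop_def)
  have 2: "((\<lambda>i. lcoeff a i ** lcoeff b (m - i)) has_sum lcoeff (a * b) m) UNIV"
    unfolding lcoeff_times by (rule has_sum_infsum[OF conv_mat_summable])
  have 3: "norm (lcoeff a i ** lcoeff b (m - i)) \<le> norm (lcoeff a i) * K" for i
  proof (cases "lcoeff a i = 0")
    case False
    then show ?thesis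
      by (intro order_trans[OF norm_mat2_mult] mult_left_mono assms) auto
  qed (simp add: mat2.zero_left)
  show ?thesis
    by (rule norm_infsum_le[OF 2 1 3])
qed

section \<open>Factorization of loops near the identity\<close>

text \<open>Projection of \<open>1 + v + (k + v * k)\<close> to the negative powers. This direction
  applies to any factorization already at hand, however it was obtained.\<close>

lemma birkhoff_fixed_point:
  assumes "supp_le (-1) v" "supp_ge 0 ((1 + v) * (1 + k))"
  shows "v = - lneg (k + v * k)"
proof -
  have "lneg ((1 + v) * (1 + k)) = 0"
    using assms by (simp add: lneg_eq_0_iff)
  then have "lneg 1 + lneg v + lneg (k + v * k) = 0"
    by (simp add: algebra_simps lneg_add[symmetric])
  moreover have "lneg 1 = 0" "lneg v = v"
    using assms by (simp_all add: lneg_eq_0_iff lneg_eq_self_iff)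
  ultimately show ?thesis
    by (simp add: eq_neg_iff_add_eq_0)
qed

text \<open>The threshold 1/2 lets \<open>norm v / 2\<close> be absorbed on the left. The second
  estimate identifies \<open>- lneg k\<close> as the linear part of \<open>v\<close>, with remainder
  \<open>- lneg (v * k)\<close>.\<close>

lemma birkhoff_norm_bound:
  assumes "v = - lneg (k + v * k)" "norm k \<le> 1/2"
  shows "norm v \<le> 2 * norm k" "norm (v + lneg k) \<le> 2 * (norm k)\<^sup>2"
proof -
  have "norm v \<le> norm (k + v * k)"
    using assms(1) norm_lneg_le[of "k + v * k"] by (metis norm_minus_cancel)
  also have "\<dots> \<le> norm k + norm v * (1/2)"
    using norm_triangle_ineq[of k "v * k"] norm_mult_ineq[of v k]
      mult_left_mono[OF assms(2), of "norm v"] by simp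
  finally show v: "norm v \<le> 2 * norm k" by simp
  have "v + lneg k = - lneg (v * k)"
    by (subst assms(1)) (simp add: lneg_add)
  then have "norm (v + lneg k) \<le> norm v * norm k"
    using norm_lneg_le[of "v * k"] norm_mult_ineq[of v k] by simp
  also have "\<dots> \<le> 2 * norm k * norm k"
    using v by (intro mult_right_mono) auto
  finally show "norm (v + lneg k) \<le> 2 * (norm k)\<^sup>2"
    by (simp add: power2_eq_square)
qed

text \<open>The map \<open>f\<close> is affine and contracts with rate \<open>norm k < 1\<close> on
  the whole Banach space. Its fixed point gives \<open>u = 1 + v\<close> for which
  \<open>q = u * g\<close> has no negative powers; the work lies in showing that \<open>u\<close> is
  twisted, has determinant one and extends analytically.\<close>

lemma birkhoff_near_one:
  assumes g: "g \<in> tLambda_G_sigma" and small: "norm (g - 1) < 1"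
  obtains m q where "m \<in> tLambda_minus_star" "q \<in> tLambda_plus" "g = m * q"
proof -
  define k where "k = g - 1"
  define f where "f = (\<lambda>v. - lneg (k + v * k))"
  have gG: "g \<in> Lambda_G_sigma" "extends_analytically g"
    using g by (auto simp: tLambda_G_sigma_def)
  have "\<exists>!v. f v = v"
  proof (rule banach_fix_type[where c = "norm k"])
    show "\<forall>v w. dist (f v) (f w) \<le> norm k * dist v w"
    proof (intro allI)
      fix v w
      have "f v - f w = - lneg ((v - w) * k)"
        by (simp add: f_def lneg_diff[symmetric] algebra_simps flip: lneg_minus)
      then have "norm (f v - f w) \<le> norm (v - w) * norm k"
        using norm_lneg_le[of "(v - w) * k"] norm_mult_ineq[of "v - w" k] by simp
      then show "dist (f v) (f w) \<le> norm k * dist v w"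
        by (simp add: dist_norm mult.commute)
    qed
  qed (use small in \<open>auto simp: k_def\<close>)
  then obtain v where v: "f v = v" and uniq: "\<And>w. f w = w \<Longrightarrow> w = v" by blast
  have "lsig k = k"
    using gG by (simp add: k_def lsig_diff Lambda_G_sigma_iff)
  \<comment> \<open>The twist commutes with the projection and fixes \<open>k\<close>, so it
    permutes the fixed points of \<open>f\<close>, of which there is only one.\<close>
  then have "f (lsig v) = lsig v"
    using v by (metis f_def lsig_add lsig_lneg lsig_minus lsig_mult)
  then have sv: "lsig v = v" by (rule uniq)
  have suppv: "supp_le (-1) v"
    using supp_lneg[of "- (k + v * k)"] v unfolding lneg_minus f_def by simp
  define u where "u = 1 + v"
  define q where "q = u * g"
  have "lneg (k + v * k) = - v"
    using v unfolding f_def by (metis minus_minus)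
  moreover have "lneg q = lneg 1 + lneg v + lneg (k + v * k)"
    by (simp add: q_def u_def k_def lneg_add[symmetric] algebra_simps)
  moreover have "lneg 1 = 0" "lneg v = v"
    using suppv by (simp_all add: lneg_eq_0_iff lneg_eq_self_iff)
  ultimately have sq: "supp_ge 0 q"
    by (simp add: lneg_eq_0_iff[symmetric])
  have su: "supp_le 0 u"
    unfolding u_def by (rule supp_add) (use suppv supp_le_mono[OF suppv] in auto)
  have u0: "lcoeff u 0 = mat 1"
    using suppv by (simp add: u_def plus_loop.rep_eq lcoeff_one supp_le_def)
  have "q * ladj q = u * (g * ladj g) * ladj u"
    by (simp add: q_def ladj_mult mult.assoc)
  then have qq: "q * ladj q = u * ladj u"
    using gG by (simp add: Lambda_G_sigma_cancel)
  \<comment> \<open>This product is the determinant of \<open>u\<close>. It has no positive powers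
    because of \<open>u\<close> and no negative ones because it equals the determinant of
    \<open>q\<close>.\<close>
  have uu: "u * ladj u = 1"
  proof (rule supp_le_ge_eq_one)
    show "supp_le 0 (u * ladj u)"
      using supp_le_mult[of 0 u 0 "ladj u"] su by simp
    show "supp_ge 0 (u * ladj u)"
      using supp_ge_mult[of 0 q 0 "ladj q"] sq by (simp add: qq[symmetric])
    show "lcoeff (u * ladj u) 0 = mat 1"
      using lcoeff_times_top[of 0 u 0 "ladj u"] su u0 by (simp add: lcoeff_ladj mat2_eq_iff)
  qed
  have uG: "u \<in> Lambda_G_sigma"
    using uu sv by (simp add: Lambda_G_sigma_iff u_def lsig_add)
  have qG: "q \<in> Lambda_G_sigma"
    unfolding q_def by (rule Lambda_G_sigma_mult[OF uG gG(1)])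
  \<comment> \<open>Since \<open>q\<close> has only powers from 0 upward, the coefficient of
    \<open>u\<close> at -n involves \<open>ladj g\<close> only at exponents up to -n, where it
    decays rapidly.\<close>
  have "u = q * ladj g"
    using gG by (simp add: q_def mult.assoc Lambda_G_sigma_cancel)
  have uext: "extends_analytically u"
  proof (rule extends_one_sided[where s = "- 1"])
    fix j :: int assume "\<And>n. j \<noteq> - 1 * int n"
    from this[of "nat (- j)"] have "j > 0"
      by (cases "j \<le> 0") auto
    then show "lcoeff u j = 0" using su by (simp add: supp_le_def)
  next
    fix \<rho> :: real assume "\<rho> > 0"
    \<comment> \<open>The cap at 1 makes \<open>r powi (int n + i) \<le> r ^ n\<close> for all
      \<open>i \<ge> 0\<close>.\<close>
    define r where "r = min \<rho> 1"
    have r: "0 < r" "r \<le> 1" "r \<le> \<rho>" using \<open>\<rho> > 0\<close> by (auto simp: r_def)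
    obtain M where M: "M \<ge> 0" "\<And>j. norm (lcoeff (ladj g) j) \<le> M * r powi (- j)"
      using extends_decay[OF extends_ladj[OF gG(2)] r(1)] by blast
    have "norm (lcoeff (q * ladj g) (- int n)) \<le> norm q * (M * r ^ n)" for n
    proof (rule convolution_bound)
      fix i assume "lcoeff q i \<noteq> 0"
      then have "i \<ge> 0" using sq by (force simp: supp_ge_def not_less)
      have "r powi (int n + i) \<le> r ^ n"
        using \<open>i \<ge> 0\<close> r power_decreasing[of n "nat (int n + i)" r] by (simp add: power_int_def)
      then show "norm (lcoeff (ladj g) (- int n - i)) \<le> M * r ^ n"
        using M(2)[of "- int n - i"] mult_left_mono[of "r powi (int n + i)" "r ^ n" M] M(1)
        by (simp add: add.commute)
    qed (use M r in auto)
    also have "norm q * (M * r ^ n) \<le> norm q * M * \<rho> ^ n" for n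
      using r M(1) power_mono[of r \<rho> n] by (simp add: mult_left_mono mult.assoc)
    finally show "\<exists>M. \<forall>n. norm (lcoeff u (- 1 * int n)) \<le> M * \<rho> ^ n"
      unfolding \<open>u = q * ladj g\<close>[symmetric] by auto
  qed auto
  have uT: "u \<in> tLambda_G_sigma"
    using uG uext by (simp add: tLambda_G_sigma_def)
  have qT: "q \<in> tLambda_G_sigma"
    unfolding q_def by (rule tLambda_G_sigma_mult[OF uT g])
  show ?thesis
  proof (rule that)
    show "ladj u \<in> tLambda_minus_star"
      using tLambda_G_sigma_ladj[OF uT] su u0 supp_ladj(1)[of 0 u]
      by (simp add: tLambda_minus_star_def supp_le_def lcoeff_ladj mat2_eq_iff)
    show "q \<in> tLambda_plus"
      using qT sq by (simp add: tLambda_plus_def supp_ge_def)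
    show "g = ladj u * q"
      using uG by (simp add: q_def Lambda_G_sigma_cancel)
  qed
qed

section \<open>Smooth maps\<close>

lemma higher_differentiable_on_D:
  assumes "higher_differentiable_on S f (Suc n)" "x \<in> S"
  shows "(f has_derivative frechet_derivative f (at x)) (at x)"
  using assms(1)[THEN higher_differentiable_on.simps(2)[THEN iffD1], THEN conjunct1] assms(2)
    frechet_derivative_works by blast

lemma higher_differentiable_on_cong:
  assumes "open S" "\<And>x. x \<in> S \<Longrightarrow> f x = g x" "higher_differentiable_on S g n"
  shows "higher_differentiable_on S f n"
  using assms(2,3)
proof (induction n arbitrary: f g)
  case 0
  then show ?case
    using continuous_on_cong[of S S f g] by simp
next
  case (Suc n)
  have d: "(f has_derivative frechet_derivative g (at x)) (at x)" if "x \<in> S" for x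
    by (rule has_derivative_transform_within_open[OF higher_differentiable_on_D[OF Suc.prems(2) that]
          assms(1) that]) (use Suc.prems(1) in simp)
  have eq: "frechet_derivative f (at x) = frechet_derivative g (at x)" if "x \<in> S" for x
    using frechet_derivative_at[OF d[OF that]] by simp
  have "higher_differentiable_on S (\<lambda>x. frechet_derivative f (at x) v) n" for v
    by (rule Suc.IH[of _ "\<lambda>x. frechet_derivative g (at x) v"])
      (use eq Suc.prems(2) in simp_all)
  then show ?case
    using d by (auto simp: differentiable_def)
qed

lemma higher_differentiable_on_SucI:
  assumes "open S" "\<And>x. x \<in> S \<Longrightarrow> (f has_derivative f' x) (at x)"
    and "\<And>v. higher_differentiable_on S (\<lambda>x. f' x v) n"
  shows "higher_differentiable_on S f (Suc n)"
proof -
  have eq: "frechet_derivative f (at x) = f' x" if "x \<in> S" for x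
    by (rule frechet_derivative_at[OF assms(2)[OF that], symmetric])
  have "higher_differentiable_on S (\<lambda>x. frechet_derivative f (at x) v) n" for v
    by (rule higher_differentiable_on_cong[OF assms(1) _ assms(3)[of v]]) (simp only: eq)
  moreover have "f differentiable at x" if "x \<in> S" for x
    by (rule differentiableI[OF assms(2)[OF that]])
  ultimately show ?thesis
    by simp
qed

lemma higher_differentiable_on_Suc_imp:
  "higher_differentiable_on S f (Suc n) \<Longrightarrow> higher_differentiable_on S f n"
proof (induction n arbitrary: f)
  case 0
  then show ?case
    unfolding higher_differentiable_on.simps(1)
    by (intro continuous_at_imp_continuous_on ballI has_derivative_continuous[OF higher_differentiable_on_D])
next
  case (Suc n)
  note P = Suc.prems[THEN higher_differentiable_on.simps(2)[THEN iffD1]]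
  show ?case
    by (rule higher_differentiable_on.simps(2)[THEN iffD2], rule conjI[OF P[THEN conjunct1]],
        rule allI, rule Suc.IH, rule P[THEN conjunct2, THEN spec])
qed

section \<open>Closure properties of maps that are differentiable n times\<close>

lemma higher_differentiable_on_const: "open S \<Longrightarrow> higher_differentiable_on S (\<lambda>_. c) n"
proof (induction n arbitrary: c)
  case (Suc n)
  show ?case
    by (rule higher_differentiable_on_SucI[where f' = "\<lambda>_ _. 0"]) (use Suc in auto)
qed simp

lemma higher_differentiable_on_add:
  assumes "open S" "higher_differentiable_on S f n" "higher_differentiable_on S g n"
  shows "higher_differentiable_on S (\<lambda>x. f x + g x) n"
  using assms(2,3)
proof (induction n arbitrary: f g)
  case 0
  then show ?case by (simp add: continuous_on_add)
next
  case (Suc n)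
  show ?case
    by (rule higher_differentiable_on_SucI[OF assms(1)
          has_derivative_add[OF higher_differentiable_on_D[OF Suc.prems(1)] higher_differentiable_on_D[OF Suc.prems(2)]]])
      (use Suc in simp_all)
qed

lemma higher_differentiable_on_bounded_linear:
  assumes "open S" "bounded_linear h" "higher_differentiable_on S f n"
  shows "higher_differentiable_on S (\<lambda>x. h (f x)) n"
  using assms(3)
proof (induction n arbitrary: f)
  case 0
  then show ?case using bounded_linear.continuous_on[OF assms(2)] by simp
next
  case (Suc n)
  show ?case
    by (rule higher_differentiable_on_SucI[OF assms(1) bounded_linear.has_derivative[OF assms(2)
          higher_differentiable_on_D[OF Suc.prems]]])
      (use Suc in simp_all)
qed

lemma higher_differentiable_on_bilinear:
  assumes "open S" "bounded_bilinear pr"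
    and "higher_differentiable_on S f n" "higher_differentiable_on S g n"
  shows "higher_differentiable_on S (\<lambda>x. pr (f x) (g x)) n"
  using assms(3,4)
proof (induction n arbitrary: f g)
  case 0
  then show ?case
    unfolding higher_differentiable_on.simps(1) by (rule bounded_bilinear.continuous_on[OF assms(2)])
next
  case (Suc n)
  have d: "\<And>v. higher_differentiable_on S (\<lambda>x. frechet_derivative f (at x) v) n"
    "\<And>v. higher_differentiable_on S (\<lambda>x. frechet_derivative g (at x) v) n"
    using Suc.prems by simp_all
  show ?case
  proof (rule higher_differentiable_on_SucI[OF assms(1)])
    fix x assume "x \<in> S"
    then show "((\<lambda>x. pr (f x) (g x)) has_derivative (\<lambda>v. pr (f x) (frechet_derivative g (at x) v) +
        pr (frechet_derivative f (at x) v) (g x))) (at x)"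
      using bounded_bilinear.FDERIV[OF assms(2) higher_differentiable_on_D[OF Suc.prems(1)]
          higher_differentiable_on_D[OF Suc.prems(2)]] by blast
  next
    fix v
    \<comment> \<open>The undifferentiated factors are available at order \<open>Suc n\<close> and
      are lowered to \<open>n\<close>, so that the induction hypothesis covers both
      products.\<close>
    show "higher_differentiable_on S (\<lambda>x. pr (f x) (frechet_derivative g (at x) v) +
        pr (frechet_derivative f (at x) v) (g x)) n"
      by (intro higher_differentiable_on_add[OF assms(1)] Suc.IH d
          Suc.prems[THEN higher_differentiable_on_Suc_imp])
  qed
qed

lemma higher_differentiable_on_compose_linear:
  assumes "open T" "bounded_linear L" "L ` T \<subseteq> S" "higher_differentiable_on S f n"
  shows "higher_differentiable_on T (\<lambda>x. f (L x)) n"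
  using assms(4)
proof (induction n arbitrary: f)
  case 0
  then show ?case
    using continuous_on_compose2[of S f T L] assms bounded_linear.continuous_on[OF assms(2) continuous_on_id]
    by simp
next
  case (Suc n)
  show ?case
  proof (rule higher_differentiable_on_SucI[OF assms(1)])
    fix x assume "x \<in> T"
    then have "L x \<in> S" using assms(3) by blast
    then show "((\<lambda>x. f (L x)) has_derivative (\<lambda>v. frechet_derivative f (at (L x)) (L v))) (at x)"
      by (rule has_derivative_compose[OF bounded_linear_imp_has_derivative[OF assms(2)]
            higher_differentiable_on_D[OF Suc.prems]])
  next
    fix v
    show "higher_differentiable_on T (\<lambda>x. frechet_derivative f (at (L x)) (L v)) n"
      by (rule Suc.IH) (use Suc.prems in simp)
  qed
qed

lemma smooth_on_cong: "open S \<Longrightarrow> (\<And>x. x \<in> S \<Longrightarrow> f x = g x) \<Longrightarrow> smooth_on S g \<Longrightarrow> smooth_on S f"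
  unfolding smooth_on_def using higher_differentiable_on_cong by blast

lemma smooth_on_bounded_linear:
  "open S \<Longrightarrow> bounded_linear h \<Longrightarrow> smooth_on S f \<Longrightarrow> smooth_on S (\<lambda>x. h (f x))"
  unfolding smooth_on_def using higher_differentiable_on_bounded_linear by blast

lemma smooth_on_bilinear:
  "open S \<Longrightarrow> bounded_bilinear pr \<Longrightarrow> smooth_on S f \<Longrightarrow> smooth_on S g \<Longrightarrow>
    smooth_on S (\<lambda>x. pr (f x) (g x))"
  unfolding smooth_on_def using higher_differentiable_on_bilinear by blast

lemma smooth_on_const: "open S \<Longrightarrow> smooth_on S (\<lambda>_. c)"
  unfolding smooth_on_def using higher_differentiable_on_const by blast

lemma smooth_on_compose_linear:
  "open T \<Longrightarrow> bounded_linear L \<Longrightarrow> L ` T \<subseteq> S \<Longrightarrow> smooth_on S f \<Longrightarrow> smooth_on T (\<lambda>x. f (L x))"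
  unfolding smooth_on_def using higher_differentiable_on_compose_linear by blast

lemma smooth_on_has_derivative:
  "smooth_on S f \<Longrightarrow> x \<in> S \<Longrightarrow> (f has_derivative frechet_derivative f (at x)) (at x)"
  unfolding smooth_on_def using higher_differentiable_on_D by blast

lemma smooth_on_derivative: "smooth_on S f \<Longrightarrow> smooth_on S (\<lambda>x. frechet_derivative f (at x) v)"
  unfolding smooth_on_def using higher_differentiable_on.simps(2) by blast

lemma smooth_on_continuous_on: "smooth_on S f \<Longrightarrow> continuous_on S f"
  unfolding smooth_on_def using higher_differentiable_on.simps(1) by blast

text \<open>Each pass gains one order: regularity \<open>n\<close> of \<open>f\<close> gives
  regularity \<open>n\<close> of its derivative, hence \<open>Suc n\<close> of
  \<open>f\<close>.\<close>

lemma smooth_on_bootstrap: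
  assumes "open S" "\<And>x. x \<in> S \<Longrightarrow> (f has_derivative f' x) (at x)"
    and "\<And>n v. higher_differentiable_on S f n \<Longrightarrow> higher_differentiable_on S (\<lambda>x. f' x v) n"
  shows "smooth_on S f"
  unfolding smooth_on_def
proof
  fix n show "higher_differentiable_on S f n"
  proof (induction n)
    case 0
    then show ?case
      using assms(2) by (auto intro!: continuous_at_imp_continuous_on has_derivative_continuous)
  next
    case (Suc n)
    show ?case
      by (rule higher_differentiable_on_SucI[OF assms(1,2) assms(3)[OF Suc]])
  qed
qed

lemma smooth_on_ode:
  assumes "open (I :: real set)" "bounded_bilinear pr" "smooth_on I \<xi>"
    and "\<And>t. t \<in> I \<Longrightarrow> (u has_vector_derivative pr (u t) (\<xi> t)) (at t)"
  shows "smooth_on I u"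
proof (rule smooth_on_bootstrap[OF assms(1)])
  fix t assume "t \<in> I"
  then show "(u has_derivative (\<lambda>v. v *\<^sub>R pr (u t) (\<xi> t))) (at t)"
    using assms(4) by (simp add: has_vector_derivative_def)
next
  fix n v assume "higher_differentiable_on I u n"
  then show "higher_differentiable_on I (\<lambda>t. v *\<^sub>R pr (u t) (\<xi> t)) n"
    using assms(3) unfolding smooth_on_def
    by (intro higher_differentiable_on_bounded_linear[OF assms(1) bounded_linear_scaleR_right]
        higher_differentiable_on_bilinear[OF assms(1,2)]) auto
qed

section \<open>Linear differential equations in Banach spaces\<close>

lemma interval_around:
  fixes I :: "real set"
  assumes "open I" "convex I" "0 \<in> I" "t \<in> I"
  obtains a b where "a < 0" "a < t" "0 < b" "t < b" "{a..b} \<subseteq> I"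
proof -
  obtain e where e: "e > 0" "ball (min 0 t) e \<subseteq> I"
    by (rule openE[OF assms(1), of "min 0 t"]) (use assms(3,4) in \<open>auto simp: min_def\<close>)
  obtain d where d: "d > 0" "ball (max 0 t) d \<subseteq> I"
    by (rule openE[OF assms(1), of "max 0 t"]) (use assms(3,4) in \<open>auto simp: max_def\<close>)
  define a b where "a = min 0 t - e / 2" and "b = max 0 t + d / 2"
  have "a \<in> ball (min 0 t) e" "b \<in> ball (max 0 t) d"
    using e(1) d(1) by (auto simp: a_def b_def dist_real_def)
  then have "a \<in> I" "b \<in> I"
    using e(2) d(2) by auto
  then have "{a..b} \<subseteq> I"
    using assms(2) by (meson atLeastAtMost_iff is_interval_1 is_interval_convex_1 subsetI)
  then show ?thesis
    using that[of a b] e d by (simp add: a_def b_def)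
qed

text \<open>The case distinction supplies the orientation: the set integral over
  \<open>{0..t}\<close> is zero for negative \<open>t\<close>.\<close>

definition primitive :: "(real \<Rightarrow> 'a::banach) \<Rightarrow> real \<Rightarrow> 'a" where
  "primitive f t = (if 0 \<le> t then integral {0..t} f else - integral {t..0} f)"

lemma primitive_0 [simp]: "primitive f 0 = 0"
  by (simp add: primitive_def)

lemma primitive_has_vector_derivative:
  assumes "open I" "convex I" "0 \<in> I" "continuous_on I f" "t \<in> I"
  shows "(primitive f has_vector_derivative f t) (at t)"
proof -
  obtain a b where ab: "a < 0" "a < t" "0 < b" "t < b" "{a..b} \<subseteq> I"
    using interval_around[OF assms(1,2,3,5)] by blast
  have cont: "continuous_on {a..b} f"
    by (rule continuous_on_subset[OF assms(4) ab(5)])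
  have int: "f integrable_on {c..d}" if "a \<le> c" "d \<le> b" for c d
    by (rule integrable_continuous_real, rule continuous_on_subset[OF cont]) (use that in auto)
  \<comment> \<open>A fixed left end \<open>a < 0\<close> avoids the change of formula at 0;
    subtracting the constant \<open>integral {a..0} f\<close> gives the primitive on both
    sides.\<close>
  have "((\<lambda>u. integral {a..u} f - integral {a..0} f) has_vector_derivative f t - 0) (at t within {a..b})"
    by (intro has_vector_derivative_diff has_vector_derivative_const integral_has_vector_derivative[OF cont])
      (use ab in auto)
  then have d: "((\<lambda>u. integral {a..u} f - integral {a..0} f) has_vector_derivative f t) (at t)"
    using ab at_within_Icc_at[of a t b] by simp
  show ?thesis
  proof (rule has_vector_derivative_transform_within_open[OF d])
    show "integral {a..u} f - integral {a..0} f = primitive f u" if "u \<in> {a<..<b}" for u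
    proof (cases "0 \<le> u")
      case True
      then show ?thesis
        using Henstock_Kurzweil_Integration.integral_combine[of a 0 u f] int[of a u] ab that
        by (simp add: primitive_def algebra_simps)
    next
      case False
      then show ?thesis
        using Henstock_Kurzweil_Integration.integral_combine[of a u 0 f] int[of a 0] ab that
        by (simp add: primitive_def algebra_simps)
    qed
  qed (use ab in auto)
qed

text \<open>One step of the factorial estimate for iterated integrals. Negative \<open>t\<close> is
  reduced to positive by reflection.\<close>

lemma power_bound_of_derivative:
  fixes f :: "real \<Rightarrow> 'a::real_normed_vector"
  assumes "f 0 = 0" "\<And>s. s \<in> {a..b} \<Longrightarrow> (f has_vector_derivative f' s) (at s)"
    and bnd: "\<And>s. s \<in> {a..b} \<Longrightarrow> norm (f' s) \<le> N * \<bar>s\<bar> ^ n"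
    and ab: "a < 0" "0 < b" "t \<in> {a..b}"
  shows "norm (f t) \<le> N * \<bar>t\<bar> ^ Suc n / real (Suc n)"
proof -
  have pos: "norm (h r) \<le> N * r ^ Suc n / real (Suc n)"
    if "r > 0" "h 0 = 0" "\<And>s. 0 \<le> s \<Longrightarrow> s \<le> r \<Longrightarrow> (h has_vector_derivative h' s) (at s)"
      "\<And>s. 0 \<le> s \<Longrightarrow> s \<le> r \<Longrightarrow> norm (h' s) \<le> N * s ^ n"
    for h h' :: "real \<Rightarrow> 'a" and r
  proof -
    have "norm (h r - h 0) \<le> N * r ^ Suc n / real (Suc n) - N * 0 ^ Suc n / real (Suc n)"
    proof (rule differentiable_bound_general[where f' = h' and \<phi>' = "\<lambda>s. N * s ^ n"])
      show "continuous_on {0..r} h"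
        by (rule continuous_on_vector_derivative[of "{0..r}" h h'])
          (use that in \<open>auto intro: has_vector_derivative_at_within\<close>)
      show "((\<lambda>s. N * s ^ Suc n / real (Suc n)) has_vector_derivative N * s ^ n) (at s)" for s
        unfolding has_real_derivative_iff_has_vector_derivative[symmetric]
        by (rule derivative_eq_intros refl | simp add: divide_simps)+
    qed (use that in \<open>auto intro!: continuous_intros\<close>)
    then show ?thesis using that by simp
  qed
  consider "t = 0" | "t > 0" | "t < 0" by linarith
  then show ?thesis
  proof cases
    case 2
    have "norm (f t) \<le> N * t ^ Suc n / real (Suc n)"
    proof (rule pos[where h' = f'])
      show "(f has_vector_derivative f' s) (at s)" if "0 \<le> s" "s \<le> t" for s
        by (rule assms(2)) (use that ab in auto)
      show "norm (f' s) \<le> N * s ^ n" if "0 \<le> s" "s \<le> t" for s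
        using bnd[of s] that ab by simp
    qed (use 2 assms(1) in auto)
    then show ?thesis using 2 by simp
  next
    case 3
    have "norm ((\<lambda>s. f (- s)) (- t)) \<le> N * (- t) ^ Suc n / real (Suc n)"
    proof (rule pos[where h' = "\<lambda>s. - f' (- s)"])
      show "((\<lambda>s. f (- s)) has_vector_derivative - f' (- s)) (at s)" if "0 \<le> s" "s \<le> - t" for s
      proof -
        have "(f has_vector_derivative f' (- s)) (at (- s))"
          using that ab 3 by (intro assms(2)) auto
        then show ?thesis
          using vector_diff_chain_at[of uminus "- 1" s f "f' (- s)"]
          by (simp add: o_def has_vector_derivative_minus[OF has_vector_derivative_id, unfolded id_def])
      qed
      show "norm (- f' (- s)) \<le> N * s ^ n" if "0 \<le> s" "s \<le> - t" for s
        using bnd[of "- s"] that ab 3 by simp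
    qed (use 3 assms(1) in auto)
    then show ?thesis using 3 by simp
  qed (use assms(1) in simp)
qed

text \<open>The iterated integrals whose sum is the solution, that is, the increments between
  successive Picard approximations.\<close>

primrec peano_baker ::
  "('a::banach \<Rightarrow> 'b \<Rightarrow> 'a) \<Rightarrow> (real \<Rightarrow> 'b) \<Rightarrow> 'a \<Rightarrow> nat \<Rightarrow> real \<Rightarrow> 'a" where
  "peano_baker pr \<xi> u0 0 = (\<lambda>t. u0)"
| "peano_baker pr \<xi> u0 (Suc n) = primitive (\<lambda>t. pr (peano_baker pr \<xi> u0 n t) (\<xi> t))"

text \<open>Linearity makes the series converge on every compact subinterval, so the solution is
  global. The functionals in \<Phi> cut out a closed subspace that contains \<open>u0\<close> and is
  mapped into itself by the right-hand side; all iterated integrals remain in it, and so does their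
  sum.\<close>

lemma linear_ivp_exists:
  fixes pr :: "'a::banach \<Rightarrow> 'b::real_normed_vector \<Rightarrow> 'a"
    and \<Phi> :: "('a \<Rightarrow> 'c::real_normed_vector) set"
  assumes bl: "bounded_bilinear pr" and I: "open I" "convex I" "0 \<in> I"
    and \<xi>: "continuous_on I \<xi>"
    and \<Phi>: "\<And>\<phi>. \<phi> \<in> \<Phi> \<Longrightarrow> bounded_linear \<phi>" "\<And>\<phi>. \<phi> \<in> \<Phi> \<Longrightarrow> \<phi> u0 = 0"
    and inv: "\<And>\<phi> x t. t \<in> I \<Longrightarrow> (\<And>\<phi>. \<phi> \<in> \<Phi> \<Longrightarrow> \<phi> x = 0) \<Longrightarrow> \<phi> \<in> \<Phi> \<Longrightarrow> \<phi> (pr x (\<xi> t)) = 0"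
  obtains u where "u 0 = u0" "\<And>t. t \<in> I \<Longrightarrow> (u has_vector_derivative pr (u t) (\<xi> t)) (at t)"
    "\<And>\<phi> t. t \<in> I \<Longrightarrow> \<phi> \<in> \<Phi> \<Longrightarrow> \<phi> (u t) = 0"
proof -
  interpret pr: bounded_bilinear pr by (rule bl)
  define p where "p = peano_baker pr \<xi> u0"
  \<comment> \<open>The termwise derivatives. The term 0 is constant, which is why the coefficients
    are shifted by one and start with 0.\<close>
  define g where "g = (\<lambda>n t. case n of 0 \<Rightarrow> 0 | Suc m \<Rightarrow> pr (p m t) (\<xi> t))"
  have cont: "continuous_on I (p n)" for n
  proof (induction n)
    case (Suc n)
    then have "continuous_on I (\<lambda>t. pr (p n t) (\<xi> t))"
      by (intro pr.continuous_on \<xi>)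
    then have "(p (Suc n) has_vector_derivative pr (p n t) (\<xi> t)) (at t)" if "t \<in> I" for t
      using primitive_has_vector_derivative[OF I _ that, of "\<lambda>t. pr (p n t) (\<xi> t)"] by (simp add: p_def)
    then show ?case
      by (rule continuous_on_vector_derivative[OF has_vector_derivative_at_within])
  qed (simp add: p_def)
  have deriv: "(p n has_vector_derivative g n t) (at t)" if "t \<in> I" for n t
  proof (cases n)
    case (Suc m)
    have "continuous_on I (\<lambda>t. pr (p m t) (\<xi> t))"
      by (intro pr.continuous_on cont \<xi>)
    from primitive_has_vector_derivative[OF I this that] show ?thesis
      by (simp add: p_def g_def Suc)
  qed (simp add: p_def g_def)
  have p0: "p n 0 = (if n = 0 then u0 else 0)" for n
    by (cases n) (simp_all add: p_def)
  define u where "u = (\<lambda>t. \<Sum>n. p n t)"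
  have local: "(u has_vector_derivative pr (u t) (\<xi> t)) (at t) \<and> (\<lambda>n. p n t) sums u t" if t: "t \<in> I" for t
  proof -
    obtain a b where ab: "a < 0" "a < t" "0 < b" "t < b" "{a..b} \<subseteq> I"
      using interval_around[OF I t] by blast
    obtain K where K: "K > 0" "\<And>x y. norm (pr x y) \<le> norm x * norm y * K"
      using pr.pos_bounded by blast
    have "compact (\<xi> ` {a..b})"
      by (intro compact_continuous_image continuous_on_subset[OF \<xi> ab(5)]) auto
    then obtain X where "\<forall>y \<in> \<xi> ` {a..b}. norm y \<le> X"
      by (meson bounded_iff compact_imp_bounded)
    then have X: "norm (\<xi> s) \<le> X" if "s \<in> {a..b}" for s
      using that by blast
    have "X \<ge> 0" using order_trans[OF norm_ge_zero X[of 0]] ab by simp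
    \<comment> \<open>\<open>C\<close> bounds the operators \<open>pr _ (\<xi> s)\<close> on the
      interval and \<open>r\<close> bounds the time, so the series is dominated by that of
      \<open>norm u0 * exp (C * r)\<close>.\<close>
    define C r where "C = X * K" and "r = max (- a) b"
    have C: "C \<ge> 0" using K \<open>X \<ge> 0\<close> by (simp add: C_def)
    have pr_le: "norm (pr x (\<xi> s)) \<le> C * norm x" if "s \<in> {a..b}" for x s
    proof -
      have "norm x * norm (\<xi> s) * K \<le> norm x * X * K"
        using K X[OF that] by (intro mult_right_mono mult_left_mono) auto
      then show ?thesis
        using K(2)[of x "\<xi> s"] by (simp add: C_def algebra_simps)
    qed
    have bound: "norm (p n s) \<le> norm u0 * C ^ n / fact n * \<bar>s\<bar> ^ n" if "s \<in> {a..b}" for n s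
      using that
    proof (induction n arbitrary: s)
      case (Suc n)
      have "norm (p (Suc n) s) \<le> (C * (norm u0 * C ^ n / fact n)) * \<bar>s\<bar> ^ Suc n / real (Suc n)"
      proof (rule power_bound_of_derivative[where f' = "g (Suc n)"])
        show "norm (g (Suc n) s) \<le> C * (norm u0 * C ^ n / fact n) * \<bar>s\<bar> ^ n" if "s \<in> {a..b}" for s
          using pr_le[OF that, of "p n s"] mult_left_mono[OF Suc.IH[OF that] C] by (simp add: g_def mult.assoc)
      qed (use deriv ab Suc.prems p0 in auto)
      then show ?case by (simp add: field_simps)
    qed (simp add: p_def)
    have r: "\<bar>s\<bar> \<le> r" if "s \<in> {a..b}" for s
      using that by (auto simp: r_def)
    have "r \<ge> 0" using ab by (simp add: r_def)
    have bound': "norm (p n s) \<le> norm u0 * (inverse (fact n) * (C * r) ^ n)" if "s \<in> {a..b}" for n s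
    proof -
      have "norm u0 * C ^ n / fact n * \<bar>s\<bar> ^ n \<le> norm u0 * C ^ n / fact n * r ^ n"
        using r[OF that] C by (intro mult_left_mono power_mono) auto
      then show ?thesis
        using bound[OF that, of n] by (simp add: field_simps)
    qed
    have M: "summable (\<lambda>n. norm u0 * (inverse (fact n) * (C * r) ^ n))"
      by (intro summable_mult summable_exp)
    have summ: "(\<lambda>n. p n s) sums u s" if "s \<in> {a..b}" for s
      unfolding u_def
      by (rule summable_sums, rule summable_comparison_test'[OF M, of 0]) (rule bound'[OF that])
    define G where "G = (\<lambda>s. \<Sum>n. g n s)"
    have G: "G s = pr (u s) (\<xi> s)" if "s \<in> {a..b}" for s
    proof -
      have "(\<lambda>n. g (Suc n) s) sums pr (u s) (\<xi> s)"
        unfolding g_def using bounded_linear.sums[OF pr.bounded_linear_left summ[OF that]] by simp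
      then have "(\<lambda>n. g n s) sums (pr (u s) (\<xi> s) + g 0 s)"
        by (rule sums_Suc_iff[of "\<lambda>n. g n s", THEN iffD1])
      then show ?thesis
        by (simp add: G_def sums_unique[symmetric] g_def)
    qed
    \<comment> \<open>Uniform convergence of the differentiated series is what permits
      differentiation term by term.\<close>
    have ul: "uniform_limit {a<..<b} (\<lambda>n s. \<Sum>i<n. g i s) G sequentially"
      unfolding G_def
    proof (rule Weierstrass_m_test)
      let ?M = "\<lambda>n. case n of 0 \<Rightarrow> 0 | Suc m \<Rightarrow> C * (norm u0 * (inverse (fact m) * (C * r) ^ m))"
      show "norm (g n s) \<le> ?M n" if "s \<in> {a<..<b}" for n s
      proof (cases n)
        case (Suc m)
        have s: "s \<in> {a..b}" using that by auto
        show ?thesis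
          using pr_le[OF s, of "p m s"] mult_left_mono[OF bound'[OF s] C, of m] by (simp add: g_def Suc)
      qed (simp add: g_def)
      show "summable ?M"
        using summable_Suc_iff[of ?M] summable_mult[OF M, of C] by simp
    qed
    have "\<exists>h. \<forall>s\<in>{a<..<b}. (\<lambda>n. p n s) sums h s \<and>
        (h has_derivative (\<lambda>v. v *\<^sub>R G s)) (at s within {a<..<b})"
    proof (rule has_derivative_series[where f' = "\<lambda>n s v. v *\<^sub>R g n s"])
      show "(p n has_derivative (\<lambda>v. v *\<^sub>R g n s)) (at s within {a<..<b})" if "s \<in> {a<..<b}" for n s
        using has_vector_derivative_at_within[OF deriv[of s n]] that ab
        by (auto simp: has_vector_derivative_def subset_iff)
      fix e :: real assume "e > 0"
      then have "\<forall>\<^sub>F n in sequentially. \<forall>s\<in>{a<..<b}. dist (\<Sum>i<n. g i s) (G s) < e"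
        using ul by (simp add: uniform_limit_iff)
      then show "\<forall>\<^sub>F n in sequentially. \<forall>s\<in>{a<..<b}. \<forall>h.
          norm ((\<Sum>i<n. h *\<^sub>R g i s) - h *\<^sub>R G s) \<le> e * norm h"
      proof (rule eventually_mono, intro ballI allI)
        fix n s h assume "\<forall>s\<in>{a<..<b}. dist (\<Sum>i<n. g i s) (G s) < e" "s \<in> {a<..<b}"
        then have "norm ((\<Sum>i<n. g i s) - G s) \<le> e"
          by (simp add: dist_norm less_imp_le)
        then show "norm ((\<Sum>i<n. h *\<^sub>R g i s) - h *\<^sub>R G s) \<le> e * norm h"
          unfolding scaleR_sum_right[symmetric] scaleR_diff_right[symmetric] norm_scaleR
          by (subst mult.commute) (simp add: mult_right_mono)
      qed
    qed (use ab summ[of t] in auto)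
    then obtain h where h: "\<And>s. s \<in> {a<..<b} \<Longrightarrow> (\<lambda>n. p n s) sums h s"
      "\<And>s. s \<in> {a<..<b} \<Longrightarrow> (h has_derivative (\<lambda>v. v *\<^sub>R G s)) (at s within {a<..<b})"
      by blast
    have "(h has_vector_derivative G t) (at t)"
      using h(2)[of t] ab at_within_open[of t "{a<..<b}"] by (simp add: has_vector_derivative_def)
    then have "(u has_vector_derivative G t) (at t)"
      by (rule has_vector_derivative_transform_within_open[of _ _ _ "{a<..<b}"])
        (use ab h(1) in \<open>auto simp: u_def sums_iff\<close>)
    then show ?thesis
      using G[of t] summ[of t] ab by simp
  qed
  \<comment> \<open>Under \<phi>, each later term has derivative zero by invariance and vanishes at
    time 0.\<close>
  have ker: "\<forall>\<phi>\<in>\<Phi>. \<forall>t\<in>I. \<phi> (p n t) = 0" for n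
  proof (induction n)
    case 0
    then show ?case using \<Phi>(2) by (simp add: p_def)
  next
    case (Suc n)
    show ?case
    proof (intro ballI)
      fix \<phi> t assume \<phi>: "\<phi> \<in> \<Phi>" and t: "t \<in> I"
      have "((\<lambda>s. \<phi> (p (Suc n) s)) has_vector_derivative 0) (at s within I)" if "s \<in> I" for s
      proof -
        have "\<phi> (g (Suc n) s) = 0"
          using inv[OF that _ \<phi>, of "p n s"] Suc that by (simp add: g_def)
        then show ?thesis
          using bounded_linear.has_vector_derivative[OF \<Phi>(1)[OF \<phi>] has_vector_derivative_at_within[OF deriv[OF that, of "Suc n"]]]
          by metis
      qed
      then obtain c where c: "\<And>s. s \<in> I \<Longrightarrow> \<phi> (p (Suc n) s) = c"
        using has_vector_derivative_zero_constant[OF I(2)] by blast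
      show "\<phi> (p (Suc n) t) = 0"
        using c[OF t] c[OF I(3)] p0[of "Suc n"] linear_0[OF bounded_linear.linear[OF \<Phi>(1)[OF \<phi>]]] by simp
    qed
  qed
  show ?thesis
  proof (rule that[of u])
    show "u 0 = u0"
      using sums_single[of 0 "\<lambda>_. u0"] by (simp add: u_def p0 sums_iff)
  next
    fix \<phi> t assume "t \<in> I" "\<phi> \<in> \<Phi>"
    then have "(\<lambda>n. \<phi> (p n t)) sums \<phi> (u t)"
      using bounded_linear.sums[OF \<Phi>(1)] local by blast
    moreover have "\<phi> (p n t) = 0" for n
      using ker \<open>t \<in> I\<close> \<open>\<phi> \<in> \<Phi>\<close> by blast
    ultimately show "\<phi> (u t) = 0"
      using sums_unique2[OF _ sums_zero] by simp
  qed (use local in blast)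
qed

section \<open>Iwasawa decompositions\<close>

lemma tLambda_minus_star_D:
  assumes "a \<in> tLambda_minus_star"
  shows "a \<in> tLambda_G_sigma" "a \<in> Lambda_G_sigma" "supp_le 0 a" "lcoeff a 0 = mat 1"
  using assms by (auto simp: tLambda_minus_star_def tLambda_G_sigma_def supp_le_def)

lemma tLambda_plus_D:
  assumes "a \<in> tLambda_plus"
  shows "a \<in> tLambda_G_sigma" "a \<in> Lambda_G_sigma" "supp_ge 0 a"
  using assms by (auto simp: tLambda_plus_def tLambda_G_sigma_def supp_ge_def)

lemma tLambda_minus_star_iff:
  "a \<in> tLambda_minus_star \<longleftrightarrow> a \<in> tLambda_G_sigma \<and> supp_le 0 a \<and> lcoeff a 0 = mat 1"
  by (auto simp: tLambda_minus_star_def supp_le_def)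

lemma tLambda_plus_iff: "a \<in> tLambda_plus \<longleftrightarrow> a \<in> tLambda_G_sigma \<and> supp_ge 0 a"
  by (auto simp: tLambda_plus_def supp_ge_def)

lemma adj2_one [simp]: "adj2 (mat 1 :: 'a::comm_ring_1^2^2) = mat 1"
  by (simp add: mat2_eq_iff)

lemma tLambda_minus_star_mult:
  assumes "a \<in> tLambda_minus_star" "b \<in> tLambda_minus_star"
  shows "a * b \<in> tLambda_minus_star"
  using assms supp_le_mult[of 0 a 0 b] lcoeff_times_top[of 0 a 0 b] matrix_mul_lid[of "mat 1 :: mat2"]
  by (simp add: tLambda_minus_star_iff tLambda_G_sigma_mult)

lemma tLambda_plus_mult:
  assumes "a \<in> tLambda_plus" "b \<in> tLambda_plus"
  shows "a * b \<in> tLambda_plus"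
  using assms supp_ge_mult[of 0 a 0 b] by (simp add: tLambda_plus_iff tLambda_G_sigma_mult)

lemma tLambda_plus_ladj: "a \<in> tLambda_plus \<Longrightarrow> ladj a \<in> tLambda_plus"
  by (simp add: tLambda_plus_iff tLambda_G_sigma_ladj)

lemma iwasawa_iff:
  "iwasawa g' g'' \<gamma> Lm Lp \<longleftrightarrow>
    \<gamma> \<in> tLambda_G_sigma \<and> Lm \<in> tLambda_minus_star \<and> Lp \<in> tLambda_plus \<and>
    \<gamma> = g' * Lm \<and> \<gamma> = g'' * Lp"
proof -
  have *: "g = \<gamma> * loop_inv L \<longleftrightarrow> \<gamma> = g * L" if "L \<in> Lambda_G_sigma" for g L
  proof
    assume "g = \<gamma> * loop_inv L"
    then show "\<gamma> = g * L"
      by (simp add: loop_inv_Lambda_G_sigma[OF that] mult.assoc Lambda_G_sigma_cancel[OF that])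
  next
    assume "\<gamma> = g * L"
    then show "g = \<gamma> * loop_inv L"
      by (simp add: loop_inv_Lambda_G_sigma[OF that] mult.assoc Lambda_G_sigma_cancel[OF that])
  qed
  show ?thesis
    unfolding iwasawa_def
    using *[OF tLambda_minus_star_D(2), of Lm] *[OF tLambda_plus_D(2), of Lp] by blast
qed

text \<open>The initial value problems deliver only absolutely summable loops; it is the existence
  of a decomposition that forces them to extend analytically.\<close>

lemma iwasawa_group:
  assumes "iwasawa g' g'' \<gamma> Lm Lp"
  shows "g' \<in> tLambda_G_sigma" "g'' \<in> tLambda_G_sigma"
proof -
  have L: "\<gamma> \<in> tLambda_G_sigma" "Lm \<in> tLambda_minus_star" "Lp \<in> tLambda_plus"
    and g: "g' = \<gamma> * loop_inv Lm" "g'' = \<gamma> * loop_inv Lp"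
    using assms by (simp_all add: iwasawa_def)
  show "g' \<in> tLambda_G_sigma" "g'' \<in> tLambda_G_sigma"
    unfolding g loop_inv_Lambda_G_sigma[OF tLambda_minus_star_D(2)[OF L(2)]]
      loop_inv_Lambda_G_sigma[OF tLambda_plus_D(2)[OF L(3)]]
    by (intro tLambda_G_sigma_mult tLambda_G_sigma_ladj tLambda_minus_star_D(1) tLambda_plus_D(1) L)+
qed

lemma tLambda_imp_Lambda: "a \<in> tLambda_G_sigma \<Longrightarrow> a \<in> Lambda_G_sigma"
  by (simp add: tLambda_G_sigma_def)

text \<open>Both decompositions give the same element \<open>ladj Mm * Lm = ladj Mp * Lp\<close>,
  which lies in the normalized minus group and in the plus group, hence is 1.\<close>

lemma iwasawa_unique:
  assumes 1: "iwasawa g' g'' \<gamma> Lm Lp" and 2: "iwasawa g' g'' \<delta> Mm Mp"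
  shows "\<gamma> = \<delta>" "Lm = Mm" "Lp = Mp"
proof -
  have G: "g' \<in> Lambda_G_sigma" "g'' \<in> Lambda_G_sigma"
    using iwasawa_group[OF 1] by (auto intro: tLambda_imp_Lambda)
  have m: "Lm \<in> tLambda_minus_star" "Mm \<in> tLambda_minus_star"
    and p: "Lp \<in> tLambda_plus" "Mp \<in> tLambda_plus"
    and e: "g' * Lm = g'' * Lp" "g' * Mm = g'' * Mp"
    using 1 2 by (auto simp: iwasawa_iff)
  note C = tLambda_minus_star_D[OF m(1)] tLambda_minus_star_D[OF m(2)]
    tLambda_plus_D[OF p(1)] tLambda_plus_D[OF p(2)]
  have "ladj Mm * Lm = ladj (g' * Mm) * (g' * Lm)"
    by (simp add: ladj_mult mult.assoc Lambda_G_sigma_cancel G)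
  also have "\<dots> = ladj (g'' * Mp) * (g'' * Lp)"
    by (simp only: e)
  finally have eq: "ladj Mm * Lm = ladj Mp * Lp"
    by (simp add: ladj_mult mult.assoc Lambda_G_sigma_cancel G)
  have "ladj Mm * Lm = 1"
  proof (rule supp_le_ge_eq_one)
    show "supp_le 0 (ladj Mm * Lm)"
      using supp_le_mult[of 0 "ladj Mm" 0 Lm] C by simp
    show "supp_ge 0 (ladj Mm * Lm)"
      unfolding eq using supp_ge_mult[of 0 "ladj Mp" 0 Lp] C by simp
    show "lcoeff (ladj Mm * Lm) 0 = mat 1"
      using lcoeff_times_top[of 0 "ladj Mm" 0 Lm] C matrix_mul_lid[of "mat 1 :: mat2"]
      by (simp add: lcoeff_ladj)
  qed
  then have "Mm * (ladj Mm * Lm) = Mm" "Mp * (ladj Mp * Lp) = Mp"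
    using eq by simp_all
  then show "Lm = Mm" "Lp = Mp"
    using C by (simp_all add: Lambda_G_sigma_cancel)
  then show "\<gamma> = \<delta>"
    using 1 2 by (simp add: iwasawa_iff)
qed

text \<open>Multiplied by the factors at \<open>p0\<close>, the loop
  \<open>ladj \<Psi>' * \<Psi>''\<close> becomes 1 there and stays within distance 1 nearby.
  Analytic extension is assumed at all points because \<open>birkhoff_near_one\<close> factors
  within the analytic subgroup.\<close>

lemma open_iwasawa_domain:
  assumes D: "open D" and cont: "continuous_on (fst ` D) \<Psi>'" "continuous_on (snd ` D) \<Psi>''"
    and G: "\<And>x. x \<in> fst ` D \<Longrightarrow> \<Psi>' x \<in> tLambda_G_sigma"
      "\<And>y. y \<in> snd ` D \<Longrightarrow> \<Psi>'' y \<in> tLambda_G_sigma"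
  shows "open (iwasawa_domain D \<Psi>' \<Psi>'')"
  unfolding open_subopen[of "iwasawa_domain D \<Psi>' \<Psi>''"]
proof
  fix p0 assume "p0 \<in> iwasawa_domain D \<Psi>' \<Psi>''"
  then obtain \<gamma> Lm Lp where p0: "p0 \<in> D" and iw: "iwasawa (\<Psi>' (fst p0)) (\<Psi>'' (snd p0)) \<gamma> Lm Lp"
    by (auto simp: iwasawa_domain_def)
  then have L: "Lm \<in> tLambda_minus_star" "Lp \<in> tLambda_plus" "\<gamma> \<in> tLambda_G_sigma"
    and e: "\<gamma> = \<Psi>' (fst p0) * Lm" "\<gamma> = \<Psi>'' (snd p0) * Lp"
    by (auto simp: iwasawa_iff)
  define g where "g = (\<lambda>p. ladj Lm * (ladj (\<Psi>' (fst p)) * \<Psi>'' (snd p)) * Lp)"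
  define T where "T = D \<inter> (\<lambda>p. g p - 1) -` ball 0 1"
  have "continuous_on D g"
    unfolding g_def
    by (intro continuous_on_mult continuous_on_const bounded_linear.continuous_on[OF bounded_linear_ladj]
        continuous_on_compose2[OF cont(1) continuous_on_fst[OF continuous_on_id]]
        continuous_on_compose2[OF cont(2) continuous_on_snd[OF continuous_on_id]]) auto
  then have "open T"
    unfolding T_def by (intro continuous_open_preimage continuous_on_diff continuous_on_const D open_ball)
  moreover have "p0 \<in> T"
  proof -
    have "g p0 = ladj \<gamma> * \<gamma>"
      unfolding g_def by (subst (1) e(1), subst e(2)) (simp add: ladj_mult mult.assoc)
    then have "g p0 = 1"
      using tLambda_imp_Lambda[OF L(3)] by (simp add: Lambda_G_sigma_cancel)
    then show ?thesis
      using p0 by (simp add: T_def)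
  qed
  moreover have "T \<subseteq> iwasawa_domain D \<Psi>' \<Psi>''"
  proof
    fix p assume "p \<in> T"
    then have p: "p \<in> D" "norm (g p - 1) < 1"
      by (auto simp: T_def)
    have \<Psi>: "\<Psi>' (fst p) \<in> tLambda_G_sigma" "\<Psi>'' (snd p) \<in> tLambda_G_sigma"
      using G p(1) by auto
    have "g p \<in> tLambda_G_sigma"
      unfolding g_def
      by (intro tLambda_G_sigma_mult tLambda_G_sigma_ladj \<Psi> tLambda_minus_star_D(1) tLambda_plus_D(1) L)
    then obtain m q where mq: "m \<in> tLambda_minus_star" "q \<in> tLambda_plus" "g p = m * q"
      using birkhoff_near_one[OF _ p(2)] by blast
    note C = Lambda_G_sigma_cancel[OF tLambda_imp_Lambda[OF \<Psi>(1)]]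
      Lambda_G_sigma_cancel[OF tLambda_minus_star_D(2)[OF L(1)]]
      Lambda_G_sigma_cancel[OF tLambda_plus_D(2)[OF mq(2)]]
    have "\<Psi>'' (snd p) * Lp = \<Psi>' (fst p) * (Lm * g p)"
      by (simp add: g_def mult.assoc C)
    \<comment> \<open>The factorization \<open>g p = m * q\<close> corrects \<open>Lm\<close> by
      \<open>m\<close> and \<open>Lp\<close> by the inverse of \<open>q\<close>.\<close>
    then have "\<Psi>'' (snd p) * (Lp * ladj q) = \<Psi>' (fst p) * (Lm * (m * (q * ladj q)))"
      by (simp add: mult.assoc[symmetric] mq(3))
    then have "\<Psi>'' (snd p) * (Lp * ladj q) = \<Psi>' (fst p) * (Lm * m)"
      by (simp add: C)
    then have "iwasawa (\<Psi>' (fst p)) (\<Psi>'' (snd p)) (\<Psi>' (fst p) * (Lm * m)) (Lm * m) (Lp * ladj q)"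
      using L mq \<Psi> unfolding iwasawa_iff
      by (auto intro!: tLambda_minus_star_mult tLambda_plus_mult tLambda_plus_ladj tLambda_G_sigma_mult
          dest: tLambda_minus_star_D(1))
    then show "p \<in> iwasawa_domain D \<Psi>' \<Psi>''"
      using p(1) by (cases p) (auto simp: iwasawa_domain_def)
  qed
  ultimately show "\<exists>T. open T \<and> p0 \<in> T \<and> T \<subseteq> iwasawa_domain D \<Psi>' \<Psi>''"
    by blast
qed

subsection \<open>Smooth dependence of the factors\<close>

text \<open>Differentiability and \<open>k x = 0\<close> give \<open>k\<close> linear growth at
  \<open>x\<close>, so a quantity quadratic in \<open>k\<close> is of second order.\<close>

lemma has_derivative_quadratic_zero:
  fixes k w :: "'a::real_normed_vector \<Rightarrow> 'b::real_normed_vector"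
  assumes k: "(k has_derivative k') (at x)" "k x = 0"
    and w: "\<And>y. y \<in> S \<Longrightarrow> norm (k y) \<le> 1/2 \<Longrightarrow> norm (w y) \<le> 2 * (norm (k y))\<^sup>2" and S: "open S" "x \<in> S"
  shows "(w has_derivative (\<lambda>_. 0)) (at x)"
proof -
  have w0: "w x = 0"
    using w[OF S(2)] k(2) by simp
  obtain B where B: "B > 0" "\<And>h. norm (k' h) \<le> norm h * B"
    using bounded_linear.pos_bounded[OF has_derivative_bounded_linear[OF k(1)]] by blast
  obtain d where d: "d > 0" "\<And>y. norm (y - x) < d \<Longrightarrow> norm (k y - k' (y - x)) \<le> norm (y - x)"
    using k unfolding has_derivative_at_alt by (metis diff_zero less_numeral_extra(1) mult_1)
  have k_le: "norm (k y) \<le> (1 + B) * norm (y - x)" if "norm (y - x) < d" for y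
    using d(2)[OF that] B(2)[of "y - x"] norm_triangle_sub[of "k y" "k' (y - x)"]
    by (simp add: algebra_simps)
  obtain s where s: "s > 0" "ball x s \<subseteq> S"
    using S openE by blast
  show ?thesis
    unfolding has_derivative_at_alt
  proof (intro conjI allI impI)
    fix e :: real assume "e > 0"
    define c where "c = 2 * (1 + B)\<^sup>2"
    have c: "c > 0" using B by (simp add: c_def)
    \<comment> \<open>The four bounds serve, in turn, the linear estimate of \<open>k\<close>,
      membership in \<open>S\<close>, the final factor \<open>e\<close>, and the condition
      \<open>norm (k y) \<le> 1/2\<close>.\<close>
    define r where "r = min (min d s) (min (e / c) (1 / (2 * (1 + B))))"
    have "r > 0" using d s c \<open>e > 0\<close> B by (simp add: r_def)
    moreover have "norm (w y - w x - 0) \<le> e * norm (y - x)" if y: "norm (y - x) < r" for y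
    proof -
      have y': "norm (y - x) < d" "y \<in> S" "c * norm (y - x) \<le> e" "(1 + B) * norm (y - x) \<le> 1 / 2"
        using y c B s by (auto simp: r_def field_simps dist_norm norm_minus_commute subset_iff)
      have "norm (w y) \<le> 2 * (norm (k y))\<^sup>2"
        using w[OF y'(2)] k_le[OF y'(1)] y'(4) by simp
      also have "\<dots> \<le> 2 * ((1 + B) * norm (y - x))\<^sup>2"
        using k_le[OF y'(1)] by (intro mult_left_mono power_mono) auto
      also have "\<dots> = c * norm (y - x) * norm (y - x)"
        by (simp add: c_def power2_eq_square algebra_simps)
      also have "\<dots> \<le> e * norm (y - x)"
        by (intro mult_right_mono y') simp
      finally show ?thesis by (simp add: w0)
    qed
    ultimately show "\<exists>d>0. \<forall>y. norm (y - x) < d \<longrightarrow> norm (w y - w x - 0) \<le> e * norm (y - x)"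
      by blast
  qed simp
qed

text \<open>Relative to a base point \<open>p\<close>, the factors at \<open>y\<close> form a
  factorization of \<open>1 + k y\<close> with \<open>k p = 0\<close>. The estimate for its fixed
  point gives the derivative of the inverse of \<open>Lm\<close> at \<open>p\<close>, and the
  bootstrap does the rest.\<close>

lemma smooth_on_birkhoff_factors:
  assumes U: "open U" and H: "smooth_on U H"
    and Lm: "\<And>p. p \<in> U \<Longrightarrow> Lm p \<in> tLambda_minus_star"
    and Lp: "\<And>p. p \<in> U \<Longrightarrow> Lp p \<in> tLambda_plus"
    and eq: "\<And>p. p \<in> U \<Longrightarrow> Lm p = H p * Lp p"
    and HG: "\<And>p. p \<in> U \<Longrightarrow> H p \<in> Lambda_G_sigma"
  shows "smooth_on U Lm" "smooth_on U Lp"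
proof -
  note Lm' = tLambda_minus_star_D[OF Lm] and Lp' = tLambda_plus_D[OF Lp]
  define M where "M = (\<lambda>p. ladj (Lm p))"
  define DH where "DH = (\<lambda>p. frechet_derivative H (at p))"
  have Lp_eq: "Lp p = ladj (H p) * Lm p" if "p \<in> U" for p
    using eq[OF that] Lambda_G_sigma_cancel[OF HG[OF that]] by simp
  \<comment> \<open>\<open>Lp p\<close> is replaced by \<open>ladj (H p) * ladj (M p)\<close>, so
    that the right-hand side contains only \<open>M\<close>, \<open>H\<close> and the derivative of
    \<open>H\<close>; this closes the equation.\<close>
  have deriv: "(M has_derivative (\<lambda>h. - lneg (M p * DH p h * (ladj (H p) * ladj (M p))) * M p)) (at p)"
    if p: "p \<in> U" for p
  proof -
    define k where "k = (\<lambda>y. M p * H y * Lp p - 1)"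
    define v where "v = (\<lambda>y. M y * Lm p - 1)"
    have dk: "(k has_derivative (\<lambda>h. M p * DH p h * Lp p)) (at p)"
    proof -
      have "(H has_derivative DH p) (at p)"
        unfolding DH_def by (rule smooth_on_has_derivative[OF H p])
      then show ?thesis
        unfolding k_def by (auto intro!: derivative_eq_intros)
    qed
    have k0: "k p = 0"
      using Lambda_G_sigma_cancel[OF Lm'(2)[OF p]] eq[OF p] by (simp add: k_def M_def mult.assoc)
    \<comment> \<open>The product \<open>(1 + v y) * (1 + k y)\<close> collapses to
      \<open>ladj (Lp y) * Lp p\<close>, which has no negative powers.\<close>
    have fp: "v y = - lneg (k y + v y * k y)" if y: "y \<in> U" for y
    proof (rule birkhoff_fixed_point)
      have "supp_le 0 (M y * Lm p)" "lcoeff (M y * Lm p) 0 = mat 1"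
        using supp_le_mult[of 0 "M y" 0 "Lm p"] lcoeff_times_top[of 0 "M y" 0 "Lm p"] Lm'[OF p] Lm'[OF y]
          matrix_mul_lid[of "mat 1 :: mat2"]
        by (simp_all add: M_def lcoeff_ladj)
      then show "supp_le (- 1) (v y)"
        by (auto simp: supp_le_def v_def minus_loop.rep_eq lcoeff_one)
      have "(1 + v y) * (1 + k y) = M y * (H y * Lp p)"
        using Lambda_G_sigma_cancel[OF Lm'(2)[OF p]] by (simp add: k_def v_def M_def mult.assoc)
      also have "\<dots> = ladj (Lp y) * Lp p"
        using Lambda_G_sigma_cancel[OF HG[OF y]] eq[OF y] by (simp add: M_def ladj_mult mult.assoc)
      finally show "supp_ge 0 ((1 + v y) * (1 + k y))"
        using supp_ge_mult[of 0 "ladj (Lp y)" 0 "Lp p"] Lp'[OF p] Lp'[OF y] by simp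
    qed
    have "((\<lambda>y. v y + lneg (k y)) has_derivative (\<lambda>_. 0)) (at p)"
      by (rule has_derivative_quadratic_zero[OF dk k0 _ U p]) (rule birkhoff_norm_bound(2)[OF fp])
    from has_derivative_diff[OF this bounded_linear.has_derivative[OF bounded_linear_lneg dk]]
    have "(v has_derivative (\<lambda>h. - lneg (M p * DH p h * Lp p))) (at p)"
      by simp
    then have "((\<lambda>y. (1 + v y) * M p) has_derivative (\<lambda>h. - lneg (M p * DH p h * Lp p) * M p)) (at p)"
      by (auto intro!: derivative_eq_intros)
    moreover have "(\<lambda>y. (1 + v y) * M p) = M"
      using Lambda_G_sigma_cancel[OF Lm'(2)[OF p]] by (simp add: v_def M_def mult.assoc)
    ultimately show ?thesis
      using Lp_eq[OF p] by (simp add: M_def)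
  qed
  have M: "smooth_on U M"
  proof (rule smooth_on_bootstrap[OF U deriv])
    fix n v assume n: "higher_differentiable_on U M n"
    have h: "higher_differentiable_on U H n" "higher_differentiable_on U (\<lambda>p. DH p v) n"
      using H smooth_on_derivative[OF H, of v] by (simp_all add: smooth_on_def DH_def)
    show "higher_differentiable_on U (\<lambda>p. - lneg (M p * DH p v * (ladj (H p) * ladj (M p))) * M p) n"
      by (intro higher_differentiable_on_bilinear[OF U bounded_bilinear_mult]
          higher_differentiable_on_bounded_linear[OF U bounded_linear_minus[OF bounded_linear_lneg]]
          higher_differentiable_on_bounded_linear[OF U bounded_linear_ladj] n h)
  qed
  have "smooth_on U (\<lambda>p. ladj (M p))"
    by (rule smooth_on_bounded_linear[OF U bounded_linear_ladj M])
  then show Lms: "smooth_on U Lm"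
    by (simp add: M_def)
  show "smooth_on U Lp"
  proof (rule smooth_on_cong[OF U])
    show "smooth_on U (\<lambda>p. ladj (H p) * Lm p)"
      by (intro smooth_on_bilinear[OF U bounded_bilinear_mult]
          smooth_on_bounded_linear[OF U bounded_linear_ladj] H Lms)
  qed (rule Lp_eq)
qed

section \<open>The initial value problems\<close>

text \<open>One constancy argument gives both uniqueness and determinant one; the twist then follows
  from uniqueness, as \<open>lsig\<close> preserves the equation and the initial value.\<close>

lemma potential_ivp:
  assumes I: "open I" "convex I" "0 \<in> I" and \<xi>: "smooth_on I \<xi>"
    and g: "\<And>t. t \<in> I \<Longrightarrow> \<xi> t \<in> Lambda_g_sigma"
  obtains \<Psi> where "solves_ivp I \<xi> \<Psi>" "\<And>t. t \<in> I \<Longrightarrow> \<Psi> t \<in> Lambda_G_sigma"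
    "\<And>\<Phi> t. solves_ivp I \<xi> \<Phi> \<Longrightarrow> t \<in> I \<Longrightarrow> \<Phi> t = \<Psi> t" "smooth_on I \<Psi>"
proof -
  obtain \<Psi> where \<Psi>: "\<Psi> 0 = 1" "\<And>t. t \<in> I \<Longrightarrow> (\<Psi> has_vector_derivative \<Psi> t * \<xi> t) (at t)"
    by (rule linear_ivp_exists[OF bounded_bilinear_mult I smooth_on_continuous_on[OF \<xi>],
          of "{} :: (loop \<Rightarrow> real) set" 1]) auto
  have \<xi>': "ladj (\<xi> t) = - \<xi> t" "lsig (\<xi> t) = \<xi> t" if "t \<in> I" for t
    using g[OF that] by (simp_all add: Lambda_g_sigma_iff)
  \<comment> \<open>Since \<open>ladj (\<xi> t) = - \<xi> t\<close>, the two terms of the product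
    rule cancel. The choice \<Phi> = \<Psi> shows that \<open>ladj\<close> inverts the
    solution.\<close>
  have const: "\<Phi> t * ladj (\<Psi> t) = 1"
    if "\<Phi> 0 = 1" "\<And>t. t \<in> I \<Longrightarrow> (\<Phi> has_vector_derivative \<Phi> t * \<xi> t) (at t)" "t \<in> I" for \<Phi> t
  proof -
    have "((\<lambda>s. \<Phi> s * ladj (\<Psi> s)) has_vector_derivative 0) (at s within I)" if s: "s \<in> I" for s
    proof -
      have "((\<lambda>s. \<Phi> s * ladj (\<Psi> s)) has_vector_derivative
          \<Phi> s * ladj (\<Psi> s * \<xi> s) + \<Phi> s * \<xi> s * ladj (\<Psi> s)) (at s)"
        by (intro has_vector_derivative_mult \<open>\<And>t. t \<in> I \<Longrightarrow> (\<Phi> has_vector_derivative \<Phi> t * \<xi> t) (at t)\<close> s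
            bounded_linear.has_vector_derivative[OF bounded_linear_ladj] \<Psi>)
      then show ?thesis
        by - (rule has_vector_derivative_at_within, simp add: ladj_mult \<xi>' s mult.assoc)
    qed
    then obtain c where "\<And>s. s \<in> I \<Longrightarrow> \<Phi> s * ladj (\<Psi> s) = c"
      using has_vector_derivative_zero_constant[OF I(2)] by blast
    then show ?thesis
      using that(1,3) I(3) \<Psi>(1) by (metis ladj_one mult.right_neutral)
  qed
  have inv: "\<Psi> t * ladj (\<Psi> t) = 1" "ladj (\<Psi> t) * \<Psi> t = 1" if "t \<in> I" for t
    using const[OF \<Psi> that] by (simp_all add: mult_ladj_commute)
  have uniq: "\<Phi> t = \<Psi> t"
    if "\<Phi> 0 = 1" "\<And>t. t \<in> I \<Longrightarrow> (\<Phi> has_vector_derivative \<Phi> t * \<xi> t) (at t)" "t \<in> I" for \<Phi> t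
    using const[OF that] inv(2)[OF that(3)] by (metis mult.assoc mult.left_neutral mult.right_neutral)
  have "lsig (\<Psi> t) = \<Psi> t" if "t \<in> I" for t
  proof (rule uniq[OF _ _ that])
    show "lsig (\<Psi> 0) = 1" by (simp add: \<Psi>)
    show "((\<lambda>t. lsig (\<Psi> t)) has_vector_derivative lsig (\<Psi> t) * \<xi> t) (at t)" if "t \<in> I" for t
      using bounded_linear.has_vector_derivative[OF bounded_linear_lsig \<Psi>(2)[OF that]]
      by (simp add: lsig_mult \<xi>' that)
  qed
  then have "\<Psi> t \<in> Lambda_G_sigma" if "t \<in> I" for t
    using inv that by (simp add: Lambda_G_sigma_iff)
  moreover have "smooth_on I \<Psi>"
    by (rule smooth_on_ode[OF I(1) bounded_bilinear_mult \<xi> \<Psi>(2)])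
  moreover have "solves_ivp I \<xi> \<Psi>"
    using \<Psi> by (simp add: solves_ivp_def)
  moreover have "\<Phi> t = \<Psi> t" if "solves_ivp I \<xi> \<Phi>" "t \<in> I" for \<Phi> t
    using uniq[of \<Phi>, OF _ _ that(2)] that(1) by (simp add: solves_ivp_def)
  ultimately show ?thesis
    using that by blast
qed

subsection \<open>Dilations of the loop parameter\<close>

text \<open>A relation rather than an operator, since the rescaled coefficients of a general loop
  are not summable.\<close>

definition dilated :: "real \<Rightarrow> loop \<Rightarrow> loop \<Rightarrow> bool" where
  "dilated l a b \<longleftrightarrow> (\<forall>j. lcoeff b j = (l powi j) *\<^sub>R lcoeff a j)"

lemma dilated_mult:
  assumes "l \<noteq> 0" "dilated l a b" "dilated l c d"
  shows "dilated l (a * c) (b * d)"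
  unfolding dilated_def
proof
  fix n
  have "lcoeff (b * d) n = (\<Sum>\<^sub>\<infinity>i. (l powi n) *\<^sub>R (lcoeff a i ** lcoeff c (n - i)))"
    unfolding lcoeff_times
    by (rule infsum_cong) (use assms in \<open>simp add: dilated_def mat2.scaleR_left mat2.scaleR_right power_int_diff\<close>)
  also have "\<dots> = (l powi n) *\<^sub>R lcoeff (a * c) n"
    unfolding lcoeff_times by (rule infsum_scaleR_right)
  finally show "lcoeff (b * d) n = (l powi n) *\<^sub>R lcoeff (a * c) n" .
qed

text \<open>Makes a pair of initial value problems a single linear one, so that a relation between
  the two solutions can be propagated.\<close>

lemma bounded_bilinear_componentwise:
  "bounded_bilinear (\<lambda>x y :: loop \<times> loop. (fst x * fst y, snd x * snd y))"
proof
  have le: "norm (fst z) \<le> norm z" "norm (snd z) \<le> norm z" for z :: "loop \<times> loop"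
    using norm_fst_le[of "fst z" "snd z"] norm_snd_le[of "snd z" "fst z"] by simp_all
  have "norm (fst x * fst y, snd x * snd y) \<le> norm x * norm y * 2" for x y :: "loop \<times> loop"
  proof -
    have "norm (fst x * fst y, snd x * snd y) \<le> norm (fst x * fst y) + norm (snd x * snd y)"
      by (rule norm_Pair_le)
    also have "\<dots> \<le> norm (fst x) * norm (fst y) + norm (snd x) * norm (snd y)"
      by (intro add_mono norm_mult_ineq)
    also have "\<dots> \<le> norm x * norm y + norm x * norm y"
      by (intro add_mono mult_mono le norm_ge_zero)
    finally show ?thesis by simp
  qed
  then show "\<exists>K. \<forall>x y :: loop \<times> loop. norm (fst x * fst y, snd x * snd y) \<le> norm x * norm y * K"
    by blast
qed (simp_all add: prod_eq_iff algebra_simps)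

text \<open>The equations for \<xi> and for its dilation are solved together. Dilation is
  multiplicative, so the pairs related by it form an invariant closed subspace; uniqueness
  identifies the first component with the given \<Psi>.\<close>

lemma dilated_solution:
  assumes I: "open I" "convex I" "0 \<in> I" and \<xi>: "smooth_on I \<xi>"
    and \<Psi>: "\<And>\<Phi> t. solves_ivp I \<xi> \<Phi> \<Longrightarrow> t \<in> I \<Longrightarrow> \<Phi> t = \<Psi> t"
    and J: "\<And>t j. t \<in> I \<Longrightarrow> j \<notin> J \<Longrightarrow> lcoeff (\<xi> t) j = 0"
    and l: "l \<noteq> 0" "\<And>j. j \<in> J \<Longrightarrow> \<bar>l powi j\<bar> \<le> C" "0 \<le> C"
  obtains \<Phi> where "smooth_on I \<Phi>" "\<And>t. t \<in> I \<Longrightarrow> dilated l (\<Psi> t) (\<Phi> t)"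
proof -
  define \<eta> where "\<eta> = (\<lambda>t. lscale l J (\<xi> t))"
  have \<eta>: "smooth_on I \<eta>"
    unfolding \<eta>_def by (rule smooth_on_bounded_linear[OF I(1) bounded_linear_lscale[OF l(2,3)] \<xi>])
  have dil: "dilated l (\<xi> t) (\<eta> t)" if "t \<in> I" for t
    using J[OF that] by (auto simp: dilated_def \<eta>_def lcoeff_lscale[OF l(2,3)])
  \<comment> \<open>The common kernel of these functionals is the set of pairs whose second
    component is the dilation of the first.\<close>
  define \<phi> where "\<phi> = (\<lambda>j (x :: loop \<times> loop). lcoeff (snd x) j - (l powi j) *\<^sub>R lcoeff (fst x) j)"
  have ker: "(\<forall>f \<in> range \<phi>. f x = 0) \<longleftrightarrow> dilated l (fst x) (snd x)" for x
    by (auto simp: \<phi>_def dilated_def)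
  have "bounded_linear (\<phi> j)" for j
    unfolding \<phi>_def
    by (intro bounded_linear_sub bounded_linear_compose[OF bounded_linear_lcoeff] bounded_linear_fst bounded_linear_snd
        bounded_linear_compose[OF bounded_linear_scaleR_right])
  then have bl: "bounded_linear f" if "f \<in> range \<phi>" for f
    using that by auto
  have one: "f (1, 1) = 0" if "f \<in> range \<phi>" for f
    using that by (auto simp: \<phi>_def lcoeff_one)
  have inv: "f (fst x * fst (\<xi> t, \<eta> t), snd x * snd (\<xi> t, \<eta> t)) = 0"
    if "t \<in> I" "\<And>f. f \<in> range \<phi> \<Longrightarrow> f x = 0" "f \<in> range \<phi>" for f x t
    using ker[of "(fst x * \<xi> t, snd x * \<eta> t)"] ker[of x] that dilated_mult[OF l(1) _ dil[OF that(1)]]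
    by auto
  have cont: "continuous_on I (\<lambda>t. (\<xi> t, \<eta> t))"
    by (intro continuous_on_Pair smooth_on_continuous_on \<xi> \<eta>)
  obtain u where u: "u 0 = (1, 1)"
    "\<And>t. t \<in> I \<Longrightarrow> (u has_vector_derivative (fst (u t) * fst (\<xi> t, \<eta> t), snd (u t) * snd (\<xi> t, \<eta> t))) (at t)"
    "\<And>f t. t \<in> I \<Longrightarrow> f \<in> range \<phi> \<Longrightarrow> f (u t) = 0"
    by (rule linear_ivp_exists[OF bounded_bilinear_componentwise I cont,
          where \<Phi> = "range \<phi>" and ?u0.0 = "(1, 1)"]) (use bl one inv in blast)+
  have "solves_ivp I \<xi> (\<lambda>t. fst (u t))"
    using bounded_linear.has_vector_derivative[OF bounded_linear_fst u(2)] u(1) by (simp add: solves_ivp_def)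
  from \<Psi>[OF this] have eq: "fst (u t) = \<Psi> t" if "t \<in> I" for t
    using that by blast
  have "((\<lambda>t. snd (u t)) has_vector_derivative snd (u t) * \<eta> t) (at t)" if "t \<in> I" for t
    using bounded_linear.has_vector_derivative[OF bounded_linear_snd u(2)[OF that]] by simp
  then have "smooth_on I (\<lambda>t. snd (u t))"
    by (rule smooth_on_ode[OF I(1) bounded_bilinear_mult \<eta>])
  moreover have "dilated l (\<Psi> t) (snd (u t))" if "t \<in> I" for t
    using ker[of "u t"] u(3)[OF that] eq[OF that] by auto
  ultimately show ?thesis
    by (rule that)
qed

section \<open>Maurer--Cartan forms\<close>

lemma Lambda_g_sigma_coeff:
  assumes "ladj \<omega> = - \<omega>" "lsig \<omega> = \<omega>"
  shows "even j \<Longrightarrow> lcoeff \<omega> j \<in> diag_part" "odd j \<Longrightarrow> lcoeff \<omega> j \<in> offdiag_part"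
proof -
  have "adj2 (lcoeff \<omega> j) = - lcoeff \<omega> j"
    using arg_cong[OF assms(1), of "\<lambda>a. lcoeff a j"] by (simp add: lcoeff_ladj uminus_loop.rep_eq)
  from arg_cong[OF this, of "\<lambda>X. X $ 1 $ 1"] have tr: "lcoeff \<omega> j \<in> sl2"
    by (simp add: sl2_def trace_mat2)
  have s: "(if even j then sigma (lcoeff \<omega> j) else - sigma (lcoeff \<omega> j)) = lcoeff \<omega> j"
    using arg_cong[OF assms(2), of "\<lambda>a. lcoeff a j"] by (simp add: lcoeff_lsig)
  show "even j \<Longrightarrow> lcoeff \<omega> j \<in> diag_part" "odd j \<Longrightarrow> lcoeff \<omega> j \<in> offdiag_part"
    using s tr by (simp_all add: mat2_eq_iff diag_part_def offdiag_part_def)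
qed

lemma has_vector_derivative_unique_on_open:
  assumes "open S" "t \<in> S" "\<And>s. s \<in> S \<Longrightarrow> f s = g s"
    and "(f has_vector_derivative f') (at t)" "(g has_vector_derivative g') (at t)"
  shows "f' = g'"
proof -
  have "(g has_vector_derivative f') (at t)"
    by (rule has_vector_derivative_transform_within_open[OF assms(4,1,2,3)])
  then show ?thesis
    by (rule vector_derivative_unique_at[OF _ assms(5)])
qed

lemma lcoeff_derivative_eq_0:
  assumes "open S" "t \<in> S" "\<And>s. s \<in> S \<Longrightarrow> lcoeff (f s) j = c"
    and "(f has_vector_derivative f') (at t)"
  shows "lcoeff f' j = 0"
  by (rule has_vector_derivative_unique_on_open[OF assms(1,2,3)
        bounded_linear.has_vector_derivative[OF bounded_linear_lcoeff assms(4)] has_vector_derivative_const])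

text \<open>A map that factors as \<open>P A = Q B\<close> with \<open>Q\<close> constant: comparing the two expressions for the
  logarithmic derivative is what truncates its Laurent series.\<close>

lemma framing_derivative:
  assumes S: "open S" "t \<in> S"
    and A: "(A has_vector_derivative A') (at t)" and B: "(B has_vector_derivative B') (at t)"
    and P: "(P has_vector_derivative P t * \<xi>) (at t)"
    and eq: "\<And>s. s \<in> S \<Longrightarrow> \<gamma> s = P s * A s" "\<And>s. s \<in> S \<Longrightarrow> \<gamma> s = Q * B s"
    and G: "A t \<in> Lambda_G_sigma" "B t \<in> Lambda_G_sigma" "P t \<in> Lambda_G_sigma" "Q \<in> Lambda_G_sigma"
    and \<gamma>: "\<And>s. s \<in> S \<Longrightarrow> \<gamma> s \<in> Lambda_G_sigma"
    and \<omega>: "\<omega> = ladj (B t) * B'"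
  shows "(\<gamma> has_vector_derivative \<gamma> t * \<omega>) (at t)"
    and "\<omega> = ladj (A t) * A' + ladj (A t) * \<xi> * A t"
    and "B' = B t * \<omega>" "ladj \<omega> = - \<omega>" "lsig \<omega> = \<omega>"
proof -
  have 1: "((\<lambda>s. Q * B s) has_vector_derivative Q * B') (at t)"
    using bounded_linear.has_vector_derivative[OF bounded_linear_mult_right B] .
  have 2: "((\<lambda>s. P s * A s) has_vector_derivative P t * A' + P t * \<xi> * A t) (at t)"
    by (rule has_vector_derivative_mult[OF P A])
  have d: "(\<gamma> has_vector_derivative Q * B') (at t)"
    by (rule has_vector_derivative_transform_within_open[OF 1 S]) (simp add: eq(2))
  show B': "B' = B t * \<omega>"
    by (simp add: \<omega> Lambda_G_sigma_cancel[OF G(2)])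
  have \<gamma>t: "\<gamma> t = P t * A t" "\<gamma> t = Q * B t"
    using eq S by auto
  show d\<gamma>: "(\<gamma> has_vector_derivative \<gamma> t * \<omega>) (at t)"
    using d \<gamma>t(2) B' by (simp add: mult.assoc)
  have "Q * B' = P t * A' + P t * \<xi> * A t"
    by (rule has_vector_derivative_unique_on_open[OF S eq(1) d 2])
  then have "P t * (A t * \<omega>) = P t * (A' + \<xi> * A t)"
    using \<gamma>t B' by (simp add: mult.assoc distrib_left) (metis mult.assoc)
  then have "ladj (P t) * (P t * (A t * \<omega>)) = ladj (P t) * (P t * (A' + \<xi> * A t))"
    by simp
  then have "A t * \<omega> = A' + \<xi> * A t"
    by (simp only: Lambda_G_sigma_cancel[OF G(3)])
  then have "ladj (A t) * (A t * \<omega>) = ladj (A t) * (A' + \<xi> * A t)"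
    by simp
  then show "\<omega> = ladj (A t) * A' + ladj (A t) * \<xi> * A t"
    by (simp only: Lambda_G_sigma_cancel[OF G(1)]) (simp add: distrib_left mult.assoc)
  note C = Lambda_G_sigma_cancel[OF \<gamma>[OF S(2)]]
  \<comment> \<open>Differentiating the constant \<open>ladj (\<gamma> s) * \<gamma> s = 1\<close>
    shows that \<omega> is traceless.\<close>
  have unit: "((\<lambda>s. ladj (\<gamma> s) * \<gamma> s) has_vector_derivative
      ladj (\<gamma> t) * (\<gamma> t * \<omega>) + ladj (\<gamma> t * \<omega>) * \<gamma> t) (at t)"
    by (rule has_vector_derivative_mult[OF bounded_linear.has_vector_derivative[OF bounded_linear_ladj d\<gamma>] d\<gamma>])
  have "ladj (\<gamma> t) * (\<gamma> t * \<omega>) + ladj (\<gamma> t * \<omega>) * \<gamma> t = 0"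
    by (rule has_vector_derivative_unique_on_open[OF S _ unit has_vector_derivative_const])
      (rule Lambda_G_sigma_cancel(2)[OF \<gamma>])
  then show "ladj \<omega> = - \<omega>"
    by (simp add: C ladj_mult mult.assoc eq_neg_iff_add_eq_0 add.commute)
  have "lsig (\<gamma> t * \<omega>) = \<gamma> t * \<omega>"
    by (rule has_vector_derivative_unique_on_open[OF S _
          bounded_linear.has_vector_derivative[OF bounded_linear_lsig d\<gamma>] d\<gamma>])
      (use \<gamma> in \<open>simp add: Lambda_G_sigma_iff\<close>)
  then have "\<gamma> t * lsig \<omega> = \<gamma> t * \<omega>"
    using \<gamma>[OF S(2)] by (simp add: lsig_mult Lambda_G_sigma_iff)
  then have "ladj (\<gamma> t) * (\<gamma> t * lsig \<omega>) = ladj (\<gamma> t) * (\<gamma> t * \<omega>)"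
    by simp
  then show "lsig \<omega> = \<omega>"
    by (simp only: C)
qed

section \<open>Evaluation of loops at a positive real parameter\<close>

lemma loop_val_nth: "loop_val l a $ i $ k = (\<Sum>\<^sub>\<infinity>j. lcoeff a j $ i $ k * l powi j)"
  by (simp add: loop_val_def)

lemma loop_val_dilated: "dilated l a b \<Longrightarrow> loop_val l a = loop_val 1 b"
  by (simp add: loop_val_def dilated_def mult.commute)

lemma loop_eval_one_eq: "loop_eval a 1 $ i $ k = complex_of_real (loop_val 1 a $ i $ k)"
proof -
  have "(\<lambda>j. norm (lcoeff a j $ i $ k)) summable_on UNIV"
    using entry_abs_summable[of a i k] by simp
  then have "(\<lambda>j. lcoeff a j $ i $ k) summable_on UNIV"
    by (rule abs_summable_summable)
  then show ?thesis
    using infsum_bounded_linear_image[of complex_of_real "\<lambda>j. lcoeff a j $ i $ k" UNIV,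
        OF bounded_linear_of_real]
    by (simp add: loop_eval_nth loop_val_nth)
qed

lemma loop_val_one_eq: "loop_val 1 a = (\<Sum>\<^sub>\<infinity>j. lcoeff a j)"
proof -
  have "(\<Sum>\<^sub>\<infinity>j. lcoeff a j) $ i $ k = (\<Sum>\<^sub>\<infinity>j. lcoeff a j $ i $ k)" for i k
    by (rule infsum_bounded_linear_image[symmetric, OF bounded_linear_compose[OF bounded_linear_vec_nth bounded_linear_vec_nth]
          abs_summable_summable[OF lcoeff_summable]])
  then show ?thesis
    by (simp add: mat2_eq_iff loop_val_nth)
qed

text \<open>Evaluation at 1 is bounded by the coefficient norm; evaluation at any other
  \<open>l\<close> is reached by dilating first.\<close>

lemma bounded_linear_loop_val: "bounded_linear (loop_val 1)"
proof (rule bounded_linear_intro[where K = 1])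
  show "loop_val 1 (a + b) = loop_val 1 a + loop_val 1 b" for a b
    unfolding loop_val_one_eq plus_loop.rep_eq
    by (rule infsum_add) (rule abs_summable_summable[OF lcoeff_summable])+
  show "loop_val 1 (r *\<^sub>R a) = r *\<^sub>R loop_val 1 a" for r a
    unfolding loop_val_one_eq scaleR_loop.rep_eq by (rule infsum_scaleR_right)
  show "norm (loop_val 1 a) \<le> norm a * 1" for a
    unfolding loop_val_one_eq norm_loop_def by (simp add: norm_infsum_bound[OF lcoeff_summable])
qed

lemma loop_val_mult: "loop_val 1 (a * b) = loop_val 1 a ** loop_val 1 b"
proof -
  have "complex_of_real (loop_val 1 (a * b) $ i $ k) = complex_of_real ((loop_val 1 a ** loop_val 1 b) $ i $ k)" for i k
    using loop_eval_mult[of 1 a b] by (simp add: loop_eval_one_eq[symmetric])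
  then show ?thesis
    by (simp only: of_real_eq_iff) (simp add: vec_eq_iff)
qed

lemma loop_val_ladj: "loop_val 1 (ladj a) = adj2 (loop_val 1 a)"
  by (simp add: mat2_eq_iff loop_val_nth lcoeff_ladj infsum_uminus)

lemma loop_val_lterm: "loop_val 1 (lterm j X) = X"
proof -
  have "loop_val 1 (lterm j X) = (\<Sum>\<^sub>\<infinity>i\<in>{j}. lcoeff (lterm j X) i)"
    unfolding loop_val_one_eq by (rule infsum_cong_neutral) (auto simp: lterm.rep_eq)
  then show ?thesis by (simp add: lterm.rep_eq)
qed

lemma dilated_unique: "dilated l a b \<Longrightarrow> dilated l a c \<Longrightarrow> b = c"
  by (rule loop_eqI) (simp add: dilated_def)

lemma dilated_one: "dilated l 1 1"
  by (simp add: dilated_def lcoeff_one)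

lemma dilated_ladj: "dilated l a b \<Longrightarrow> dilated l (ladj a) (ladj b)"
  by (simp add: dilated_def lcoeff_ladj linear_cmul[OF linear_adj2])

lemma dilated_add: "dilated l a b \<Longrightarrow> dilated l c d \<Longrightarrow> dilated l (a + c) (b + d)"
  by (simp add: dilated_def plus_loop.rep_eq scaleR_add_right)

lemma dilated_lterm: "dilated l (lterm j X) (lterm j ((l powi j) *\<^sub>R X))"
  by (simp add: dilated_def lterm.rep_eq)

lemma dilated_lscale:
  assumes "\<And>j. j \<in> J \<Longrightarrow> \<bar>l powi j\<bar> \<le> C" "0 \<le> C" "\<And>j. j \<notin> J \<Longrightarrow> lcoeff a j = 0"
  shows "dilated l a (lscale l J a)"
  using assms(3) by (auto simp: dilated_def lcoeff_lscale[OF assms(1,2)])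

text \<open>Each coefficient is differentiated separately, which identifies \<theta> as the dilation
  of the original derivative; evaluation at 1 then gives a matrix equation.\<close>

lemma dilated_derivative:
  assumes S: "open S" "t \<in> S" and l: "l \<noteq> 0"
    and dil: "\<And>s. s \<in> S \<Longrightarrow> dilated l (\<gamma> s) (\<Theta> s)" "dilated l \<omega> \<eta>"
    and \<gamma>: "(\<gamma> has_vector_derivative \<gamma> t * \<omega>) (at t)" and \<Theta>: "(\<Theta> has_vector_derivative \<theta>) (at t)"
  shows "((\<lambda>s. loop_val 1 (\<Theta> s)) has_vector_derivative loop_val 1 (\<Theta> t) ** loop_val 1 \<eta>) (at t)"
proof -
  have "dilated l (\<gamma> t * \<omega>) \<theta>"
    unfolding dilated_def
  proof
    fix j
    have "((\<lambda>s. lcoeff (\<Theta> s) j) has_vector_derivative lcoeff \<theta> j) (at t)"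
      by (rule bounded_linear.has_vector_derivative[OF bounded_linear_lcoeff \<Theta>])
    moreover have "((\<lambda>s. (l powi j) *\<^sub>R lcoeff (\<gamma> s) j) has_vector_derivative
        (l powi j) *\<^sub>R lcoeff (\<gamma> t * \<omega>) j) (at t)"
      by (rule bounded_linear.has_vector_derivative[OF bounded_linear_scaleR_right
            bounded_linear.has_vector_derivative[OF bounded_linear_lcoeff \<gamma>]])
    ultimately show "lcoeff \<theta> j = (l powi j) *\<^sub>R lcoeff (\<gamma> t * \<omega>) j"
      by (rule has_vector_derivative_unique_on_open[OF S, rotated]) (use dil(1) in \<open>simp add: dilated_def\<close>)
  qed
  then have "\<theta> = \<Theta> t * \<eta>"
    by (rule dilated_unique) (rule dilated_mult[OF l dil(1)[OF S(2)] dil(2)])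
  then show ?thesis
    using bounded_linear.has_vector_derivative[OF bounded_linear_loop_val \<Theta>] by (simp add: loop_val_mult)
qed

section \<open>Harmonic maps from framings\<close>

lemma has_vector_derivative_partials:
  assumes "(f has_derivative f') (at p)"
  shows "((\<lambda>t. f (t, snd p)) has_vector_derivative f' (1, 0)) (at (fst p))"
    and "((\<lambda>t. f (fst p, t)) has_vector_derivative f' (0, 1)) (at (snd p))"
proof -
  have f: "(f has_derivative f') (at (fst p, snd p))"
    using assms by simp
  have lin: "linear f'"
    using assms has_derivative_linear by blast
  have e1: "(\<lambda>h. f' (h, 0)) = (\<lambda>h. h *\<^sub>R f' (1, 0))"
  proof
    show "f' (h, 0) = h *\<^sub>R f' (1, 0)" for h
      using linear_cmul[OF lin, of h "(1, 0)"] by simp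
  qed
  have e2: "(\<lambda>h. f' (0, h)) = (\<lambda>h. h *\<^sub>R f' (0, 1))"
  proof
    show "f' (0, h) = h *\<^sub>R f' (0, 1)" for h
      using linear_cmul[OF lin, of h "(0, 1)"] by simp
  qed
  have "((\<lambda>t. (t, snd p)) has_derivative (\<lambda>h. (h, 0))) (at (fst p))"
    by (auto intro!: derivative_eq_intros)
  from has_derivative_compose[OF this f]
  show "((\<lambda>t. f (t, snd p)) has_vector_derivative f' (1, 0)) (at (fst p))"
    unfolding has_vector_derivative_def using e1 by simp
  have "((\<lambda>t. (fst p, t)) has_derivative (\<lambda>h. (0, h))) (at (snd p))"
    by (auto intro!: derivative_eq_intros)
  from has_derivative_compose[OF this f]
  show "((\<lambda>t. f (fst p, t)) has_vector_derivative f' (0, 1)) (at (snd p))"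
    unfolding has_vector_derivative_def using e2 by simp
qed

lemma smooth_on_partials:
  assumes "smooth_on U f" "p \<in> U"
  shows "((\<lambda>t. f (t, snd p)) has_vector_derivative partial_x f p) (at (fst p))"
    and "((\<lambda>t. f (fst p, t)) has_vector_derivative partial_y f p) (at (snd p))"
  using has_vector_derivative_partials[OF smooth_on_has_derivative[OF assms]]
  by (simp_all add: partial_x_def partial_y_def vector_derivative_at)

lemma open_slices:
  assumes "open (U :: (real \<times> real) set)"
  shows "open {t. (t, y) \<in> U}" "open {t. (x, t) \<in> U}"
proof -
  have "open ((\<lambda>t. (t, y)) -` U)" "open ((\<lambda>t. (x, t)) -` U)"
    by (intro open_vimage assms continuous_intros)+
  then show "open {t. (t, y) \<in> U}" "open {t. (x, t) \<in> U}"
    by (simp_all add: vimage_def)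
qed

text \<open>For traceless \<omega> one has \<open>adj2 \<omega> = - \<omega>\<close>, so the product
  rule yields the commutator with \<omega>.\<close>

lemma conjugate_has_vector_derivative:
  fixes G :: "real \<Rightarrow> mat2"
  assumes G: "(G has_vector_derivative G t ** \<omega>) (at t)" and N: "(N has_vector_derivative N') (at t)"
    and tr: "\<omega> \<in> sl2"
  shows "((\<lambda>s. G s ** N s ** adj2 (G s)) has_vector_derivative
    G t ** (\<omega> ** N t - N t ** \<omega> + N') ** adj2 (G t)) (at t)"
proof -
  have adj: "bounded_linear (adj2 :: mat2 \<Rightarrow> mat2)"
    using linear_adj2 linear_conv_bounded_linear by blast
  have "((\<lambda>s. G s ** N s ** adj2 (G s)) has_vector_derivative
      (G t ** N t) ** adj2 (G t ** \<omega>) + (G t ** N' + (G t ** \<omega>) ** N t) ** adj2 (G t)) (at t)"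
    by (intro bounded_bilinear.has_vector_derivative[OF bounded_bilinear_mat2_mult] G N
        bounded_linear.has_vector_derivative[OF adj])
  moreover have "adj2 \<omega> = - \<omega>"
    using tr by (simp add: sl2_def trace_mat2 mat2_eq_iff)
  then have "(G t ** N t) ** adj2 (G t ** \<omega>) + (G t ** N' + (G t ** \<omega>) ** N t) ** adj2 (G t) =
      G t ** (\<omega> ** N t - N t ** \<omega> + N') ** adj2 (G t)"
    by (simp add: adj2_mult mat2.add_left mat2.add_right mat2.diff_left mat2.diff_right
        mat2.minus_left mat2.minus_right matrix_mul_assoc)
  ultimately show ?thesis by simp
qed

lemma diag_offdiag_sl2: "A \<in> diag_part \<Longrightarrow> A \<in> sl2" "A \<in> offdiag_part \<Longrightarrow> A \<in> sl2"
  by (simp_all add: diag_part_def offdiag_part_def)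

text \<open>\<open>By\<close> and \<open>Ex\<close> are the zero curvature equations at \<lambda>
  and at its inverse. With them both mixed partial derivatives reduce to the double bracket of
  \<open>B\<close> and \<open>E\<close> with \<open>kprime\<close>, a diagonal traceless matrix and
  hence a multiple of \<open>kprime\<close>.\<close>

lemma harmonic_map_of_framing:
  assumes U: "open U" and smooth: "smooth_on U G" and det: "\<And>p. p \<in> U \<Longrightarrow> det (G p) = 1"
    and Gx: "\<And>p. p \<in> U \<Longrightarrow> ((\<lambda>t. G (t, snd p)) has_vector_derivative G p ** (A p + B p)) (at (fst p))"
    and Gy: "\<And>p. p \<in> U \<Longrightarrow> ((\<lambda>t. G (fst p, t)) has_vector_derivative G p ** E p) (at (snd p))"
    and parts: "\<And>p. p \<in> U \<Longrightarrow> A p \<in> diag_part" "\<And>p. p \<in> U \<Longrightarrow> B p \<in> offdiag_part"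
      "\<And>p. p \<in> U \<Longrightarrow> E p \<in> offdiag_part"
    and By: "\<And>p. p \<in> U \<Longrightarrow> ((\<lambda>t. B (fst p, t)) has_vector_derivative 0) (at (snd p))"
    and Ex: "\<And>p. p \<in> U \<Longrightarrow>
      ((\<lambda>t. E (t, snd p)) has_vector_derivative E p ** A p - A p ** E p) (at (fst p))"
  shows "harmonic_map U (\<lambda>p. Ad (G p) kprime)"
proof -
  define c where "c = (\<lambda>X :: mat2. X ** kprime - kprime ** X)"
  have c: "bounded_linear c"
    unfolding c_def by (intro bounded_linear_sub mat2.bounded_linear_left mat2.bounded_linear_right)
  define \<psi> where "\<psi> = (\<lambda>p. Ad (G p) kprime)"
  have \<psi>: "\<psi> p = G p ** kprime ** adj2 (G p)" if "p \<in> U" for p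
  proof -
    have "matrix_inv (G p) = adj2 (G p)"
      by (rule matrix_inv_unique) (simp_all add: mult_adj2 adj2_mult_self det[OF that])
    then show ?thesis by (simp add: \<psi>_def Ad_def)
  qed
  have AB: "A p + B p \<in> sl2" if "p \<in> U" for p
    using parts that by (auto simp: diag_part_def offdiag_part_def sl2_def trace_mat2)
  \<comment> \<open>Diagonal matrices commute with \<open>kprime\<close>, so \<open>A\<close>
    disappears from the first derivative.\<close>
  have Ak: "A p ** kprime - kprime ** A p = 0" if "p \<in> U" for p
    using parts(1)[OF that] by (simp add: diag_part_def mat2_eq_iff)
  have px: "partial_x \<psi> p = G p ** c (B p) ** adj2 (G p)" if p: "p \<in> U" for p
  proof -
    have "((\<lambda>t. G (t, snd p) ** kprime ** adj2 (G (t, snd p))) has_vector_derivative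
        G p ** c (B p) ** adj2 (G p)) (at (fst p))"
      using conjugate_has_vector_derivative[of "\<lambda>t. G (t, snd p)" "fst p" _ "\<lambda>_. kprime",
          OF _ has_vector_derivative_const AB[OF p]] Gx[OF p] Ak[OF p]
      by (simp add: c_def mat2.add_left mat2.add_right algebra_simps)
    then have "((\<lambda>t. \<psi> (t, snd p)) has_vector_derivative G p ** c (B p) ** adj2 (G p)) (at (fst p))"
      by (rule has_vector_derivative_transform_within_open[OF _ open_slices(1)[OF U, of "snd p"]])
        (use p in \<open>auto simp: \<psi>\<close>)
    then show ?thesis
      by (simp add: partial_x_def vector_derivative_at)
  qed
  have py: "partial_y \<psi> p = G p ** c (E p) ** adj2 (G p)" if p: "p \<in> U" for p
  proof -
    have "((\<lambda>t. G (fst p, t) ** kprime ** adj2 (G (fst p, t))) has_vector_derivative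
        G p ** c (E p) ** adj2 (G p)) (at (snd p))"
      using conjugate_has_vector_derivative[of "\<lambda>t. G (fst p, t)" "snd p" _ "\<lambda>_. kprime",
          OF _ has_vector_derivative_const diag_offdiag_sl2(2)[OF parts(3)[OF p]]] Gy[OF p]
      by (simp add: c_def)
    then have "((\<lambda>t. \<psi> (fst p, t)) has_vector_derivative G p ** c (E p) ** adj2 (G p)) (at (snd p))"
      by (rule has_vector_derivative_transform_within_open[OF _ open_slices(2)[OF U, of "fst p"]])
        (use p in \<open>auto simp: \<psi>\<close>)
    then show ?thesis
      by (simp add: partial_y_def vector_derivative_at)
  qed
  define \<rho> where "\<rho> = (\<lambda>p. 2 * (E p $ 1 $ 2 * B p $ 2 $ 1 + B p $ 1 $ 2 * E p $ 2 $ 1))"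
  have pxy: "partial_x (partial_y \<psi>) p = \<rho> p *\<^sub>R \<psi> p" if p: "p \<in> U" for p
  proof -
    have "((\<lambda>t. G (t, snd p) ** c (E (t, snd p)) ** adj2 (G (t, snd p))) has_vector_derivative
        G p ** ((A p + B p) ** c (E p) - c (E p) ** (A p + B p) + c (E p ** A p - A p ** E p)) ** adj2 (G p))
        (at (fst p))"
      using conjugate_has_vector_derivative[of "\<lambda>t. G (t, snd p)" "fst p" _ "\<lambda>t. c (E (t, snd p))",
          OF _ bounded_linear.has_vector_derivative[OF c Ex[OF p]] AB[OF p]] Gx[OF p]
      by simp
    \<comment> \<open>The terms with \<open>A\<close> cancel by the Jacobi identity; the remaining
      expression is symmetric in \<open>B\<close> and \<open>E\<close>, which is why the same \<rho>
      serves both mixed derivatives.\<close>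
    moreover have "(A p + B p) ** c (E p) - c (E p) ** (A p + B p) + c (E p ** A p - A p ** E p)
        = \<rho> p *\<^sub>R kprime"
      using parts[OF p]
      by (simp add: c_def \<rho>_def mat2_eq_iff diag_part_def offdiag_part_def sl2_def trace_mat2 algebra_simps)
    ultimately have "((\<lambda>t. G (t, snd p) ** c (E (t, snd p)) ** adj2 (G (t, snd p))) has_vector_derivative
        \<rho> p *\<^sub>R \<psi> p) (at (fst p))"
      by (simp add: \<psi>[OF p] mat2.scaleR_left mat2.scaleR_right)
    then have "((\<lambda>t. partial_y \<psi> (t, snd p)) has_vector_derivative \<rho> p *\<^sub>R \<psi> p) (at (fst p))"
      by (rule has_vector_derivative_transform_within_open[OF _ open_slices(1)[OF U, of "snd p"]])
        (use p in \<open>auto simp: py\<close>)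
    then show ?thesis
      by (simp add: partial_x_def[of "partial_y \<psi>"] vector_derivative_at)
  qed
  have pyx: "partial_y (partial_x \<psi>) p = \<rho> p *\<^sub>R \<psi> p" if p: "p \<in> U" for p
  proof -
    have "((\<lambda>t. G (fst p, t) ** c (B (fst p, t)) ** adj2 (G (fst p, t))) has_vector_derivative
        G p ** (E p ** c (B p) - c (B p) ** E p + c 0) ** adj2 (G p)) (at (snd p))"
      using conjugate_has_vector_derivative[of "\<lambda>t. G (fst p, t)" "snd p" _ "\<lambda>t. c (B (fst p, t))",
          OF _ bounded_linear.has_vector_derivative[OF c By[OF p]] diag_offdiag_sl2(2)[OF parts(3)[OF p]]] Gy[OF p]
      by simp
    moreover have "E p ** c (B p) - c (B p) ** E p + c 0 = \<rho> p *\<^sub>R kprime"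
      using parts[OF p]
      by (simp add: c_def \<rho>_def mat2_eq_iff diag_part_def offdiag_part_def sl2_def trace_mat2 algebra_simps)
    ultimately have "((\<lambda>t. G (fst p, t) ** c (B (fst p, t)) ** adj2 (G (fst p, t))) has_vector_derivative
        \<rho> p *\<^sub>R \<psi> p) (at (snd p))"
      by (simp add: \<psi>[OF p] mat2.scaleR_left mat2.scaleR_right)
    then have "((\<lambda>t. partial_x \<psi> (fst p, t)) has_vector_derivative \<rho> p *\<^sub>R \<psi> p) (at (snd p))"
      by (rule has_vector_derivative_transform_within_open[OF _ open_slices(2)[OF U, of "fst p"]])
        (use p in \<open>auto simp: px\<close>)
    then show ?thesis
      by (simp add: partial_y_def[of "partial_x \<psi>"] vector_derivative_at)
  qed
  have sphere: "\<psi> p \<in> pseudosphere" if p: "p \<in> U" for p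
  proof -
    have inv: "adj2 (G p) ** G p = mat 1"
      by (simp add: adj2_mult_self det[OF p])
    have "\<psi> p ** \<psi> p = G p ** kprime ** (adj2 (G p) ** G p) ** kprime ** adj2 (G p)"
      by (simp add: \<psi>[OF p] matrix_mul_assoc)
    also have "\<dots> = G p ** (kprime ** kprime) ** adj2 (G p)"
      by (simp add: inv matrix_mul_assoc matrix_mul_rid)
    also have "kprime ** kprime = (mat 1 :: mat2)"
      by (simp add: mat2_eq_iff)
    finally have "\<psi> p ** \<psi> p = mat 1"
      by (simp add: matrix_mul_rid mult_adj2 det[OF p])
    moreover have "trace (\<psi> p) = 0"
      by (simp add: \<psi>[OF p] trace_mat2 algebra_simps)
    ultimately show ?thesis
      by (simp add: pseudosphere_def sl2_def scal_def trace_mat2[of "mat 1"])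
  qed
  have "tension_field \<psi> p = 0" if p: "p \<in> U" for p
  proof -
    have "scal (\<psi> p) (\<psi> p) = 1"
      using sphere[OF p] by (simp add: pseudosphere_def)
    moreover have "scal (r *\<^sub>R \<psi> p) (\<psi> p) = r * scal (\<psi> p) (\<psi> p)" for r
      by (simp add: scal_def trace_mat2 algebra_simps add_divide_distrib)
    ultimately have "tangential (\<psi> p) (\<rho> p *\<^sub>R \<psi> p) = 0"
      by (simp add: tangential_def)
    then show ?thesis
      by (simp add: tension_field_def pxy[OF p] pyx[OF p])
  qed
  moreover have "smooth_on U \<psi>"
  proof (rule smooth_on_cong[OF U \<psi>])
    have adj: "bounded_linear (adj2 :: mat2 \<Rightarrow> mat2)"
      using linear_adj2 linear_conv_bounded_linear by blast
    show "smooth_on U (\<lambda>p. G p ** kprime ** adj2 (G p))"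
      by (intro smooth_on_bilinear[OF U bounded_bilinear_mat2_mult] smooth smooth_on_const[OF U]
          smooth_on_bounded_linear[OF U adj])
  qed
  ultimately have "harmonic_map U \<psi>"
    using sphere by (simp add: harmonic_map_def)
  then show ?thesis
    by (simp add: \<psi>_def)
qed

section \<open>The generalized Weierstrass representation\<close>

text \<open>Uniqueness of the two solutions is part of the data because
  \<open>dilated_solution\<close> uses it to recognize them inside the paired system.\<close>

locale iwasawa_framing =
  fixes U :: "(real \<times> real) set" and I' I'' :: "real set" and \<xi>' \<xi>'' \<Psi>' \<Psi>'' :: "real \<Rightarrow> loop"
    and \<Psi> Lm Lp :: "real \<times> real \<Rightarrow> loop"
  assumes U: "open U" "(0, 0) \<in> U" "\<And>p. p \<in> U \<Longrightarrow> fst p \<in> I'" "\<And>p. p \<in> U \<Longrightarrow> snd p \<in> I''"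
    and I': "open I'" "convex I'" "0 \<in> I'" and I'': "open I''" "convex I''" "0 \<in> I''"
    and \<xi>': "smooth_on I' \<xi>'" "\<And>t j. t \<in> I' \<Longrightarrow> j > 1 \<Longrightarrow> lcoeff (\<xi>' t) j = 0"
    and \<xi>'': "smooth_on I'' \<xi>''" "\<And>t j. t \<in> I'' \<Longrightarrow> j < - 1 \<Longrightarrow> lcoeff (\<xi>'' t) j = 0"
    and \<Psi>': "solves_ivp I' \<xi>' \<Psi>'" "\<And>\<Phi> t. solves_ivp I' \<xi>' \<Phi> \<Longrightarrow> t \<in> I' \<Longrightarrow> \<Phi> t = \<Psi>' t"
      "smooth_on I' \<Psi>'"
    and \<Psi>'': "solves_ivp I'' \<xi>'' \<Psi>''" "\<And>\<Phi> t. solves_ivp I'' \<xi>'' \<Phi> \<Longrightarrow> t \<in> I'' \<Longrightarrow> \<Phi> t = \<Psi>'' t"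
      "smooth_on I'' \<Psi>''"
    and iwasawa: "\<And>p. p \<in> U \<Longrightarrow> iwasawa (\<Psi>' (fst p)) (\<Psi>'' (snd p)) (\<Psi> p) (Lm p) (Lp p)"
begin

lemma members:
  assumes "p \<in> U"
  shows "\<Psi> p \<in> tLambda_G_sigma" "Lm p \<in> tLambda_minus_star" "Lp p \<in> tLambda_plus"
    "\<Psi> p = \<Psi>' (fst p) * Lm p" "\<Psi> p = \<Psi>'' (snd p) * Lp p"
    "\<Psi>' (fst p) \<in> Lambda_G_sigma" "\<Psi>'' (snd p) \<in> Lambda_G_sigma" "\<Psi> p \<in> Lambda_G_sigma"
  using iwasawa[OF assms] iwasawa_group[OF iwasawa[OF assms]] tLambda_imp_Lambda
  unfolding iwasawa_iff by blast+

lemmas Lm = tLambda_minus_star_D[OF members(2)]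
lemmas Lp = tLambda_plus_D[OF members(3)]

section \<open>Regularity of the factors and of the framing\<close>

lemma smooth_pullback: "smooth_on U (\<lambda>p. \<Psi>' (fst p))" "smooth_on U (\<lambda>p. \<Psi>'' (snd p))"
  by (rule smooth_on_compose_linear[OF U(1) bounded_linear_fst _ \<Psi>'(3)]
      smooth_on_compose_linear[OF U(1) bounded_linear_snd _ \<Psi>''(3)], use U in auto)+

lemma smooth_factors: "smooth_on U Lm" "smooth_on U Lp"
proof -
  let ?H = "\<lambda>p. ladj (\<Psi>' (fst p)) * \<Psi>'' (snd p)"
  have H: "smooth_on U ?H"
    by (intro smooth_on_bilinear[OF U(1) bounded_bilinear_mult]
        smooth_on_bounded_linear[OF U(1) bounded_linear_ladj] smooth_pullback)
  have eq: "Lm p = ?H p * Lp p" if "p \<in> U" for p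
  proof -
    have "?H p * Lp p = ladj (\<Psi>' (fst p)) * (\<Psi>' (fst p) * Lm p)"
      using members(4,5)[OF that] by (simp add: mult.assoc)
    then show ?thesis
      using Lambda_G_sigma_cancel[OF members(6)[OF that]] by simp
  qed
  have HG: "?H p \<in> Lambda_G_sigma" if "p \<in> U" for p
    by (intro Lambda_G_sigma_mult Lambda_G_sigma_ladj members that)
  show "smooth_on U Lm" "smooth_on U Lp"
    using smooth_on_birkhoff_factors[OF U(1) H members(2,3) eq HG] by blast+
qed

lemma smooth_framing: "smooth_on U \<Psi>"
  by (rule smooth_on_cong[OF U(1)], erule members(4))
    (intro smooth_on_bilinear[OF U(1) bounded_bilinear_mult] smooth_pullback smooth_factors)

text \<open>The logarithmic derivative of \<Psi>, expressed through the factorization whose first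
  factor is independent of the variable: \<open>\<Psi>''\<close> for x, and \<open>\<Psi>'\<close>
  for y.\<close>

definition \<omega>x :: "real \<times> real \<Rightarrow> loop" where "\<omega>x p = ladj (Lp p) * partial_x Lp p"
definition \<omega>y :: "real \<times> real \<Rightarrow> loop" where "\<omega>y p = ladj (Lm p) * partial_y Lm p"

lemma slice: "p \<in> U \<Longrightarrow> fst p \<in> {t. (t, snd p) \<in> U}" "p \<in> U \<Longrightarrow> snd p \<in> {t. (fst p, t) \<in> U}"
  by simp_all

lemma maurer_cartan_x:
  assumes p: "p \<in> U"
  shows "((\<lambda>t. \<Psi> (t, snd p)) has_vector_derivative \<Psi> p * \<omega>x p) (at (fst p))"
    and "\<omega>x p = ladj (Lm p) * partial_x Lm p + ladj (Lm p) * \<xi>' (fst p) * Lm p"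
    and "partial_x Lp p = Lp p * \<omega>x p" "ladj (\<omega>x p) = - \<omega>x p" "lsig (\<omega>x p) = \<omega>x p"
proof -
  have d: "(\<Psi>' has_vector_derivative \<Psi>' (fst p) * \<xi>' (fst p)) (at (fst p))"
    using \<Psi>'(1) U(3)[OF p] by (simp add: solves_ivp_def)
  note F = framing_derivative[where \<gamma> = "\<lambda>t. \<Psi> (t, snd p)" and A = "\<lambda>t. Lm (t, snd p)"
      and B = "\<lambda>t. Lp (t, snd p)" and P = \<Psi>' and Q = "\<Psi>'' (snd p)" and t = "fst p",
      OF open_slices(1)[OF U(1)] slice(1)[OF p] smooth_on_partials(1)[OF smooth_factors(1) p]
        smooth_on_partials(1)[OF smooth_factors(2) p] d, of "\<omega>x p"]
  show "((\<lambda>t. \<Psi> (t, snd p)) has_vector_derivative \<Psi> p * \<omega>x p) (at (fst p))"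
    and "\<omega>x p = ladj (Lm p) * partial_x Lm p + ladj (Lm p) * \<xi>' (fst p) * Lm p"
    and "partial_x Lp p = Lp p * \<omega>x p" "ladj (\<omega>x p) = - \<omega>x p" "lsig (\<omega>x p) = \<omega>x p"
    using F members[of "(_, snd p)"] members[OF p] Lm(2)[OF p] Lp(2)[OF p] by (simp_all add: \<omega>x_def)
qed

lemma maurer_cartan_y:
  assumes p: "p \<in> U"
  shows "((\<lambda>t. \<Psi> (fst p, t)) has_vector_derivative \<Psi> p * \<omega>y p) (at (snd p))"
    and "\<omega>y p = ladj (Lp p) * partial_y Lp p + ladj (Lp p) * \<xi>'' (snd p) * Lp p"
    and "ladj (\<omega>y p) = - \<omega>y p" "lsig (\<omega>y p) = \<omega>y p"
proof -
  have d: "(\<Psi>'' has_vector_derivative \<Psi>'' (snd p) * \<xi>'' (snd p)) (at (snd p))"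
    using \<Psi>''(1) U(4)[OF p] by (simp add: solves_ivp_def)
  note F = framing_derivative[where \<gamma> = "\<lambda>t. \<Psi> (fst p, t)" and A = "\<lambda>t. Lp (fst p, t)"
      and B = "\<lambda>t. Lm (fst p, t)" and P = \<Psi>'' and Q = "\<Psi>' (fst p)" and t = "snd p",
      OF open_slices(2)[OF U(1)] slice(2)[OF p] smooth_on_partials(2)[OF smooth_factors(2) p]
        smooth_on_partials(2)[OF smooth_factors(1) p] d, of "\<omega>y p"]
  show "((\<lambda>t. \<Psi> (fst p, t)) has_vector_derivative \<Psi> p * \<omega>y p) (at (snd p))"
    and "\<omega>y p = ladj (Lp p) * partial_y Lp p + ladj (Lp p) * \<xi>'' (snd p) * Lp p"
    and "ladj (\<omega>y p) = - \<omega>y p" "lsig (\<omega>y p) = \<omega>y p"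
    using F members[of "(fst p, _)"] members[OF p] Lm(2)[OF p] Lp(2)[OF p] by (simp_all add: \<omega>y_def)
qed

text \<open>Constant coefficients have derivative zero. The normalization of \<open>Lm\<close> fixes
  its coefficient at 0 as well, so the derivatives of \<open>Lm\<close> start at power -1.\<close>

lemma derivative_supports:
  assumes p: "p \<in> U"
  shows "supp_le (- 1) (partial_x Lm p)" "supp_le (- 1) (partial_y Lm p)"
    and "supp_ge 0 (partial_x Lp p)" "supp_ge 0 (partial_y Lp p)"
proof -
  note Z = lcoeff_derivative_eq_0[OF open_slices(1)[OF U(1)] slice(1)[OF p]]
    and W = lcoeff_derivative_eq_0[OF open_slices(2)[OF U(1)] slice(2)[OF p]]
  have Lm_const: "lcoeff (Lm q) j = (if j = 0 then mat 1 else 0)" if "q \<in> U" "- 1 < j" for q j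
    using Lm(3,4)[OF that(1)] that(2) by (auto simp: supp_le_def)
  show "supp_le (- 1) (partial_x Lm p)" "supp_le (- 1) (partial_y Lm p)"
    unfolding supp_le_def
    using Z[OF _ smooth_on_partials(1)[OF smooth_factors(1) p]] W[OF _ smooth_on_partials(2)[OF smooth_factors(1) p]]
      Lm_const by blast+
  have Lp_const: "lcoeff (Lp q) j = 0" if "q \<in> U" "j < 0" for q j
    using Lp(3)[OF that(1)] that(2) by (auto simp: supp_ge_def)
  show "supp_ge 0 (partial_x Lp p)" "supp_ge 0 (partial_y Lp p)"
    unfolding supp_ge_def
    using Z[OF _ smooth_on_partials(1)[OF smooth_factors(2) p]] W[OF _ smooth_on_partials(2)[OF smooth_factors(2) p]]
      Lp_const by blast+
qed

definition A :: "real \<times> real \<Rightarrow> mat2" where "A p = lcoeff (\<omega>x p) 0"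
definition B :: "real \<times> real \<Rightarrow> mat2" where "B p = lcoeff (\<xi>' (fst p)) 1"
definition Q :: "real \<times> real \<Rightarrow> mat2" where "Q p = lcoeff (Lp p) 0"
definition E :: "real \<times> real \<Rightarrow> mat2" where
  "E p = adj2 (Q p) ** lcoeff (\<xi>'' (snd p)) (- 1) ** Q p"

lemma \<omega>x_eq:
  assumes p: "p \<in> U"
  shows "\<omega>x p = lterm 0 (A p) + lterm 1 (B p)"
proof -
  have ge: "supp_ge 0 (\<omega>x p)"
    using supp_ge_mult[of 0 "ladj (Lp p)" 0 "partial_x Lp p"] Lp(3)[OF p] derivative_supports[OF p]
    by (simp add: \<omega>x_def)
  have \<xi>: "supp_le 1 (\<xi>' (fst p))"
    using \<xi>'(2)[OF U(3)[OF p]] by (simp add: supp_le_def)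
  have 1: "supp_le (- 1) (ladj (Lm p) * partial_x Lm p)"
    using supp_le_mult[of 0 "ladj (Lm p)" "- 1" "partial_x Lm p"] Lm(3)[OF p] derivative_supports[OF p] by simp
  have 2: "supp_le 1 (ladj (Lm p) * \<xi>' (fst p))"
    using supp_le_mult[of 0 "ladj (Lm p)" 1 "\<xi>' (fst p)"] Lm(3)[OF p] \<xi> by simp
  have 3: "supp_le 1 (ladj (Lm p) * \<xi>' (fst p) * Lm p)"
    using supp_le_mult[OF 2 Lm(3)[OF p]] by simp
  have le: "supp_le 1 (\<omega>x p)"
    unfolding maurer_cartan_x(2)[OF p] by (rule supp_add(1)[OF supp_le_mono[OF 1] 3]) simp
  \<comment> \<open>At the top power only the constant terms of \<open>Lm\<close> and of its inverse
    contribute, and both are the identity.\<close>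
  have "lcoeff (ladj (Lm p) * \<xi>' (fst p) * Lm p) 1 = B p"
    using lcoeff_times_top[OF 2 Lm(3)[OF p]] lcoeff_times_top[of 0 "ladj (Lm p)" 1 "\<xi>' (fst p)"] Lm(3,4)[OF p] \<xi>
    by (simp add: lcoeff_ladj B_def matrix_mul_lid matrix_mul_rid)
  then have "lcoeff (\<omega>x p) 1 = B p"
    using 1 unfolding maurer_cartan_x(2)[OF p] by (simp add: plus_loop.rep_eq supp_le_def)
  moreover have "lcoeff (\<omega>x p) j = 0" if "j \<noteq> 0" "j \<noteq> 1" for j
    using ge le that unfolding supp_ge_def supp_le_def by (cases "j < 0") auto
  ultimately show ?thesis
    by (intro loop_eqI) (simp add: plus_loop.rep_eq lterm.rep_eq A_def)
qed

lemma \<omega>y_eq: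
  assumes p: "p \<in> U"
  shows "\<omega>y p = lterm (- 1) (E p)"
proof -
  \<comment> \<open>Power 0 is excluded here, so the diagonal coefficient of the y-component of the
    framing vanishes.\<close>
  have le: "supp_le (- 1) (\<omega>y p)"
    using supp_le_mult[of 0 "ladj (Lm p)" "- 1" "partial_y Lm p"] Lm(3)[OF p] derivative_supports[OF p]
    by (simp add: \<omega>y_def)
  have \<xi>: "supp_ge (- 1) (\<xi>'' (snd p))"
    using \<xi>''(2)[OF U(4)[OF p]] by (simp add: supp_ge_def)
  have 1: "supp_ge 0 (ladj (Lp p) * partial_y Lp p)"
    using supp_ge_mult[of 0 "ladj (Lp p)" 0 "partial_y Lp p"] Lp(3)[OF p] derivative_supports[OF p] by simp
  have 2: "supp_ge (- 1) (ladj (Lp p) * \<xi>'' (snd p))"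
    using supp_ge_mult[of 0 "ladj (Lp p)" "- 1" "\<xi>'' (snd p)"] Lp(3)[OF p] \<xi> by simp
  have 3: "supp_ge (- 1) (ladj (Lp p) * \<xi>'' (snd p) * Lp p)"
    using supp_ge_mult[OF 2 Lp(3)[OF p]] by simp
  have ge: "supp_ge (- 1) (\<omega>y p)"
    unfolding maurer_cartan_y(2)[OF p]
    by (rule supp_add(2)[OF _ 3]) (use 1 in \<open>simp add: supp_ge_def\<close>)
  have "lcoeff (ladj (Lp p) * \<xi>'' (snd p) * Lp p) (- 1) = E p"
    using lcoeff_times_bot[OF 2 Lp(3)[OF p]] lcoeff_times_bot[of 0 "ladj (Lp p)" "- 1" "\<xi>'' (snd p)"] Lp(3)[OF p] \<xi>
    by (simp add: lcoeff_ladj E_def Q_def)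
  then have "lcoeff (\<omega>y p) (- 1) = E p"
    using 1 unfolding maurer_cartan_y(2)[OF p] by (simp add: plus_loop.rep_eq supp_ge_def)
  moreover have "lcoeff (\<omega>y p) j = 0" if "j \<noteq> - 1" for j
    using ge le that unfolding supp_ge_def supp_le_def by (cases "j < - 1") auto
  ultimately show ?thesis
    by (intro loop_eqI) (simp add: lterm.rep_eq)
qed

lemma parts:
  assumes "p \<in> U"
  shows "A p \<in> diag_part" "B p \<in> offdiag_part" "E p \<in> offdiag_part"
  using Lambda_g_sigma_coeff(1)[OF maurer_cartan_x(4,5)[OF assms], of 0]
    Lambda_g_sigma_coeff(2)[OF maurer_cartan_x(4,5)[OF assms], of 1]
    Lambda_g_sigma_coeff(2)[OF maurer_cartan_y(3,4)[OF assms], of "- 1"]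
  by (simp_all add: \<omega>x_eq[OF assms] \<omega>y_eq[OF assms] plus_loop.rep_eq lterm.rep_eq)

text \<open>The coefficient at 0 of \<open>partial_x Lp p = Lp p * \<omega>x p\<close> says that the
  x-derivative of \<open>Q\<close> is \<open>Q ** A\<close>. As \<xi>'' does not depend on x,
  differentiating the conjugation gives the bracket.\<close>

lemma E_derivative:
  assumes p: "p \<in> U"
  shows "((\<lambda>t. E (t, snd p)) has_vector_derivative E p ** A p - A p ** E p) (at (fst p))"
proof -
  have adj: "bounded_linear (adj2 :: mat2 \<Rightarrow> mat2)"
    using linear_adj2 linear_conv_bounded_linear by blast
  define X where "X = lcoeff (\<xi>'' (snd p)) (- 1)"
  have "supp_ge 0 (\<omega>x p)"
    by (auto simp: \<omega>x_eq[OF p] supp_ge_def plus_loop.rep_eq lterm.rep_eq)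
  then have "lcoeff (partial_x Lp p) 0 = Q p ** A p"
    using lcoeff_times_bot[of 0 "Lp p" 0 "\<omega>x p"] Lp(3)[OF p] maurer_cartan_x(3)[OF p]
    by (simp add: Q_def A_def)
  then have Q: "((\<lambda>t. Q (t, snd p)) has_vector_derivative Q p ** A p) (at (fst p))"
    using bounded_linear.has_vector_derivative[OF bounded_linear_lcoeff
        smooth_on_partials(1)[OF smooth_factors(2) p], of 0]
    by (simp add: Q_def)
  have "((\<lambda>t. adj2 (Q (t, snd p)) ** X ** Q (t, snd p)) has_vector_derivative
      adj2 (Q p) ** X ** (Q p ** A p) + (adj2 (Q p) ** 0 + adj2 (Q p ** A p) ** X) ** Q p) (at (fst p))"
    using bounded_bilinear.has_vector_derivative[OF bounded_bilinear_mat2_mult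
        bounded_bilinear.has_vector_derivative[OF bounded_bilinear_mat2_mult
          bounded_linear.has_vector_derivative[OF adj Q] has_vector_derivative_const[of X]] Q]
    by simp
  moreover have "adj2 (A p) = - A p"
    using parts(1)[OF p] by (simp add: diag_part_def sl2_def trace_mat2 mat2_eq_iff)
  ultimately show ?thesis
    by (simp add: E_def X_def adj2_mult matrix_mul_assoc mat2.minus_left mat2.minus_right mat2.zero_right)
qed

lemma B_derivative: "((\<lambda>t. B (fst p, t)) has_vector_derivative 0) (at (snd p))"
  by (simp add: B_def)

text \<open>The Wiener norm on the circle does not control evaluation at \<open>l \<noteq> 1\<close>.  Of the two
  factorizations \<open>\<Psi> = \<Psi>' Lm = \<Psi>'' Lp\<close>, the first survives the dilation for \<open>l \<ge> 1\<close>,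
  the second for \<open>l \<le> 1\<close>.\<close>

lemma dilated_framing:
  assumes l: "l > 0"
  obtains \<Theta> where "smooth_on U \<Theta>" "\<And>p. p \<in> U \<Longrightarrow> dilated l (\<Psi> p) (\<Theta> p)"
proof (cases "l \<ge> 1")
  case True
  \<comment> \<open>Exponents up to 1 cover both \<xi>' and \<open>Lm\<close>; for
    \<open>l \<ge> 1\<close> the largest factor is the one at exponent 1.\<close>
  have bound: "\<bar>l powi j\<bar> \<le> l" if "j \<le> 1" for j
    using power_int_increasing[of j 1 l] True that by simp
  obtain \<Phi> where \<Phi>: "smooth_on I' \<Phi>" "\<And>t. t \<in> I' \<Longrightarrow> dilated l (\<Psi>' t) (\<Phi> t)"
    by (rule dilated_solution[where \<Psi> = \<Psi>' and J = "{..1}" and l = l and C = l, OF I' \<xi>'(1)],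
        erule (1) \<Psi>'(2)) (use \<xi>'(2) bound l in auto)
  have bnd: "\<And>j. j \<in> {..0} \<Longrightarrow> \<bar>l powi j\<bar> \<le> l" "0 \<le> l"
    using bound l by auto
  show ?thesis
  proof (rule that)
    have "smooth_on U (\<lambda>p. \<Phi> (fst p))"
      by (rule smooth_on_compose_linear[OF U(1) bounded_linear_fst _ \<Phi>(1)]) (use U in auto)
    then show "smooth_on U (\<lambda>p. \<Phi> (fst p) * lscale l {..0} (Lm p))"
      by (intro smooth_on_bilinear[OF U(1) bounded_bilinear_mult] smooth_factors
          smooth_on_bounded_linear[OF U(1) bounded_linear_lscale[OF bnd]])
    show "dilated l (\<Psi> p) (\<Phi> (fst p) * lscale l {..0} (Lm p))" if p: "p \<in> U" for p
      unfolding members(4)[OF p]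
      by (intro dilated_mult \<Phi> U p dilated_lscale[OF bnd])
        (use l Lm(3)[OF p] in \<open>auto simp: supp_le_def\<close>)
  qed
next
  case False
  have bound: "\<bar>l powi j\<bar> \<le> l powi (- 1)" if "- 1 \<le> j" for j
    using power_int_decreasing[of "- 1" j l] False l that by simp
  have nn: "0 \<le> l powi (- 1)" using l by simp
  obtain \<Phi> where \<Phi>: "smooth_on I'' \<Phi>" "\<And>t. t \<in> I'' \<Longrightarrow> dilated l (\<Psi>'' t) (\<Phi> t)"
    by (rule dilated_solution[where \<Psi> = \<Psi>'' and J = "{- 1..}" and l = l and C = "l powi (- 1)",
        OF I'' \<xi>''(1)], erule (1) \<Psi>''(2))
      (use \<xi>''(2) bound l in auto)
  have bnd: "\<And>j. j \<in> {0..} \<Longrightarrow> \<bar>l powi j\<bar> \<le> l powi (- 1)"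
    using bound by auto
  show ?thesis
  proof (rule that)
    have "smooth_on U (\<lambda>p. \<Phi> (snd p))"
      by (rule smooth_on_compose_linear[OF U(1) bounded_linear_snd _ \<Phi>(1)]) (use U in auto)
    then show "smooth_on U (\<lambda>p. \<Phi> (snd p) * lscale l {0..} (Lp p))"
      by (intro smooth_on_bilinear[OF U(1) bounded_bilinear_mult] smooth_factors
          smooth_on_bounded_linear[OF U(1) bounded_linear_lscale[OF bnd nn]])
    show "dilated l (\<Psi> p) (\<Phi> (snd p) * lscale l {0..} (Lp p))" if p: "p \<in> U" for p
      unfolding members(5)[OF p]
      by (intro dilated_mult \<Phi> U p dilated_lscale[OF bnd nn])
        (use l Lp(3)[OF p] in \<open>auto simp: supp_ge_def\<close>)
  qed
qed

lemma extended_framing: "extended_framing U \<Psi>"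
proof -
  have "\<Psi>' 0 = 1" "\<Psi>'' 0 = 1"
    using \<Psi>' \<Psi>'' by (simp_all add: solves_ivp_def)
  then have "iwasawa 1 1 (\<Psi> (0, 0)) (Lm (0, 0)) (Lp (0, 0))"
    using iwasawa[OF U(2)] by simp
  \<comment> \<open>Both solutions start at 1, so uniqueness against the trivial decomposition gives
    the initial value of the framing.\<close>
  moreover have "iwasawa 1 1 1 1 1"
    by (simp add: iwasawa_iff tLambda_minus_star_iff tLambda_plus_iff tLambda_G_sigma_one lcoeff_one)
  ultimately have one: "\<Psi> (0, 0) = 1"
    by (rule iwasawa_unique(1))
  have mc: "loop_inv (\<Psi> p) * partial_x \<Psi> p = lterm 0 (A p) + lterm 1 (B p)"
    "loop_inv (\<Psi> p) * partial_y \<Psi> p = lterm 0 0 + lterm (- 1) (E p)" if p: "p \<in> U" for p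
  proof -
    have "partial_x \<Psi> p = \<Psi> p * \<omega>x p" "partial_y \<Psi> p = \<Psi> p * \<omega>y p"
      using maurer_cartan_x(1)[OF p] maurer_cartan_y(1)[OF p]
      by (simp_all add: partial_x_def partial_y_def vector_derivative_at)
    moreover have "lterm 0 0 = 0"
      by (rule loop_eqI) (simp add: lterm.rep_eq zero_loop.rep_eq)
    ultimately show "loop_inv (\<Psi> p) * partial_x \<Psi> p = lterm 0 (A p) + lterm 1 (B p)"
      "loop_inv (\<Psi> p) * partial_y \<Psi> p = lterm 0 0 + lterm (- 1) (E p)"
      using members(8)[OF p]
      by (simp_all add: loop_inv_Lambda_G_sigma Lambda_G_sigma_cancel \<omega>x_eq[OF p] \<omega>y_eq[OF p])
  qed
  have "0 \<in> diag_part"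
    by (simp add: diag_part_def sl2_def trace_mat2)
  then show ?thesis
    unfolding extended_framing_def
    using smooth_framing members(1) one mc parts
    by (intro conjI exI[of _ A] exI[of _ B] exI[of _ "\<lambda>_. 0"] exI[of _ E] ballI) auto
qed

text \<open>Dilation fixes \<open>A\<close> and multiplies \<open>B\<close> by \<open>l\<close> and
  \<open>E\<close> by its inverse. The two integrability equations are linear in \<open>B\<close>
  and in \<open>E\<close>, so they persist for each \<open>l\<close>.\<close>

lemma loop_of_harmonic_maps: "loop_of_harmonic_maps U (\<lambda>l p. Ad (loop_val l (\<Psi> p)) kprime)"
  unfolding loop_of_harmonic_maps_def
proof (intro allI impI)
  fix l :: real assume l: "l > 0"
  obtain \<Theta> where \<Theta>: "smooth_on U \<Theta>" "\<And>p. p \<in> U \<Longrightarrow> dilated l (\<Psi> p) (\<Theta> p)"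
    using dilated_framing[OF l] by blast
  define G where "G = (\<lambda>p. loop_val l (\<Psi> p))"
  have G_eq: "G p = loop_val 1 (\<Theta> p)" if "p \<in> U" for p
    unfolding G_def by (rule loop_val_dilated[OF \<Theta>(2)[OF that]])
  have "smooth_on U G"
    by (rule smooth_on_cong[OF U(1)], erule G_eq) (intro smooth_on_bounded_linear[OF U(1) bounded_linear_loop_val] \<Theta>)
  moreover have "det (G p) = 1" if p: "p \<in> U" for p
  proof -
    have "dilated l (\<Psi> p * ladj (\<Psi> p)) (\<Theta> p * ladj (\<Theta> p))"
      by (intro dilated_mult dilated_ladj \<Theta> p) (use l in simp)
    then have "\<Theta> p * ladj (\<Theta> p) = 1"
      using dilated_unique[OF _ dilated_one] Lambda_G_sigma_cancel[OF members(8)[OF p]] by simp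
    then have "mat (det (G p)) = loop_val 1 1"
      by (simp add: G_eq[OF p] mult_adj2[symmetric] loop_val_ladj[symmetric] loop_val_mult[symmetric])
    then show ?thesis
      by (simp add: one_loop_def loop_val_lterm mat2_eq_iff)
  qed
  moreover have "((\<lambda>t. G (t, snd p)) has_vector_derivative G p ** (A p + l *\<^sub>R B p)) (at (fst p))"
    if p: "p \<in> U" for p
  proof -
    have "dilated l (\<omega>x p) (lterm 0 (A p) + lterm 1 (l *\<^sub>R B p))"
      unfolding \<omega>x_eq[OF p] using dilated_add[OF dilated_lterm[of l 0 "A p"] dilated_lterm[of l 1 "B p"]] by simp
    from dilated_derivative[OF open_slices(1)[OF U(1)] slice(1)[OF p] _ _ this _ smooth_on_partials(1)[OF \<Theta>(1) p],
        of "\<lambda>t. \<Psi> (t, snd p)"]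
    have "((\<lambda>t. loop_val 1 (\<Theta> (t, snd p))) has_vector_derivative G p ** (A p + l *\<^sub>R B p)) (at (fst p))"
      using maurer_cartan_x(1)[OF p] l \<Theta>(2)
      by (simp add: G_eq[OF p] linear_add[OF bounded_linear.linear[OF bounded_linear_loop_val]] loop_val_lterm)
    then show ?thesis
      by (rule has_vector_derivative_transform_within_open[OF _ open_slices(1)[OF U(1), of "snd p"]])
        (use p in \<open>auto simp: G_eq\<close>)
  qed
  moreover have "((\<lambda>t. G (fst p, t)) has_vector_derivative G p ** (inverse l *\<^sub>R E p)) (at (snd p))"
    if p: "p \<in> U" for p
  proof -
    have "dilated l (\<omega>y p) (lterm (- 1) (inverse l *\<^sub>R E p))"
      unfolding \<omega>y_eq[OF p] using dilated_lterm[of l "- 1" "E p"] by (simp add: power_int_minus)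
    from dilated_derivative[OF open_slices(2)[OF U(1)] slice(2)[OF p] _ _ this _ smooth_on_partials(2)[OF \<Theta>(1) p],
        of "\<lambda>t. \<Psi> (fst p, t)"]
    have "((\<lambda>t. loop_val 1 (\<Theta> (fst p, t))) has_vector_derivative G p ** (inverse l *\<^sub>R E p)) (at (snd p))"
      using maurer_cartan_y(1)[OF p] l \<Theta>(2) by (simp add: G_eq[OF p] loop_val_lterm)
    then show ?thesis
      by (rule has_vector_derivative_transform_within_open[OF _ open_slices(2)[OF U(1), of "fst p"]])
        (use p in \<open>auto simp: G_eq\<close>)
  qed
  moreover have "r *\<^sub>R X \<in> offdiag_part" if "X \<in> offdiag_part" for r X
    using that by (auto simp: offdiag_part_def sl2_def trace_mat2 distrib_left[symmetric])
  moreover have "((\<lambda>t. l *\<^sub>R B (fst p, t)) has_vector_derivative 0) (at (snd p))" for p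
    using bounded_linear.has_vector_derivative[OF bounded_linear_scaleR_right B_derivative, of l] by simp
  moreover have "((\<lambda>t. inverse l *\<^sub>R E (t, snd p)) has_vector_derivative
      inverse l *\<^sub>R E p ** A p - A p ** inverse l *\<^sub>R E p) (at (fst p))" if "p \<in> U" for p
    using bounded_linear.has_vector_derivative[OF bounded_linear_scaleR_right E_derivative[OF that], of "inverse l"]
    by (simp add: scaleR_diff_right mat2.scaleR_left mat2.scaleR_right)
  ultimately have "harmonic_map U (\<lambda>p. Ad (G p) kprime)"
    using parts by (intro harmonic_map_of_framing[OF U(1), where B = "\<lambda>p. l *\<^sub>R B p" and E = "\<lambda>p. inverse l *\<^sub>R E p"]) auto
  then show "harmonic_map U (\<lambda>p. Ad (loop_val l (\<Psi> p)) kprime)"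
    by (simp add: G_def)
qed

end

section \<open>From the region to its coordinate intervals, and the final assembly\<close>

lemma minkowski_region_projections:
  assumes "minkowski_region D"
  shows "open (fst ` D)" "convex (fst ` D)" "0 \<in> fst ` D"
    and "open (snd ` D)" "convex (snd ` D)" "0 \<in> snd ` D"
proof -
  have D: "open D" "connected D" "(0, 0) \<in> D"
    using assms simply_connected_imp_connected by (auto simp: minkowski_region_def)
  show "open (fst ` D)" "open (snd ` D)"
    by (rule open_image_fst[OF D(1)] open_image_snd[OF D(1)])+
  have "connected (fst ` D)" "connected (snd ` D)"
    by (intro connected_continuous_image D continuous_intros)+
  then show "convex (fst ` D)" "convex (snd ` D)"
    using is_interval_connected_1 is_interval_convex_1 by blast+
  show "0 \<in> fst ` D" "0 \<in> snd ` D"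
    using D(3) by force+
qed

text \<open>The potentials only guarantee solutions among absolutely summable loops, so openness of
  the decomposable set is stated for solutions that extend analytically. In the last clause \<Psi>,
  \<open>Lm\<close> and \<open>Lp\<close> are arbitrary functions that decompose pointwise; their
  smoothness is proved, not assumed.\<close>

theorem theorem4p3:
  fixes D :: "(real \<times> real) set" and \<xi>' \<xi>'' :: "real \<Rightarrow> loop"
  assumes "minkowski_region D"
    and "\<xi>' \<in> potentials' D" and "\<xi>'' \<in> potentials'' D"
  shows "\<exists>\<Psi>' \<Psi>''.
    solves_ivp (fst ` D) \<xi>' \<Psi>' \<and> (\<forall>x \<in> fst ` D. \<Psi>' x \<in> Lambda_G_sigma) \<and>
    (\<forall>\<Phi>. solves_ivp (fst ` D) \<xi>' \<Phi> \<longrightarrow> (\<forall>x \<in> fst ` D. \<Phi> x = \<Psi>' x)) \<and>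
    solves_ivp (snd ` D) \<xi>'' \<Psi>'' \<and> (\<forall>y \<in> snd ` D. \<Psi>'' y \<in> Lambda_G_sigma) \<and>
    (\<forall>\<Phi>. solves_ivp (snd ` D) \<xi>'' \<Phi> \<longrightarrow> (\<forall>y \<in> snd ` D. \<Phi> y = \<Psi>'' y)) \<and>
    (0, 0) \<in> iwasawa_domain D \<Psi>' \<Psi>'' \<and>
    (\<forall>(x, y) \<in> iwasawa_domain D \<Psi>' \<Psi>''.
       \<exists>!(\<gamma>, Lm, Lp). iwasawa (\<Psi>' x) (\<Psi>'' y) \<gamma> Lm Lp) \<and>
    ((\<forall>x \<in> fst ` D. \<Psi>' x \<in> tLambda_G_sigma) \<and> (\<forall>y \<in> snd ` D. \<Psi>'' y \<in> tLambda_G_sigma) \<longrightarrow>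
       open (iwasawa_domain D \<Psi>' \<Psi>'')) \<and>
    (\<forall>U \<Psi> Lm Lp.
       open U \<and> (0, 0) \<in> U \<and> U \<subseteq> D \<and>
       (\<forall>(x, y) \<in> U. iwasawa (\<Psi>' x) (\<Psi>'' y) (\<Psi> (x, y)) (Lm (x, y)) (Lp (x, y))) \<longrightarrow>
       extended_framing U \<Psi> \<and>
       loop_of_harmonic_maps U (\<lambda>l p. Ad (loop_val l (\<Psi> p)) kprime))"
proof -
  note I = minkowski_region_projections[OF assms(1)]
  have D: "open D" "(0, 0) \<in> D"
    using assms(1) by (auto simp: minkowski_region_def)
  have \<xi>': "smooth_on (fst ` D) \<xi>'" "\<And>t. t \<in> fst ` D \<Longrightarrow> \<xi>' t \<in> Lambda_g_sigma"
    "\<And>t j. t \<in> fst ` D \<Longrightarrow> j > 1 \<Longrightarrow> lcoeff (\<xi>' t) j = 0"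
    using assms(2) unfolding potentials'_def by blast+
  have \<xi>'': "smooth_on (snd ` D) \<xi>''" "\<And>t. t \<in> snd ` D \<Longrightarrow> \<xi>'' t \<in> Lambda_g_sigma"
    "\<And>t j. t \<in> snd ` D \<Longrightarrow> j < - 1 \<Longrightarrow> lcoeff (\<xi>'' t) j = 0"
    using assms(3) unfolding potentials''_def by blast+
  obtain \<Psi>' where \<Psi>': "solves_ivp (fst ` D) \<xi>' \<Psi>'" "\<And>t. t \<in> fst ` D \<Longrightarrow> \<Psi>' t \<in> Lambda_G_sigma"
    "\<And>\<Phi> t. solves_ivp (fst ` D) \<xi>' \<Phi> \<Longrightarrow> t \<in> fst ` D \<Longrightarrow> \<Phi> t = \<Psi>' t" "smooth_on (fst ` D) \<Psi>'"
    using potential_ivp[OF I(1-3) \<xi>'(1,2)] by blast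
  obtain \<Psi>'' where \<Psi>'': "solves_ivp (snd ` D) \<xi>'' \<Psi>''" "\<And>t. t \<in> snd ` D \<Longrightarrow> \<Psi>'' t \<in> Lambda_G_sigma"
    "\<And>\<Phi> t. solves_ivp (snd ` D) \<xi>'' \<Phi> \<Longrightarrow> t \<in> snd ` D \<Longrightarrow> \<Phi> t = \<Psi>'' t" "smooth_on (snd ` D) \<Psi>''"
    using potential_ivp[OF I(4-6) \<xi>''(1,2)] by blast
  have origin: "(0, 0) \<in> iwasawa_domain D \<Psi>' \<Psi>''"
  proof -
    have "\<Psi>' 0 = 1" "\<Psi>'' 0 = 1"
      using \<Psi>'(1) \<Psi>''(1) by (simp_all add: solves_ivp_def)
    then have "iwasawa (\<Psi>' 0) (\<Psi>'' 0) 1 1 1"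
      by (simp add: iwasawa_iff tLambda_minus_star_iff tLambda_plus_iff tLambda_G_sigma_one lcoeff_one)
    then show ?thesis
      using D(2) by (auto simp: iwasawa_domain_def)
  qed
  have unique: "\<forall>(x, y) \<in> iwasawa_domain D \<Psi>' \<Psi>''. \<exists>!(\<gamma>, Lm, Lp). iwasawa (\<Psi>' x) (\<Psi>'' y) \<gamma> Lm Lp"
  proof clarify
    fix x y assume "(x, y) \<in> iwasawa_domain D \<Psi>' \<Psi>''"
    then obtain \<gamma> Lm Lp where iw: "iwasawa (\<Psi>' x) (\<Psi>'' y) \<gamma> Lm Lp"
      by (auto simp: iwasawa_domain_def)
    show "\<exists>!(\<gamma>, Lm, Lp). iwasawa (\<Psi>' x) (\<Psi>'' y) \<gamma> Lm Lp"
    proof (rule ex1I[of _ "(\<gamma>, Lm, Lp)"])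
      fix T assume T: "case T of (\<gamma>, Lm, Lp) \<Rightarrow> iwasawa (\<Psi>' x) (\<Psi>'' y) \<gamma> Lm Lp"
      obtain \<delta> Mm Mp where "T = (\<delta>, Mm, Mp)" by (cases T)
      then show "T = (\<gamma>, Lm, Lp)"
        using T iwasawa_unique[OF _ iw, of \<delta> Mm Mp] by simp
    qed (use iw in simp)
  qed
  have opn: "open (iwasawa_domain D \<Psi>' \<Psi>'')"
    if "\<forall>x \<in> fst ` D. \<Psi>' x \<in> tLambda_G_sigma" "\<forall>y \<in> snd ` D. \<Psi>'' y \<in> tLambda_G_sigma"
    by (rule open_iwasawa_domain[OF D(1) smooth_on_continuous_on[OF \<Psi>'(4)] smooth_on_continuous_on[OF \<Psi>''(4)]])
      (use that in auto)
  have framing: "extended_framing U \<Psi> \<and> loop_of_harmonic_maps U (\<lambda>l p. Ad (loop_val l (\<Psi> p)) kprime)"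
    if U: "open U" "(0, 0) \<in> U" "U \<subseteq> D"
      and iw: "\<forall>(x, y) \<in> U. iwasawa (\<Psi>' x) (\<Psi>'' y) (\<Psi> (x, y)) (Lm (x, y)) (Lp (x, y))"
    for U \<Psi> Lm Lp
  proof -
    interpret iwasawa_framing U "fst ` D" "snd ` D" \<xi>' \<xi>'' \<Psi>' \<Psi>'' \<Psi> Lm Lp
    proof
      show "iwasawa (\<Psi>' (fst p)) (\<Psi>'' (snd p)) (\<Psi> p) (Lm p) (Lp p)" if "p \<in> U" for p
        using iw that by (cases p) auto
    qed (fact U I \<xi>'(1,3) \<xi>''(1,3) \<Psi>'(1,3,4) \<Psi>''(1,3,4) | use U(3) in blast)+
    show ?thesis
      using extended_framing loop_of_harmonic_maps by blast
  qed
  show ?thesis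
  proof (rule exI[of _ \<Psi>'], rule exI[of _ \<Psi>''], intro conjI)
    show "\<forall>\<Phi>. solves_ivp (fst ` D) \<xi>' \<Phi> \<longrightarrow> (\<forall>x \<in> fst ` D. \<Phi> x = \<Psi>' x)"
      by (intro allI impI ballI) (rule \<Psi>'(3))
    show "\<forall>\<Phi>. solves_ivp (snd ` D) \<xi>'' \<Phi> \<longrightarrow> (\<forall>y \<in> snd ` D. \<Phi> y = \<Psi>'' y)"
      by (intro allI impI ballI) (rule \<Psi>''(3))
    show "(\<forall>x \<in> fst ` D. \<Psi>' x \<in> tLambda_G_sigma) \<and> (\<forall>y \<in> snd ` D. \<Psi>'' y \<in> tLambda_G_sigma) \<longrightarrow>
        open (iwasawa_domain D \<Psi>' \<Psi>'')"
      using opn by blast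
    show "\<forall>U \<Psi> Lm Lp.
       open U \<and> (0, 0) \<in> U \<and> U \<subseteq> D \<and>
       (\<forall>(x, y) \<in> U. iwasawa (\<Psi>' x) (\<Psi>'' y) (\<Psi> (x, y)) (Lm (x, y)) (Lp (x, y))) \<longrightarrow>
       extended_framing U \<Psi> \<and>
       loop_of_harmonic_maps U (\<lambda>l p. Ad (loop_val l (\<Psi> p)) kprime)"
      by (intro allI impI, elim conjE) (rule framing)
  qed (use \<Psi>'(1,2) \<Psi>''(1,2) origin unique in blast)+
qed

end
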